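(* Let $\mathcal{C}$ be the monoidal category of finite dimensional complex $\mathfrak{sl}_2$-modules. Locally finitary, admissible, simple transitive $\mathcal{C}$-module categories of type $B_\infty$ over the complex numbers do not exist.
   Context: $\mathcal{C}$ is the monoidal category (under $\otimes_{\mathbb{C}}$) of finite dimensional $\mathfrak{sl}_2$-modules over $\mathbb{C}$; $L(1)$ is the simple module of dimension $2$. A $\mathcal{C}$-module category $\mathcal{M}$ is locally finitary if it is $\mathbb{C}$-linear, additive, idempotent split, Krull-Schmidt, has at most countably many indecomposable objects up to isomorphism, and has finite dimensional hom-spaces. It is simple transitive if it has no non-trivial $\mathcal{C}$-invariant ideals (ideals other than $0$ and $\mathcal{M}$). It is of type $B_\infty$ if its indecomposables, up to isomorphism, can be listed without repetition as $X_1,X_2,X_3,\dots$ so that $L(1)\cdot X_1\cong X_2\oplus X_2$ and $L(1)\cdot X_i\cong X_{i-1}\oplus X_{i+1}$ for $i\geq 2$. The projective abelianization $\overline{\mathcal{M}}$ has as objects diagrams $X\to Y$ over $\mathcal{M}$ and as morphisms commutative squares modulo those whose component $Y\to Y'$ factors through $X'\to Y'$. $\mathcal{M}$ is called admissible if it has weak kernels; equivalently, $\overline{\mathcal{M}}$ is abelian, with $\mathcal{M}$ embedded, via $P\mapsto (0\to P)$, as the category of projective objects. *)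

theory Defs
  imports
    "Jordan_Normal_Form.VS_Connect"
    "HOL-Library.FuncSet"
    "HOL-Library.Countable_Set"
begin

abbreviation complex_field :: "complex ring"
  where "complex_field \<equiv> class_ring"


section \<open>Linear categories\<close>

text \<open>
  Every arrow determines its source and target, so distinct hom-spaces are disjoint.
  Composition is written in the usual order: \<open>g \<cdot> f\<close> is \<open>g\<close> after \<open>f\<close>.
\<close>

record ('o, 'a) lin_cat =
  Obj :: "'o set"
  Arr :: "'a set"
  Dom :: "'a \<Rightarrow> 'o"
  Cod :: "'a \<Rightarrow> 'o"
  Idn :: "'o \<Rightarrow> 'a"
  Cmp :: "'a \<Rightarrow> 'a \<Rightarrow> 'a"  (infixr \<open>\<cdot>\<index>\<close> 75)
  Nul :: "'o \<Rightarrow> 'o \<Rightarrow> 'a"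
  Pls :: "'a \<Rightarrow> 'a \<Rightarrow> 'a"
  Scl :: "complex \<Rightarrow> 'a \<Rightarrow> 'a"

definition homset :: "('o, 'a, 'z) lin_cat_scheme \<Rightarrow> 'o \<Rightarrow> 'o \<Rightarrow> 'a set"
  where "homset C X Y = {f \<in> Arr C. Dom C f = X \<and> Cod C f = Y}"

text \<open>
  The fields \<^const>\<open>mult\<close> and \<^const>\<open>one\<close> are irrelevant for the vector space structure; for
  \<open>X = Y\<close> they make \<open>homsp C X X\<close> the endomorphism ring of \<open>X\<close>.
\<close>

definition homsp :: "('o, 'a, 'z) lin_cat_scheme \<Rightarrow> 'o \<Rightarrow> 'o \<Rightarrow> (complex, 'a) module"
  where "homsp C X Y =
    \<lparr> carrier = homset C X Y, mult = Cmp C, one = Idn C X,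
      zero = Nul C X Y, add = Pls C, smult = Scl C \<rparr>"

locale linear_category =
  fixes C :: "('o, 'a, 'z) lin_cat_scheme" (structure)
  assumes Dom_in: "f \<in> Arr C \<Longrightarrow> Dom C f \<in> Obj C"
    and Cod_in: "f \<in> Arr C \<Longrightarrow> Cod C f \<in> Obj C"
    and Idn_in: "X \<in> Obj C \<Longrightarrow> Idn C X \<in> homset C X X"
    and Cmp_in: "\<lbrakk>f \<in> homset C X Y; g \<in> homset C Y Z\<rbrakk> \<Longrightarrow> g \<cdot> f \<in> homset C X Z"
    and Cmp_assoc: "\<lbrakk>f \<in> homset C W X; g \<in> homset C X Y; h \<in> homset C Y Z\<rbrakk>
      \<Longrightarrow> (h \<cdot> g) \<cdot> f = h \<cdot> (g \<cdot> f)"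
    and Idn_left: "f \<in> homset C X Y \<Longrightarrow> Idn C Y \<cdot> f = f"
    and Idn_right: "f \<in> homset C X Y \<Longrightarrow> f \<cdot> Idn C X = f"
    and hom_vectorspace: "\<lbrakk>X \<in> Obj C; Y \<in> Obj C\<rbrakk> \<Longrightarrow> vectorspace complex_field (homsp C X Y)"
    and Cmp_linear_right: "\<lbrakk>X \<in> Obj C; g \<in> homset C Y Z\<rbrakk>
      \<Longrightarrow> linear_map complex_field (homsp C X Y) (homsp C X Z) (\<lambda>f. g \<cdot> f)"
    and Cmp_linear_left: "\<lbrakk>f \<in> homset C X Y; Z \<in> Obj C\<rbrakk>
      \<Longrightarrow> linear_map complex_field (homsp C Y Z) (homsp C X Z) (\<lambda>g. g \<cdot> f)"

definition is_iso :: "('o, 'a, 'z) lin_cat_scheme \<Rightarrow> 'o \<Rightarrow> 'o \<Rightarrow> 'a \<Rightarrow> bool"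
  where "is_iso C X Y f \<longleftrightarrow> f \<in> homset C X Y \<and>
    (\<exists>g \<in> homset C Y X. Cmp C g f = Idn C X \<and> Cmp C f g = Idn C Y)"

definition isomorphic :: "('o, 'a, 'z) lin_cat_scheme \<Rightarrow> 'o \<Rightarrow> 'o \<Rightarrow> bool"
  where "isomorphic C X Y \<longleftrightarrow> (\<exists>f. is_iso C X Y f)"

definition zero_object :: "('o, 'a, 'z) lin_cat_scheme \<Rightarrow> 'o \<Rightarrow> bool"
  where "zero_object C Z \<longleftrightarrow> Z \<in> Obj C \<and>
    (\<forall>X \<in> Obj C. (\<exists>!f. f \<in> homset C Z X) \<and> (\<exists>!f. f \<in> homset C X Z))"

text \<open>\<open>direct_sum_of C Z X Y\<close> expresses \<open>Z \<cong> X \<oplus> Y\<close>.\<close>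

definition direct_sum_of :: "('o, 'a, 'z) lin_cat_scheme \<Rightarrow> 'o \<Rightarrow> 'o \<Rightarrow> 'o \<Rightarrow> bool"
  where "direct_sum_of C Z X Y \<longleftrightarrow>
    (\<exists>i \<in> homset C X Z. \<exists>j \<in> homset C Y Z. \<exists>p \<in> homset C Z X. \<exists>q \<in> homset C Z Y.
       Cmp C p i = Idn C X \<and> Cmp C q j = Idn C Y \<and>
       Cmp C p j = Nul C Y X \<and> Cmp C q i = Nul C X Y \<and>
       Pls C (Cmp C i p) (Cmp C j q) = Idn C Z)"

primrec direct_sum_of_list :: "('o, 'a, 'z) lin_cat_scheme \<Rightarrow> 'o \<Rightarrow> 'o list \<Rightarrow> bool"
  where
    "direct_sum_of_list C Z [] \<longleftrightarrow> zero_object C Z"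
  | "direct_sum_of_list C Z (X # Xs) \<longleftrightarrow>
      (\<exists>W \<in> Obj C. direct_sum_of_list C W Xs \<and> direct_sum_of C Z X W)"

definition additive :: "('o, 'a, 'z) lin_cat_scheme \<Rightarrow> bool"
  where "additive C \<longleftrightarrow> (\<exists>Z. zero_object C Z) \<and>
    (\<forall>X \<in> Obj C. \<forall>Y \<in> Obj C. \<exists>Z \<in> Obj C. direct_sum_of C Z X Y)"

definition idempotent_split :: "('o, 'a, 'z) lin_cat_scheme \<Rightarrow> bool"
  where "idempotent_split C \<longleftrightarrow>
    (\<forall>X \<in> Obj C. \<forall>e \<in> homset C X X. Cmp C e e = e \<longrightarrow>
      (\<exists>Y \<in> Obj C. \<exists>r \<in> homset C X Y. \<exists>s \<in> homset C Y X.
         Cmp C r s = Idn C Y \<and> Cmp C s r = e))"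

definition indecomposable :: "('o, 'a, 'z) lin_cat_scheme \<Rightarrow> 'o \<Rightarrow> bool"
  where "indecomposable C X \<longleftrightarrow> X \<in> Obj C \<and> \<not> zero_object C X \<and>
    (\<forall>Y \<in> Obj C. \<forall>Z \<in> Obj C. direct_sum_of C X Y Z \<longrightarrow> zero_object C Y \<or> zero_object C Z)"

definition local_endomorphism_ring :: "('o, 'a, 'z) lin_cat_scheme \<Rightarrow> 'o \<Rightarrow> bool"
  where "local_endomorphism_ring C X \<longleftrightarrow>
    (let E = homsp C X X in
      \<one>\<^bsub>E\<^esub> \<noteq> \<zero>\<^bsub>E\<^esub> \<and>
      (\<forall>f \<in> carrier E - Units E. \<forall>g \<in> carrier E - Units E. f \<oplus>\<^bsub>E\<^esub> g \<notin> Units E))"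

definition krull_schmidt :: "('o, 'a, 'z) lin_cat_scheme \<Rightarrow> bool"
  where "krull_schmidt C \<longleftrightarrow>
    (\<forall>X \<in> Obj C. \<exists>Xs. set Xs \<subseteq> Obj C \<and> (\<forall>Y \<in> set Xs. local_endomorphism_ring C Y) \<and>
       direct_sum_of_list C X Xs)"

definition countably_many_indecomposables :: "('o, 'a, 'z) lin_cat_scheme \<Rightarrow> bool"
  where "countably_many_indecomposables C \<longleftrightarrow>
    (\<exists>S. countable S \<and> (\<forall>X. indecomposable C X \<longrightarrow> (\<exists>Y \<in> S. isomorphic C X Y)))"

definition locally_finitary :: "('o, 'a, 'z) lin_cat_scheme \<Rightarrow> bool"
  where "locally_finitary C \<longleftrightarrow>
    linear_category C \<and> additive C \<and> idempotent_split C \<and> krull_schmidt C \<and>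
    countably_many_indecomposables C \<and>
    (\<forall>X \<in> Obj C. \<forall>Y \<in> Obj C. vectorspace.fin_dim complex_field (homsp C X Y))"

definition weak_kernel :: "('o, 'a, 'z) lin_cat_scheme \<Rightarrow> 'a \<Rightarrow> 'a \<Rightarrow> bool"
  where "weak_kernel C f k \<longleftrightarrow>
    k \<in> Arr C \<and> Cod C k = Dom C f \<and> Cmp C f k = Nul C (Dom C k) (Cod C f) \<and>
    (\<forall>g \<in> Arr C. Cod C g = Dom C f \<and> Cmp C f g = Nul C (Dom C g) (Cod C f) \<longrightarrow>
      (\<exists>h \<in> homset C (Dom C g) (Dom C k). Cmp C k h = g))"

definition admissible :: "('o, 'a, 'z) lin_cat_scheme \<Rightarrow> bool"
  where "admissible C \<longleftrightarrow> (\<forall>f \<in> Arr C. \<exists>k. weak_kernel C f k)"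


section \<open>Monoidal categories and module categories\<close>

text \<open>
  Conventions for the structural isomorphisms:
  \<open>Asc U V W : (U \<otimes> V) \<otimes> W \<rightarrow> U \<otimes> (V \<otimes> W)\<close>, \<open>Lun V : \<one> \<otimes> V \<rightarrow> V\<close>, \<open>Run V : V \<otimes> \<one> \<rightarrow> V\<close>,
  and, for an action, \<open>ActAsc U V X : (U \<otimes> V) \<cdot> X \<rightarrow> U \<cdot> (V \<cdot> X)\<close>, \<open>ActUn X : \<one> \<cdot> X \<rightarrow> X\<close>.
\<close>

record ('o, 'a) mon_cat = "('o, 'a) lin_cat" +
  TenO :: "'o \<Rightarrow> 'o \<Rightarrow> 'o"  (infixr \<open>\<otimes>\<^sub>O\<index>\<close> 80)
  TenA :: "'a \<Rightarrow> 'a \<Rightarrow> 'a"  (infixr \<open>\<otimes>\<^sub>A\<index>\<close> 80)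
  Unt :: "'o"
  Asc :: "'o \<Rightarrow> 'o \<Rightarrow> 'o \<Rightarrow> 'a"
  Lun :: "'o \<Rightarrow> 'a"
  Run :: "'o \<Rightarrow> 'a"

locale monoidal_category = linear_category C
  for C :: "('o, 'a, 'z) mon_cat_scheme" (structure) +
  assumes TenO_in: "\<lbrakk>V \<in> Obj C; W \<in> Obj C\<rbrakk> \<Longrightarrow> V \<otimes>\<^sub>O W \<in> Obj C"
    and TenA_in: "\<lbrakk>f \<in> homset C V V'; g \<in> homset C W W'\<rbrakk>
      \<Longrightarrow> f \<otimes>\<^sub>A g \<in> homset C (V \<otimes>\<^sub>O W) (V' \<otimes>\<^sub>O W')"
    and TenA_Idn: "\<lbrakk>V \<in> Obj C; W \<in> Obj C\<rbrakk> \<Longrightarrow> Idn C V \<otimes>\<^sub>A Idn C W = Idn C (V \<otimes>\<^sub>O W)"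
    and TenA_Cmp: "\<lbrakk>f \<in> homset C V V'; f' \<in> homset C V' V''; g \<in> homset C W W'; g' \<in> homset C W' W''\<rbrakk>
      \<Longrightarrow> (f' \<cdot> f) \<otimes>\<^sub>A (g' \<cdot> g) = (f' \<otimes>\<^sub>A g') \<cdot> (f \<otimes>\<^sub>A g)"
    and TenA_linear_left: "\<lbrakk>V \<in> Obj C; V' \<in> Obj C; g \<in> homset C W W'\<rbrakk>
      \<Longrightarrow> linear_map complex_field (homsp C V V') (homsp C (V \<otimes>\<^sub>O W) (V' \<otimes>\<^sub>O W')) (\<lambda>f. f \<otimes>\<^sub>A g)"
    and TenA_linear_right: "\<lbrakk>f \<in> homset C V V'; W \<in> Obj C; W' \<in> Obj C\<rbrakk>
      \<Longrightarrow> linear_map complex_field (homsp C W W') (homsp C (V \<otimes>\<^sub>O W) (V' \<otimes>\<^sub>O W')) (\<lambda>g. f \<otimes>\<^sub>A g)"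
    and Unt_in: "Unt C \<in> Obj C"
    and Asc_iso: "\<lbrakk>U \<in> Obj C; V \<in> Obj C; W \<in> Obj C\<rbrakk>
      \<Longrightarrow> is_iso C ((U \<otimes>\<^sub>O V) \<otimes>\<^sub>O W) (U \<otimes>\<^sub>O (V \<otimes>\<^sub>O W)) (Asc C U V W)"
    and Asc_natural: "\<lbrakk>f \<in> homset C U U'; g \<in> homset C V V'; h \<in> homset C W W'\<rbrakk>
      \<Longrightarrow> Asc C U' V' W' \<cdot> ((f \<otimes>\<^sub>A g) \<otimes>\<^sub>A h) = (f \<otimes>\<^sub>A (g \<otimes>\<^sub>A h)) \<cdot> Asc C U V W"
    and Lun_iso: "V \<in> Obj C \<Longrightarrow> is_iso C (Unt C \<otimes>\<^sub>O V) V (Lun C V)"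
    and Lun_natural: "f \<in> homset C V V'
      \<Longrightarrow> Lun C V' \<cdot> (Idn C (Unt C) \<otimes>\<^sub>A f) = f \<cdot> Lun C V"
    and Run_iso: "V \<in> Obj C \<Longrightarrow> is_iso C (V \<otimes>\<^sub>O Unt C) V (Run C V)"
    and Run_natural: "f \<in> homset C V V'
      \<Longrightarrow> Run C V' \<cdot> (f \<otimes>\<^sub>A Idn C (Unt C)) = f \<cdot> Run C V"
    and pentagon: "\<lbrakk>T \<in> Obj C; U \<in> Obj C; V \<in> Obj C; W \<in> Obj C\<rbrakk>
      \<Longrightarrow> (Idn C T \<otimes>\<^sub>A Asc C U V W) \<cdot> Asc C T (U \<otimes>\<^sub>O V) W \<cdot> (Asc C T U V \<otimes>\<^sub>A Idn C W)
        = Asc C T U (V \<otimes>\<^sub>O W) \<cdot> Asc C (T \<otimes>\<^sub>O U) V W"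
    and triangle: "\<lbrakk>V \<in> Obj C; W \<in> Obj C\<rbrakk>
      \<Longrightarrow> (Idn C V \<otimes>\<^sub>A Lun C W) \<cdot> Asc C V (Unt C) W = Run C V \<otimes>\<^sub>A Idn C W"

record ('o, 'a, 'v, 'f) mod_cat = "('o, 'a) lin_cat" +
  ActO :: "'v \<Rightarrow> 'o \<Rightarrow> 'o"
  ActA :: "'f \<Rightarrow> 'a \<Rightarrow> 'a"
  ActAsc :: "'v \<Rightarrow> 'v \<Rightarrow> 'o \<Rightarrow> 'a"
  ActUn :: "'o \<Rightarrow> 'a"

locale module_category =
  C: monoidal_category C + M: linear_category M
  for C :: "('v, 'f, 'y) mon_cat_scheme"
    and M :: "('o, 'a, 'v, 'f, 'z) mod_cat_scheme" +
  assumes ActO_in: "\<lbrakk>V \<in> Obj C; X \<in> Obj M\<rbrakk> \<Longrightarrow> ActO M V X \<in> Obj M"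
    and ActA_in: "\<lbrakk>f \<in> homset C V V'; u \<in> homset M X X'\<rbrakk>
      \<Longrightarrow> ActA M f u \<in> homset M (ActO M V X) (ActO M V' X')"
    and ActA_Idn: "\<lbrakk>V \<in> Obj C; X \<in> Obj M\<rbrakk> \<Longrightarrow> ActA M (Idn C V) (Idn M X) = Idn M (ActO M V X)"
    and ActA_Cmp: "\<lbrakk>f \<in> homset C V V'; f' \<in> homset C V' V''; u \<in> homset M X X'; u' \<in> homset M X' X''\<rbrakk>
      \<Longrightarrow> ActA M (f' \<cdot>\<^bsub>C\<^esub> f) (u' \<cdot>\<^bsub>M\<^esub> u) = ActA M f' u' \<cdot>\<^bsub>M\<^esub> ActA M f u"
    and ActA_linear_left: "\<lbrakk>V \<in> Obj C; V' \<in> Obj C; u \<in> homset M X X'\<rbrakk>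
      \<Longrightarrow> linear_map complex_field (homsp C V V') (homsp M (ActO M V X) (ActO M V' X'))
            (\<lambda>f. ActA M f u)"
    and ActA_linear_right: "\<lbrakk>f \<in> homset C V V'; X \<in> Obj M; X' \<in> Obj M\<rbrakk>
      \<Longrightarrow> linear_map complex_field (homsp M X X') (homsp M (ActO M V X) (ActO M V' X'))
            (\<lambda>u. ActA M f u)"
    and ActAsc_iso: "\<lbrakk>U \<in> Obj C; V \<in> Obj C; X \<in> Obj M\<rbrakk>
      \<Longrightarrow> is_iso M (ActO M (U \<otimes>\<^sub>O\<^bsub>C\<^esub> V) X) (ActO M U (ActO M V X)) (ActAsc M U V X)"
    and ActAsc_natural: "\<lbrakk>f \<in> homset C U U'; g \<in> homset C V V'; u \<in> homset M X X'\<rbrakk>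
      \<Longrightarrow> ActAsc M U' V' X' \<cdot>\<^bsub>M\<^esub> ActA M (f \<otimes>\<^sub>A\<^bsub>C\<^esub> g) u
        = ActA M f (ActA M g u) \<cdot>\<^bsub>M\<^esub> ActAsc M U V X"
    and ActUn_iso: "X \<in> Obj M \<Longrightarrow> is_iso M (ActO M (Unt C) X) X (ActUn M X)"
    and ActUn_natural: "u \<in> homset M X X'
      \<Longrightarrow> ActUn M X' \<cdot>\<^bsub>M\<^esub> ActA M (Idn C (Unt C)) u = u \<cdot>\<^bsub>M\<^esub> ActUn M X"
    and Act_pentagon: "\<lbrakk>U \<in> Obj C; V \<in> Obj C; W \<in> Obj C; X \<in> Obj M\<rbrakk>
      \<Longrightarrow> ActA M (Idn C U) (ActAsc M V W X) \<cdot>\<^bsub>M\<^esub> ActAsc M U (V \<otimes>\<^sub>O\<^bsub>C\<^esub> W) X \<cdot>\<^bsub>M\<^esub>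
            ActA M (Asc C U V W) (Idn M X)
        = ActAsc M U V (ActO M W X) \<cdot>\<^bsub>M\<^esub> ActAsc M (U \<otimes>\<^sub>O\<^bsub>C\<^esub> V) W X"
    and Act_triangle: "\<lbrakk>V \<in> Obj C; X \<in> Obj M\<rbrakk>
      \<Longrightarrow> ActA M (Idn C V) (ActUn M X) \<cdot>\<^bsub>M\<^esub> ActAsc M V (Unt C) X = ActA M (Run C V) (Idn M X)"

definition ideal_of :: "('o, 'a, 'z) lin_cat_scheme \<Rightarrow> 'a set \<Rightarrow> bool"
  where "ideal_of M I \<longleftrightarrow> I \<subseteq> Arr M \<and>
    (\<forall>X \<in> Obj M. \<forall>Y \<in> Obj M.
       VectorSpace.subspace complex_field (I \<inter> homset M X Y) (homsp M X Y)) \<and>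
    (\<forall>f \<in> I. \<forall>g \<in> Arr M. Dom M g = Cod M f \<longrightarrow> Cmp M g f \<in> I) \<and>
    (\<forall>f \<in> I. \<forall>g \<in> Arr M. Cod M g = Dom M f \<longrightarrow> Cmp M f g \<in> I)"

definition invariant_ideal ::
  "('v, 'f, 'y) mon_cat_scheme \<Rightarrow> ('o, 'a, 'v, 'f, 'z) mod_cat_scheme \<Rightarrow> 'a set \<Rightarrow> bool"
  where "invariant_ideal C M I \<longleftrightarrow> ideal_of M I \<and>
    (\<forall>V \<in> Obj C. \<forall>f \<in> I. ActA M (Idn C V) f \<in> I)"

definition simple_transitive ::
  "('v, 'f, 'y) mon_cat_scheme \<Rightarrow> ('o, 'a, 'v, 'f, 'z) mod_cat_scheme \<Rightarrow> bool"
  where "simple_transitive C M \<longleftrightarrow>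
    (\<forall>I. invariant_ideal C M I \<longrightarrow>
      I = {Nul M X Y | X Y. X \<in> Obj M \<and> Y \<in> Obj M} \<or> I = Arr M)"


section \<open>Finite dimensional modules over \<open>sl\<^sub>2\<close>\<close>

definition sl2 :: "complex mat set"
  where "sl2 = {A \<in> carrier_mat 2 2. A $$ (0, 0) + A $$ (1, 1) = 0}"

definition lie_bracket :: "complex mat \<Rightarrow> complex mat \<Rightarrow> complex mat"
  where "lie_bracket A B = A * B - B * A"

text \<open>
  A finite dimensional module is carried by some \<open>\<complex>\<^sup>n\<close> and given by a Lie algebra homomorphism
  from \<open>sl\<^sub>2\<close> to the \<open>n \<times> n\<close> matrices. Up to equivalence of categories, choosing
  bases loses nothing, and it keeps the objects in one type that is closed under tensor products.
\<close>

record sl2_module =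
  vdim :: nat
  rep :: "complex mat \<Rightarrow> complex mat"

definition is_sl2_module :: "sl2_module \<Rightarrow> bool"
  where "is_sl2_module V \<longleftrightarrow>
    rep V \<in> sl2 \<rightarrow>\<^sub>E carrier_mat (vdim V) (vdim V) \<and>
    (\<forall>A \<in> sl2. \<forall>B \<in> sl2. rep V (A + B) = rep V A + rep V B) \<and>
    (\<forall>c. \<forall>A \<in> sl2. rep V (c \<cdot>\<^sub>m A) = c \<cdot>\<^sub>m rep V A) \<and>
    (\<forall>A \<in> sl2. \<forall>B \<in> sl2. rep V (lie_bracket A B) = lie_bracket (rep V A) (rep V B))"

text \<open>
  The Kronecker product is the matrix of the tensor product of two linear maps, the basis
  \<open>e\<^sub>i \<otimes> e\<^sub>j\<close> of \<open>\<complex>\<^sup>m \<otimes> \<complex>\<^sup>n = \<complex>\<^bsup>mn\<^esup>\<close> having index \<open>i n + j\<close>. With this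
  ordering the canonical associativity and unit isomorphisms are identity matrices.
\<close>

definition kronecker :: "complex mat \<Rightarrow> complex mat \<Rightarrow> complex mat"  (infixr \<open>\<otimes>\<^sub>m\<close> 75)
  where "A \<otimes>\<^sub>m B = mat (dim_row A * dim_row B) (dim_col A * dim_col B)
    (\<lambda>(i, j). A $$ (i div dim_row B, j div dim_col B) * B $$ (i mod dim_row B, j mod dim_col B))"

definition sl2_tensor :: "sl2_module \<Rightarrow> sl2_module \<Rightarrow> sl2_module"
  where "sl2_tensor V W =
    \<lparr> vdim = vdim V * vdim W,
      rep = (\<lambda>A \<in> sl2. rep V A \<otimes>\<^sub>m 1\<^sub>m (vdim W) + 1\<^sub>m (vdim V) \<otimes>\<^sub>m rep W A) \<rparr>"

definition sl2_trivial :: sl2_module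
  where "sl2_trivial = \<lparr> vdim = 1, rep = (\<lambda>A \<in> sl2. 0\<^sub>m 1 1) \<rparr>"

text \<open>The natural module \<open>\<complex>\<^sup>2\<close>, i.e.\ \<open>L(1)\<close>.\<close>

definition sl2_natural :: sl2_module
  where "sl2_natural = \<lparr> vdim = 2, rep = (\<lambda>A \<in> sl2. A) \<rparr>"

text \<open>A homomorphism \<open>V \<rightarrow> W\<close> with matrix \<open>T\<close> is the triple \<open>(V, T, W)\<close>.\<close>

type_synonym sl2_hom = "sl2_module \<times> complex mat \<times> sl2_module"

abbreviation src :: "sl2_hom \<Rightarrow> sl2_module" where "src f \<equiv> fst f"
abbreviation mtx :: "sl2_hom \<Rightarrow> complex mat" where "mtx f \<equiv> fst (snd f)"
abbreviation tgt :: "sl2_hom \<Rightarrow> sl2_module" where "tgt f \<equiv> snd (snd f)"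

definition is_sl2_hom :: "sl2_hom \<Rightarrow> bool"
  where "is_sl2_hom f \<longleftrightarrow>
    is_sl2_module (src f) \<and> is_sl2_module (tgt f) \<and>
    mtx f \<in> carrier_mat (vdim (tgt f)) (vdim (src f)) \<and>
    (\<forall>A \<in> sl2. mtx f * rep (src f) A = rep (tgt f) A * mtx f)"

definition sl2_modules :: "(sl2_module, sl2_hom) mon_cat"
  where "sl2_modules =
    \<lparr> Obj = {V. is_sl2_module V},
      Arr = {f. is_sl2_hom f},
      Dom = (\<lambda>f. src f),
      Cod = (\<lambda>f. tgt f),
      Idn = (\<lambda>V. (V, 1\<^sub>m (vdim V), V)),
      Cmp = (\<lambda>g f. (src f, mtx g * mtx f, tgt g)),
      Nul = (\<lambda>V W. (V, 0\<^sub>m (vdim W) (vdim V), W)),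
      Pls = (\<lambda>f g. (src f, mtx f + mtx g, tgt f)),
      Scl = (\<lambda>c f. (src f, c \<cdot>\<^sub>m mtx f, tgt f)),
      TenO = sl2_tensor,
      TenA = (\<lambda>f g. (sl2_tensor (src f) (src g), mtx f \<otimes>\<^sub>m mtx g, sl2_tensor (tgt f) (tgt g))),
      Unt = sl2_trivial,
      Asc = (\<lambda>U V W. (sl2_tensor (sl2_tensor U V) W, 1\<^sub>m (vdim U * vdim V * vdim W),
                      sl2_tensor U (sl2_tensor V W))),
      Lun = (\<lambda>V. (sl2_tensor sl2_trivial V, 1\<^sub>m (vdim V), V)),
      Run = (\<lambda>V. (sl2_tensor V sl2_trivial, 1\<^sub>m (vdim V), V)) \<rparr>"

definition type_B_infinity :: "('o, 'a, sl2_module, sl2_hom, 'z) mod_cat_scheme \<Rightarrow> bool"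
  where "type_B_infinity M \<longleftrightarrow>
    (\<exists>X :: nat \<Rightarrow> 'o.
      (\<forall>i \<ge> 1. indecomposable M (X i)) \<and>
      (\<forall>i \<ge> 1. \<forall>j \<ge> 1. isomorphic M (X i) (X j) \<longrightarrow> i = j) \<and>
      (\<forall>Y. indecomposable M Y \<longrightarrow> (\<exists>i \<ge> 1. isomorphic M Y (X i))) \<and>
      direct_sum_of M (ActO M sl2_natural (X 1)) (X 2) (X 2) \<and>
      (\<forall>i \<ge> 2. direct_sum_of M (ActO M sl2_natural (X i)) (X (i - 1)) (X (i + 1))))"


section \<open>The monoidal category axioms for \<open>sl\<^sub>2\<close>-modules\<close>

lemma kron_dim [simp]: "dim_row (A \<otimes>\<^sub>m B) = dim_row A * dim_row B"
  "dim_col (A \<otimes>\<^sub>m B) = dim_col A * dim_col B"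
  by (simp_all add: kronecker_def)

lemma kron_carrier [simp, intro]:
  "A \<in> carrier_mat a b \<Longrightarrow> B \<in> carrier_mat c d \<Longrightarrow> A \<otimes>\<^sub>m B \<in> carrier_mat (a * c) (b * d)"
  by (simp add: kronecker_def)

lemma div_less_mult: "i < m * (n::nat) \<Longrightarrow> i div n < m \<and> i mod n < n"
  by (metis less_mult_imp_div_less mod_less_divisor mult_0_right not_less0 neq0_conv)

lemma kron_index: "i < dim_row A * dim_row B \<Longrightarrow> j < dim_col A * dim_col B \<Longrightarrow>
  (A \<otimes>\<^sub>m B) $$ (i, j) =
    A $$ (i div dim_row B, j div dim_col B) * B $$ (i mod dim_row B, j mod dim_col B)"
  by (simp add: kronecker_def)

lemma sum_div_mod:
  fixes f g :: "nat \<Rightarrow> complex"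
  shows "(\<Sum>k = 0..<m * n. f (k div n) * g (k mod n)) = (\<Sum>i = 0..<m. f i) * (\<Sum>j = 0..<n. g j)"
proof (induction m)
  case (Suc m)
  have "(\<Sum>k = 0..<Suc m * n. f (k div n) * g (k mod n)) =
    (\<Sum>k = 0..<m * n. f (k div n) * g (k mod n)) + (\<Sum>k = m * n..<m * n + n. f (k div n) * g (k mod n))"
    by (simp add: sum.atLeastLessThan_concat add.commute)
  also have "(\<Sum>k = m * n..<m * n + n. f (k div n) * g (k mod n)) = (\<Sum>j = 0..<n. f m * g j)"
    using sum.shift_bounds_nat_ivl[of "\<lambda>k. f (k div n) * g (k mod n)" 0 "m * n" n]
    by (simp add: add.commute)
  finally show ?case using Suc by (simp add: sum_distrib_left distrib_right)
qed simp

lemma kron_mult: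
  assumes "A \<in> carrier_mat a b" "A' \<in> carrier_mat b c" "B \<in> carrier_mat d e" "B' \<in> carrier_mat e f"
  shows "(A * A') \<otimes>\<^sub>m (B * B') = (A \<otimes>\<^sub>m B) * (A' \<otimes>\<^sub>m B')"
proof (rule eq_matI)
  fix i j assume "i < dim_row ((A \<otimes>\<^sub>m B) * (A' \<otimes>\<^sub>m B'))" "j < dim_col ((A \<otimes>\<^sub>m B) * (A' \<otimes>\<^sub>m B'))"
  then have ij: "i < a * d" "j < c * f" using assms by auto
  note dm = div_less_mult[OF ij(1)] div_less_mult[OF ij(2)]
  have "((A \<otimes>\<^sub>m B) * (A' \<otimes>\<^sub>m B')) $$ (i, j) =
    (\<Sum>k = 0..<b * e. (A \<otimes>\<^sub>m B) $$ (i, k) * (A' \<otimes>\<^sub>m B') $$ (k, j))"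
    using assms ij by (simp add: scalar_prod_def)
  also have "\<dots> = (\<Sum>k = 0..<b * e. (A $$ (i div d, k div e) * A' $$ (k div e, j div f)) *
      (B $$ (i mod d, k mod e) * B' $$ (k mod e, j mod f)))"
    using assms ij by (intro sum.cong) (auto simp: kron_index)
  also have "\<dots> = (A * A') $$ (i div d, j div f) * (B * B') $$ (i mod d, j mod f)"
    using sum_div_mod[where f = "\<lambda>k. A $$ (i div d, k) * A' $$ (k, j div f)" and
       g = "\<lambda>k. B $$ (i mod d, k) * B' $$ (k, j mod f)" and m = b and n = e] assms dm
    by (simp add: scalar_prod_def)
  also have "\<dots> = ((A * A') \<otimes>\<^sub>m (B * B')) $$ (i, j)"
    using assms ij by (simp add: kron_index)
  finally show "((A * A') \<otimes>\<^sub>m (B * B')) $$ (i, j) = ((A \<otimes>\<^sub>m B) * (A' \<otimes>\<^sub>m B')) $$ (i, j)" by simp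
qed (use assms in auto)

lemma kron_assoc: "(A \<otimes>\<^sub>m B) \<otimes>\<^sub>m C = A \<otimes>\<^sub>m (B \<otimes>\<^sub>m C)"
proof (rule eq_matI)
  fix i j assume "i < dim_row (A \<otimes>\<^sub>m (B \<otimes>\<^sub>m C))" "j < dim_col (A \<otimes>\<^sub>m (B \<otimes>\<^sub>m C))"
  then have ij: "i < dim_row A * dim_row B * dim_row C" "j < dim_col A * dim_col B * dim_col C"
    by (simp_all add: mult.assoc)
  have ij': "i < dim_row A * (dim_row B * dim_row C)" "j < dim_col A * (dim_col B * dim_col C)"
    using ij by (simp_all add: mult.assoc)
  have m: "x mod (q * p) div q = x div q mod p" "x mod (q * p) mod q = x mod q" for x p q :: nat
    by (cases "q = 0"; simp add: mod_mult2_eq)+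
  show "((A \<otimes>\<^sub>m B) \<otimes>\<^sub>m C) $$ (i, j) = (A \<otimes>\<^sub>m (B \<otimes>\<^sub>m C)) $$ (i, j)"
    using ij ij' div_less_mult[OF ij(1)] div_less_mult[OF ij(2)]
      div_less_mult[OF ij'(1)] div_less_mult[OF ij'(2)]
    by (simp add: kron_index m div_mult2_eq mult.commute[of _ "dim_row C"] mult.commute[of _ "dim_col C"])
qed (simp_all add: mult.assoc)

lemma kron_one: "1\<^sub>m m \<otimes>\<^sub>m 1\<^sub>m n = 1\<^sub>m (m * n)"
proof (rule eq_matI)
  fix i j assume "i < dim_row (1\<^sub>m (m * n) :: complex mat)" "j < dim_col (1\<^sub>m (m * n) :: complex mat)"
  then have ij: "i < m * n" "j < m * n" by auto
  have "i = j \<longleftrightarrow> i div n = j div n \<and> i mod n = j mod n" by (metis mult_div_mod_eq)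
  then show "(1\<^sub>m m \<otimes>\<^sub>m 1\<^sub>m n) $$ (i, j) = 1\<^sub>m (m * n) $$ (i, j)"
    using ij div_less_mult[OF ij(1)] div_less_mult[OF ij(2)] by (auto simp: kron_index)
qed auto

lemma kron_one_left [simp]: "1\<^sub>m (Suc 0) \<otimes>\<^sub>m A = A"
  by (rule eq_matI) (auto simp: kron_index)

lemma kron_one_right [simp]: "A \<otimes>\<^sub>m 1\<^sub>m (Suc 0) = A"
  by (rule eq_matI) (auto simp: kron_index)

lemma kron_add_left: "A \<in> carrier_mat a b \<Longrightarrow> A' \<in> carrier_mat a b \<Longrightarrow>
    (A + A') \<otimes>\<^sub>m B = A \<otimes>\<^sub>m B + A' \<otimes>\<^sub>m B"
  by (rule eq_matI) (auto simp: kron_index div_less_mult distrib_right)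

lemma kron_add_right: "B \<in> carrier_mat a b \<Longrightarrow> B' \<in> carrier_mat a b \<Longrightarrow>
    A \<otimes>\<^sub>m (B + B') = A \<otimes>\<^sub>m B + A \<otimes>\<^sub>m B'"
  by (rule eq_matI) (auto simp: kron_index div_less_mult distrib_left)

lemma kron_smult_left: "(c \<cdot>\<^sub>m A) \<otimes>\<^sub>m B = c \<cdot>\<^sub>m (A \<otimes>\<^sub>m B)"
  by (rule eq_matI) (auto simp: kron_index div_less_mult)

lemma kron_smult_right: "A \<otimes>\<^sub>m (c \<cdot>\<^sub>m B) = c \<cdot>\<^sub>m (A \<otimes>\<^sub>m B)"
  by (rule eq_matI) (auto simp: kron_index div_less_mult)

lemma kron_zero_left: "0\<^sub>m a b \<otimes>\<^sub>m B = 0\<^sub>m (a * dim_row B) (b * dim_col B)"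
  by (rule eq_matI) (auto simp: kron_index div_less_mult)

lemma kron_zero_right: "A \<otimes>\<^sub>m 0\<^sub>m a b = 0\<^sub>m (dim_row A * a) (dim_col A * b)"
  by (rule eq_matI) (auto simp: kron_index div_less_mult)

lemma sl2_closed: "A \<in> sl2 \<Longrightarrow> B \<in> sl2 \<Longrightarrow> A + B \<in> sl2"
  "A \<in> sl2 \<Longrightarrow> c \<cdot>\<^sub>m A \<in> sl2"
  "A \<in> sl2 \<Longrightarrow> B \<in> sl2 \<Longrightarrow> lie_bracket A B \<in> sl2"
  by (auto simp: sl2_def lie_bracket_def scalar_prod_def numeral_2_eq_2 add_eq_0_iff algebra_simps)

lemma commutator_sum:
  fixes P Q R S :: "complex mat"
  assumes c: "P \<in> carrier_mat n n" "Q \<in> carrier_mat n n" "R \<in> carrier_mat n n" "S \<in> carrier_mat n n"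
    and "P * S = S * P" "Q * R = R * Q"
  shows "lie_bracket (P + Q) (R + S) = lie_bracket P R + lie_bracket Q S"
proof -
  have cancel: "(a + e + (f + b)) - (d + f + (e + g)) = (a - d) + (b - g)"
    if "a \<in> carrier_mat n n" "b \<in> carrier_mat n n" "d \<in> carrier_mat n n"
      "e \<in> carrier_mat n n" "f \<in> carrier_mat n n" "g \<in> carrier_mat n n"
    for a b d e f g :: "complex mat"
    using that by (intro eq_matI) auto
  have "(P + Q) * (R + S) = P * R + S * P + (R * Q + Q * S)"
    using c assms(5,6) add_mult_distrib_mat[of P n n Q "R + S" n]
      mult_add_distrib_mat[of P n n R n S] mult_add_distrib_mat[of Q n n R n S] by simp
  moreover have "(R + S) * (P + Q) = R * P + R * Q + (S * P + S * Q)"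
    using c add_mult_distrib_mat[of R n n S "P + Q" n]
      mult_add_distrib_mat[of R n n P n Q] mult_add_distrib_mat[of S n n P n Q] by simp
  ultimately show ?thesis unfolding lie_bracket_def
    using c by (simp only:) (rule cancel; auto)
qed

lemma rep_carrier [simp, intro]:
  "is_sl2_module V \<Longrightarrow> A \<in> sl2 \<Longrightarrow> rep V A \<in> carrier_mat (vdim V) (vdim V)"
  by (auto simp: is_sl2_module_def)

lemma is_sl2_module_trivial: "is_sl2_module sl2_trivial"
  by (auto simp: is_sl2_module_def sl2_trivial_def sl2_closed)
     (auto simp: lie_bracket_def)

lemma is_sl2_module_natural: "is_sl2_module sl2_natural"
  by (auto simp: is_sl2_module_def sl2_natural_def sl2_closed) (auto simp: sl2_def)

lemma is_sl2_module_tensor: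
  assumes V: "is_sl2_module V" and W: "is_sl2_module W"
  shows "is_sl2_module (sl2_tensor V W)"
proof -
  let ?m = "vdim V" and ?n = "vdim W"
  let ?L = "\<lambda>A. rep V A \<otimes>\<^sub>m 1\<^sub>m ?n" and ?R = "\<lambda>A. 1\<^sub>m ?m \<otimes>\<^sub>m rep W A"
  have c: "?L A \<in> carrier_mat (?m * ?n) (?m * ?n)" "?R A \<in> carrier_mat (?m * ?n) (?m * ?n)"
    if "A \<in> sl2" for A
    using that V W by auto
  have "?L (lie_bracket A B) + ?R (lie_bracket A B) = lie_bracket (?L A + ?R A) (?L B + ?R B)"
    if A: "A \<in> sl2" and B: "B \<in> sl2" for A B
  proof -
    note r = rep_carrier[OF V A] rep_carrier[OF V B] rep_carrier[OF W A] rep_carrier[OF W B]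
    note k = kron_mult[where a = ?m and b = ?m and c = ?m and d = ?n and e = ?n and f = ?n, symmetric]
    have "lie_bracket (?L A + ?R A) (?L B + ?R B) =
        lie_bracket (?L A) (?L B) + lie_bracket (?R A) (?R B)"
      using c A B by (rule_tac commutator_sum[of _ "?m * ?n"]) (use r in \<open>simp_all add: k\<close>)
    also have "lie_bracket (?L A) (?L B) = ?L (lie_bracket A B)"
    proof -
      have "(rep V A * rep V B) \<otimes>\<^sub>m 1\<^sub>m ?n - (rep V B * rep V A) \<otimes>\<^sub>m 1\<^sub>m ?n
          = (rep V A * rep V B - rep V B * rep V A) \<otimes>\<^sub>m 1\<^sub>m ?n"
        using r by (intro eq_matI) (auto simp: kron_index div_less_mult left_diff_distrib simp del: index_mult_mat(1))
      then show ?thesis using r V A B by (simp add: lie_bracket_def k is_sl2_module_def)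
    qed
    also have "lie_bracket (?R A) (?R B) = ?R (lie_bracket A B)"
    proof -
      have "1\<^sub>m ?m \<otimes>\<^sub>m (rep W A * rep W B) - 1\<^sub>m ?m \<otimes>\<^sub>m (rep W B * rep W A)
          = 1\<^sub>m ?m \<otimes>\<^sub>m (rep W A * rep W B - rep W B * rep W A)"
        using r by (intro eq_matI) (auto simp: kron_index div_less_mult right_diff_distrib simp del: index_mult_mat(1))
      then show ?thesis using r W A B by (simp add: lie_bracket_def k is_sl2_module_def)
    qed
    finally show ?thesis by simp
  qed
  moreover have "?L (A + B) + ?R (A + B) = (?L A + ?R A) + (?L B + ?R B)"
    if A: "A \<in> sl2" and B: "B \<in> sl2" for A B
  proof -
    note r = rep_carrier[OF V A] rep_carrier[OF V B] rep_carrier[OF W A] rep_carrier[OF W B]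
    have "?L (A + B) = ?L A + ?L B" "?R (A + B) = ?R A + ?R B"
      using V W A B r by (auto simp: is_sl2_module_def kron_add_left[of _ ?m ?m] kron_add_right[of _ ?n ?n])
    then show ?thesis using c[OF A] c[OF B] by (auto intro!: eq_matI)
  qed
  moreover have "?L (z \<cdot>\<^sub>m A) + ?R (z \<cdot>\<^sub>m A) = z \<cdot>\<^sub>m (?L A + ?R A)" if A: "A \<in> sl2" for z A
  proof -
    have "?L (z \<cdot>\<^sub>m A) = z \<cdot>\<^sub>m ?L A" "?R (z \<cdot>\<^sub>m A) = z \<cdot>\<^sub>m ?R A"
      using V W A by (auto simp: is_sl2_module_def kron_smult_left kron_smult_right)
    then show ?thesis using add_smult_distrib_left_mat[OF c[OF A]] by simp
  qed
  ultimately show ?thesis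
    using c by (simp add: is_sl2_module_def sl2_tensor_def sl2_closed)
qed

lemma sl2_tensor_assoc:
  assumes "is_sl2_module U" "is_sl2_module V" "is_sl2_module W"
  shows "sl2_tensor (sl2_tensor U V) W = sl2_tensor U (sl2_tensor V W)"
proof -
  let ?l = "vdim U" and ?m = "vdim V" and ?n = "vdim W"
  have "(rep U A \<otimes>\<^sub>m 1\<^sub>m ?m + 1\<^sub>m ?l \<otimes>\<^sub>m rep V A) \<otimes>\<^sub>m 1\<^sub>m ?n + 1\<^sub>m (?l * ?m) \<otimes>\<^sub>m rep W A =
     rep U A \<otimes>\<^sub>m 1\<^sub>m (?m * ?n) + 1\<^sub>m ?l \<otimes>\<^sub>m (rep V A \<otimes>\<^sub>m 1\<^sub>m ?n + 1\<^sub>m ?m \<otimes>\<^sub>m rep W A)"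
    if A: "A \<in> sl2" for A
  proof -
    note r = rep_carrier[OF assms(1) A] rep_carrier[OF assms(2) A] rep_carrier[OF assms(3) A]
    have "rep U A \<otimes>\<^sub>m (1\<^sub>m ?m \<otimes>\<^sub>m 1\<^sub>m ?n) \<in> carrier_mat (?l * (?m * ?n)) (?l * (?m * ?n))"
      "1\<^sub>m ?l \<otimes>\<^sub>m (rep V A \<otimes>\<^sub>m 1\<^sub>m ?n) \<in> carrier_mat (?l * (?m * ?n)) (?l * (?m * ?n))"
      "1\<^sub>m ?l \<otimes>\<^sub>m (1\<^sub>m ?m \<otimes>\<^sub>m rep W A) \<in> carrier_mat (?l * (?m * ?n)) (?l * (?m * ?n))"
      using r by (intro kron_carrier; simp)+
    note assoc_add_mat[OF this]
    moreover have "(rep U A \<otimes>\<^sub>m 1\<^sub>m ?m + 1\<^sub>m ?l \<otimes>\<^sub>m rep V A) \<otimes>\<^sub>m 1\<^sub>m ?n =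
        rep U A \<otimes>\<^sub>m 1\<^sub>m ?m \<otimes>\<^sub>m 1\<^sub>m ?n + 1\<^sub>m ?l \<otimes>\<^sub>m rep V A \<otimes>\<^sub>m 1\<^sub>m ?n"
      using r by (subst kron_add_left[of _ "?l * ?m" "?l * ?m"]) (auto simp: kron_assoc)
    moreover have "1\<^sub>m ?l \<otimes>\<^sub>m (rep V A \<otimes>\<^sub>m 1\<^sub>m ?n + 1\<^sub>m ?m \<otimes>\<^sub>m rep W A) =
        1\<^sub>m ?l \<otimes>\<^sub>m rep V A \<otimes>\<^sub>m 1\<^sub>m ?n + 1\<^sub>m ?l \<otimes>\<^sub>m 1\<^sub>m ?m \<otimes>\<^sub>m rep W A"
      using r by (subst kron_add_right[of _ "?m * ?n" "?m * ?n"]) auto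
    ultimately show ?thesis by (simp add: kron_one[symmetric] kron_assoc)
  qed
  then show ?thesis by (auto simp: sl2_tensor_def mult.assoc intro!: restrict_ext)
qed

lemma rep_undefined: "is_sl2_module V \<Longrightarrow> A \<notin> sl2 \<Longrightarrow> rep V A = undefined"
  by (auto simp: is_sl2_module_def PiE_def extensional_def)

lemma sl2_tensor_trivial:
  assumes "is_sl2_module V"
  shows "sl2_tensor sl2_trivial V = V" "sl2_tensor V sl2_trivial = V"
proof -
  have "(\<lambda>A\<in>sl2. 0\<^sub>m 1 1 \<otimes>\<^sub>m 1\<^sub>m (vdim V) + rep V A) = rep V"
    "(\<lambda>A\<in>sl2. rep V A + 1\<^sub>m (vdim V) \<otimes>\<^sub>m 0\<^sub>m 1 1) = rep V"
    using assms by (auto simp: fun_eq_iff restrict_def rep_undefined kron_zero_left kron_zero_right)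
  then show "sl2_tensor sl2_trivial V = V" "sl2_tensor V sl2_trivial = V"
    by (auto simp: sl2_tensor_def sl2_trivial_def restrict_def cong: if_cong)
qed

lemma is_sl2_hom_tensor:
  assumes f: "is_sl2_hom f" and g: "is_sl2_hom g"
  shows "is_sl2_hom (TenA sl2_modules f g)"
proof -
  obtain V S V' where [simp]: "f = (V, S, V')" by (cases f)
  obtain W T W' where [simp]: "g = (W, T, W')" by (cases g)
  have m: "is_sl2_module V" "is_sl2_module V'" "is_sl2_module W" "is_sl2_module W'"
    and S: "S \<in> carrier_mat (vdim V') (vdim V)" and T: "T \<in> carrier_mat (vdim W') (vdim W)"
    using f g by (auto simp: is_sl2_hom_def)
  have "(S \<otimes>\<^sub>m T) * (rep V A \<otimes>\<^sub>m 1\<^sub>m (vdim W) + 1\<^sub>m (vdim V) \<otimes>\<^sub>m rep W A) =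
     (rep V' A \<otimes>\<^sub>m 1\<^sub>m (vdim W') + 1\<^sub>m (vdim V') \<otimes>\<^sub>m rep W' A) * (S \<otimes>\<^sub>m T)" if A: "A \<in> sl2" for A
  proof -
    note r = m[THEN rep_carrier, OF A]
    have e: "S * rep V A = rep V' A * S" "T * rep W A = rep W' A * T"
      using f g A by (auto simp: is_sl2_hom_def)
    have "(S \<otimes>\<^sub>m T) * (rep V A \<otimes>\<^sub>m 1\<^sub>m (vdim W) + 1\<^sub>m (vdim V) \<otimes>\<^sub>m rep W A) =
      (S * rep V A) \<otimes>\<^sub>m (T * 1\<^sub>m (vdim W)) + (S * 1\<^sub>m (vdim V)) \<otimes>\<^sub>m (T * rep W A)"
      using r S T by (subst mult_add_distrib_mat[of _ "vdim V' * vdim W'" "vdim V * vdim W"])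
        (auto simp: kron_mult[of S "vdim V'" "vdim V" _ "vdim V" T "vdim W'" "vdim W" _ "vdim W", symmetric]
          simp del: right_mult_one_mat)
    also have "\<dots> = (rep V' A * S) \<otimes>\<^sub>m (1\<^sub>m (vdim W') * T) + (1\<^sub>m (vdim V') * S) \<otimes>\<^sub>m (rep W' A * T)"
      using S T e by simp
    also have "\<dots> = (rep V' A \<otimes>\<^sub>m 1\<^sub>m (vdim W') + 1\<^sub>m (vdim V') \<otimes>\<^sub>m rep W' A) * (S \<otimes>\<^sub>m T)"
      using r S T by (subst add_mult_distrib_mat[of _ "vdim V' * vdim W'" "vdim V' * vdim W'"])
        (auto simp: kron_mult[of _ "vdim V'" "vdim V'" S "vdim V" _ "vdim W'" "vdim W'" T "vdim W", symmetric]
          simp del: left_mult_one_mat)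
    finally show ?thesis .
  qed
  then show ?thesis
    using m S T by (auto simp: is_sl2_hom_def sl2_modules_def is_sl2_module_tensor)
      (auto simp: sl2_tensor_def)
qed

lemma homset_sl2: "f \<in> homset sl2_modules V W \<longleftrightarrow>
   (\<exists>T. f = (V, T, W) \<and> is_sl2_hom (V, T, W))"
  by (cases f) (auto simp: homset_def sl2_modules_def)

lemma sl2_modules_simps [simp]:
  "Obj sl2_modules = {V. is_sl2_module V}"
  "Arr sl2_modules = {f. is_sl2_hom f}"
  "Dom sl2_modules f = src f"
  "Cod sl2_modules f = tgt f"
  "Idn sl2_modules V = (V, 1\<^sub>m (vdim V), V)"
  "Cmp sl2_modules g f = (src f, mtx g * mtx f, tgt g)"
  "Nul sl2_modules V W = (V, 0\<^sub>m (vdim W) (vdim V), W)"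
  "Pls sl2_modules f f' = (src f, mtx f + mtx f', tgt f)"
  "Scl sl2_modules c f = (src f, c \<cdot>\<^sub>m mtx f, tgt f)"
  "TenO sl2_modules V W = sl2_tensor V W"
  "TenA sl2_modules f f' = (sl2_tensor (src f) (src f'), mtx f \<otimes>\<^sub>m mtx f', sl2_tensor (tgt f) (tgt f'))"
  "Unt sl2_modules = sl2_trivial"
  "Asc sl2_modules U V W = (sl2_tensor (sl2_tensor U V) W, 1\<^sub>m (vdim U * vdim V * vdim W),
                      sl2_tensor U (sl2_tensor V W))"
  "Lun sl2_modules V = (sl2_tensor sl2_trivial V, 1\<^sub>m (vdim V), V)"
  "Run sl2_modules V = (sl2_tensor V sl2_trivial, 1\<^sub>m (vdim V), V)"
  by (simp_all add: sl2_modules_def)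

lemma vdim_simps [simp]: "vdim (sl2_tensor V W) = vdim V * vdim W" "vdim sl2_trivial = 1"
  by (simp_all add: sl2_tensor_def sl2_trivial_def)

lemma hom_eq_iff: "is_sl2_hom (V, T, W) \<longleftrightarrow> is_sl2_module V \<and> is_sl2_module W \<and>
    T \<in> carrier_mat (vdim W) (vdim V) \<and> (\<forall>A\<in>sl2. T * rep V A = rep W A * T)"
  by (simp add: is_sl2_hom_def)

lemma hom_zero: "is_sl2_module V \<Longrightarrow> is_sl2_module W \<Longrightarrow> is_sl2_hom (V, 0\<^sub>m (vdim W) (vdim V), W)"
  by (auto simp: hom_eq_iff dest!: rep_carrier)

lemma hom_id: "is_sl2_module V \<Longrightarrow> is_sl2_hom (V, 1\<^sub>m (vdim V), V)"
  by (auto simp: hom_eq_iff dest!: rep_carrier)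

lemma hom_add: "is_sl2_hom (V, S, W) \<Longrightarrow> is_sl2_hom (V, T, W) \<Longrightarrow> is_sl2_hom (V, S + T, W)"
  by (auto simp: hom_eq_iff add_mult_distrib_mat[of _ "vdim W" "vdim V"]
        mult_add_distrib_mat[of _ "vdim W" "vdim W"] add_mult_distrib_mat[of _ "vdim W" "vdim V" _ "rep V A" "vdim V" for A] rep_carrier)

lemma hom_smult:
  assumes "is_sl2_hom (V, S, W)" shows "is_sl2_hom (V, c \<cdot>\<^sub>m S, W)"
proof -
  have "(c \<cdot>\<^sub>m S) * rep V A = rep W A * (c \<cdot>\<^sub>m S)" if A: "A \<in> sl2" for A
    using assms A mult_smult_assoc_mat[of S "vdim W" "vdim V" "rep V A" "vdim V" c]
      mult_smult_distrib[of "rep W A" "vdim W" "vdim W" S "vdim V" c]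
    by (auto simp: hom_eq_iff)
  then show ?thesis using assms by (auto simp: hom_eq_iff)
qed

lemma hom_mult:
  assumes f: "is_sl2_hom (U, S, V)" and g: "is_sl2_hom (V, T, W)"
  shows "is_sl2_hom (U, T * S, W)"
proof -
  have "(T * S) * rep U A = rep W A * (T * S)" if A: "A \<in> sl2" for A
  proof -
    have m: "rep U A \<in> carrier_mat (vdim U) (vdim U)" "rep V A \<in> carrier_mat (vdim V) (vdim V)"
      "rep W A \<in> carrier_mat (vdim W) (vdim W)" "S \<in> carrier_mat (vdim V) (vdim U)"
      "T \<in> carrier_mat (vdim W) (vdim V)" "S * rep U A = rep V A * S" "T * rep V A = rep W A * T"
      using f g A by (auto simp: hom_eq_iff)
    then show ?thesis
      using assoc_mult_mat[OF m(5,4,1)] assoc_mult_mat[OF m(5,2,4)] assoc_mult_mat[OF m(3,5,4)] by simp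
  qed
  then show ?thesis using f g by (auto simp: hom_eq_iff)
qed

lemma hom_carrier: "is_sl2_hom (V, T, W) \<Longrightarrow> T \<in> carrier_mat (vdim W) (vdim V)"
  by (simp add: hom_eq_iff)

lemma hom_tensor: "is_sl2_hom (V, S, V') \<Longrightarrow> is_sl2_hom (W, T, W') \<Longrightarrow>
   is_sl2_hom (sl2_tensor V W, S \<otimes>\<^sub>m T, sl2_tensor V' W')"
  using is_sl2_hom_tensor by fastforce

lemma homsp_sl2:
  "carrier (homsp sl2_modules V W) = homset sl2_modules V W"
  "zero (homsp sl2_modules V W) = (V, 0\<^sub>m (vdim W) (vdim V), W)"
  "add (homsp sl2_modules V W) f g = (src f, mtx f + mtx g, tgt f)"
  "smult (homsp sl2_modules V W) c f = (src f, c \<cdot>\<^sub>m mtx f, tgt f)"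
  by (simp_all add: homsp_def)

lemma vectorspace_homsp_sl2:
  assumes "is_sl2_module V" "is_sl2_module W"
  shows "vectorspace complex_field (homsp sl2_modules V W)"
proof (rule vs_criteria)
  show "field complex_field" by (rule class_field.field_axioms)
  show "\<forall>v\<in>carrier (homsp sl2_modules V W). \<exists>neg_v\<in>carrier (homsp sl2_modules V W).
      v \<oplus>\<^bsub>homsp sl2_modules V W\<^esub> neg_v = \<zero>\<^bsub>homsp sl2_modules V W\<^esub>"
  proof
    fix v assume "v \<in> carrier (homsp sl2_modules V W)"
    then obtain T where T: "v = (V, T, W)" "is_sl2_hom (V, T, W)"
      by (auto simp: homsp_sl2 homset_sl2)
    then show "\<exists>neg_v\<in>carrier (homsp sl2_modules V W).
      v \<oplus>\<^bsub>homsp sl2_modules V W\<^esub> neg_v = \<zero>\<^bsub>homsp sl2_modules V W\<^esub>"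
      using hom_smult[OF T(2), of "-1"] hom_carrier[OF T(2)]
      by (intro bexI[of _ "(V, (-1) \<cdot>\<^sub>m T, W)"]) (auto simp: homsp_sl2 homset_sl2)
  qed
qed (use assms in \<open>auto simp: homsp_sl2 homset_sl2 hom_zero hom_add hom_smult
   algebra_simps dest!: hom_carrier intro!: eq_matI\<close>)

lemma linear_map_sl2:
  assumes "is_sl2_module V" "is_sl2_module W" "is_sl2_module V'" "is_sl2_module W'"
    and "\<And>T. is_sl2_hom (V, T, W) \<Longrightarrow> F (V, T, W) = (V', G T, W') \<and> is_sl2_hom (V', G T, W')"
    and "\<And>S T. is_sl2_hom (V, S, W) \<Longrightarrow> is_sl2_hom (V, T, W) \<Longrightarrow> G (S + T) = G S + G T"
    and "\<And>c T. is_sl2_hom (V, T, W) \<Longrightarrow> G (c \<cdot>\<^sub>m T) = c \<cdot>\<^sub>m G T"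
  shows "linear_map complex_field (homsp sl2_modules V W) (homsp sl2_modules V' W') F"
proof -
  interpret V: vectorspace complex_field "homsp sl2_modules V W"
    by (rule vectorspace_homsp_sl2[OF assms(1,2)])
  interpret W: vectorspace complex_field "homsp sl2_modules V' W'"
    by (rule vectorspace_homsp_sl2[OF assms(3,4)])
  show ?thesis
  proof
    show "F \<in> LinearCombinations.module_hom complex_field (homsp sl2_modules V W) (homsp sl2_modules V' W')"
      using assms(5-) by (auto simp: LinearCombinations.module_hom_def homsp_sl2 homset_sl2 hom_add hom_smult)
  qed
qed

theorem monoidal_category_sl2_modules: "monoidal_category sl2_modules"
proof -
  have mod: "is_sl2_module V" "is_sl2_module W" if "is_sl2_hom (V, T, W)" for V T W
    using that by (auto simp: hom_eq_iff)
  note simps = homset_sl2 hom_id hom_mult hom_tensor is_sl2_module_tensor is_sl2_module_trivial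
  have "linear_category sl2_modules"
  proof (rule linear_category.intro)
    show "f \<in> Arr sl2_modules \<Longrightarrow> Dom sl2_modules f \<in> Obj sl2_modules" for f
      by (simp add: is_sl2_hom_def)
    show "f \<in> Arr sl2_modules \<Longrightarrow> Cod sl2_modules f \<in> Obj sl2_modules" for f
      by (simp add: is_sl2_hom_def)
    show "Cmp sl2_modules (Cmp sl2_modules h g) f = Cmp sl2_modules h (Cmp sl2_modules g f)"
      if "f \<in> homset sl2_modules W X" "g \<in> homset sl2_modules X Y" "h \<in> homset sl2_modules Y Z"
      for f g h W X Y Z
      using that by (auto simp: homset_sl2 dest!: hom_carrier)
    show "linear_map complex_field (homsp sl2_modules X Y) (homsp sl2_modules X Z) (\<lambda>f. Cmp sl2_modules g f)"
      if X: "X \<in> Obj sl2_modules" and g: "g \<in> homset sl2_modules Y Z" for X Y Z g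
    proof -
      from g obtain T where T: "g = (Y, T, Z)" "is_sl2_hom (Y, T, Z)" by (auto simp: homset_sl2)
      then show ?thesis using X mod[OF T(2)] hom_carrier[OF T(2)]
        by (intro linear_map_sl2[where G = "\<lambda>S. T * S"])
           (auto simp: hom_mult mult_add_distrib_mat[of _ "vdim Z" "vdim Y"] mult_smult_distrib[of _ "vdim Z" "vdim Y"]
             dest!: hom_carrier)
    qed
    show "linear_map complex_field (homsp sl2_modules Y Z) (homsp sl2_modules X Z) (\<lambda>g. Cmp sl2_modules g f)"
      if f: "f \<in> homset sl2_modules X Y" and Z: "Z \<in> Obj sl2_modules" for X Y Z f
    proof -
      from f obtain T where T: "f = (X, T, Y)" "is_sl2_hom (X, T, Y)" by (auto simp: homset_sl2)
      then show ?thesis using Z mod[OF T(2)] hom_carrier[OF T(2)]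
        by (intro linear_map_sl2[where G = "\<lambda>S. S * T"])
           (auto simp: hom_mult add_mult_distrib_mat[of _ "vdim Z" "vdim Y"] mult_smult_assoc_mat[of _ "vdim Z" "vdim Y"]
             dest!: hom_carrier)
    qed
  qed (auto simp: simps vectorspace_homsp_sl2 dest: hom_carrier)
  then interpret C: linear_category sl2_modules .
  have iso: "is_iso sl2_modules V V (V, 1\<^sub>m (vdim V), V)" if "is_sl2_module V" for V
    using that by (auto simp: is_iso_def simps intro!: bexI[of _ "(V, 1\<^sub>m (vdim V), V)"])
  show ?thesis
  proof (intro monoidal_category.intro monoidal_category_axioms.intro C.linear_category_axioms)
    show "linear_map complex_field (homsp sl2_modules V V')
       (homsp sl2_modules (TenO sl2_modules V W) (TenO sl2_modules V' W')) (\<lambda>f. TenA sl2_modules f g)"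
      if "V \<in> Obj sl2_modules" "V' \<in> Obj sl2_modules" "g \<in> homset sl2_modules W W'" for V V' W W' g
    proof -
      from that obtain T where T: "g = (W, T, W')" "is_sl2_hom (W, T, W')" by (auto simp: homset_sl2)
      then show ?thesis using that mod[OF T(2)]
        by (intro linear_map_sl2[where G = "\<lambda>S. S \<otimes>\<^sub>m T"])
           (auto simp: simps kron_add_left[of _ "vdim V'" "vdim V"] kron_smult_left hom_carrier)
    qed
    show "linear_map complex_field (homsp sl2_modules W W')
       (homsp sl2_modules (TenO sl2_modules V W) (TenO sl2_modules V' W')) (\<lambda>g. TenA sl2_modules f g)"
      if "f \<in> homset sl2_modules V V'" "W \<in> Obj sl2_modules" "W' \<in> Obj sl2_modules" for V V' W W' f
    proof -
      from that obtain T where T: "f = (V, T, V')" "is_sl2_hom (V, T, V')" by (auto simp: homset_sl2)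
      then show ?thesis using that mod[OF T(2)]
        by (intro linear_map_sl2[where G = "\<lambda>S. T \<otimes>\<^sub>m S"])
           (auto simp: simps kron_add_right[of _ "vdim W'" "vdim W"] kron_smult_right hom_carrier)
    qed
    show "TenA sl2_modules (Cmp sl2_modules f' f) (Cmp sl2_modules g' g) =
        Cmp sl2_modules (TenA sl2_modules f' g') (TenA sl2_modules f g)"
      if "f \<in> homset sl2_modules V V'" "f' \<in> homset sl2_modules V' V''"
        "g \<in> homset sl2_modules W W'" "g' \<in> homset sl2_modules W' W''" for f f' g g' V V' V'' W W' W''
      using that by (auto simp: homset_sl2 kron_mult dest!: hom_carrier)
    show "is_iso sl2_modules (TenO sl2_modules (TenO sl2_modules U V) W)
         (TenO sl2_modules U (TenO sl2_modules V W)) (Asc sl2_modules U V W)"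
      if "U \<in> Obj sl2_modules" "V \<in> Obj sl2_modules" "W \<in> Obj sl2_modules" for U V W
      using that iso[of "sl2_tensor U (sl2_tensor V W)"]
      by (simp add: sl2_tensor_assoc is_sl2_module_tensor mult.assoc)
    show "Cmp sl2_modules (Asc sl2_modules U' V' W') (TenA sl2_modules (TenA sl2_modules f g) h) =
       Cmp sl2_modules (TenA sl2_modules f (TenA sl2_modules g h)) (Asc sl2_modules U V W)"
      if "f \<in> homset sl2_modules U U'" "g \<in> homset sl2_modules V V'" "h \<in> homset sl2_modules W W'"
      for f g h U U' V V' W W'
      using that by (auto simp: homset_sl2 kron_assoc mult.assoc dest!: hom_carrier)
    show "is_iso sl2_modules (TenO sl2_modules (Unt sl2_modules) V) V (Lun sl2_modules V)"
      "is_iso sl2_modules (TenO sl2_modules V (Unt sl2_modules)) V (Run sl2_modules V)"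
      if "V \<in> Obj sl2_modules" for V
      using that iso by (simp_all add: sl2_tensor_trivial)
  qed (auto simp: simps kron_one mult.assoc sl2_tensor_trivial dest: hom_carrier)
qed

end

theory Submission
  imports Defs "HOL-Computational_Algebra.Fundamental_Theorem_Algebra"
begin

text \<open>
  Write \<open>F = L(1) \<cdot> _\<close>. Since \<open>L(1)\<close> is self-dual, \<open>F\<close> is self-adjoint, with unit \<open>\<eta>\<close> and counit \<open>\<epsilon>\<close>
  such that \<open>\<epsilon> \<eta>\<close> is a nonzero scalar. Let \<open>S\<^sub>i\<close> be the simple functor \<open>Hom(-, X\<^sub>i) / rad(-, X\<^sub>i)\<close>, on which
  \<open>F\<close> acts by precomposition. Counting multiplicities, \<open>F S\<^sub>1 = S\<^sub>2\<close>, while \<open>F S\<^sub>2\<close> contains \<open>S\<^sub>1\<close> twice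
  and \<open>S\<^sub>3\<close> once. As \<open>\<epsilon> \<eta> \<noteq> 0\<close>, \<open>F F S\<^sub>1 = F S\<^sub>2 = S\<^sub>1 \<oplus> Q\<close> where \<open>Q\<close> has the composition factors
  \<open>S\<^sub>1\<close> and \<open>S\<^sub>3\<close>. But \<open>Hom(S\<^sub>1, F F S\<^sub>1) = End(F S\<^sub>1) = End(S\<^sub>2)\<close> is one-dimensional, so \<open>S\<^sub>1\<close> is neither a
  subobject nor, dually, a quotient of \<open>Q\<close>, which is absurd.

  Here the argument is carried out inside the category, with residues of endomorphisms in place of
  composition multiplicities: the two non-vanishing conditions on \<open>Q\<close> give maps \<open>X\<^sub>1 \<rightarrow> X\<^sub>3 \<rightarrow> X\<^sub>1\<close> whose
  composite has residue zero and yet acts as a nonzero scalar on \<open>Q(X\<^sub>1)\<close>.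
\<close>


section \<open>Arithmetic in linear categories\<close>

context linear_category
begin

lemma Dom_simp [simp]: "f \<in> Arr C \<Longrightarrow> Dom C f \<in> Obj C" and Cod_simp [simp]: "f \<in> Arr C \<Longrightarrow> Cod C f \<in> Obj C"
  by (rule Dom_in, assumption) (rule Cod_in)

lemma Idn_simps [simp]:
  assumes "X \<in> Obj C"
  shows "Idn C X \<in> Arr C" "Dom C (Idn C X) = X" "Cod C (Idn C X) = X"
  using Idn_in[OF assms] by (auto simp: homset_def)

lemma Cmp_simps [simp]:
  assumes "f \<in> Arr C" "g \<in> Arr C" "Dom C g = Cod C f"
  shows "g \<cdot> f \<in> Arr C" "Dom C (g \<cdot> f) = Dom C f" "Cod C (g \<cdot> f) = Cod C g"
  using Cmp_in[of f "Dom C f" "Cod C f" g "Cod C g"] assms by (auto simp: homset_def)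

text \<open>Typing conditions are phrased with \<open>Dom\<close> and \<open>Cod\<close> instead of
  \<open>homset\<close>, so that the simplifier can discharge them; composites are normalised to
  right-nested form.\<close>

lemma Cmp_assoc' [simp]:
  assumes "f \<in> Arr C" "g \<in> Arr C" "h \<in> Arr C" "Dom C h = Cod C g" "Dom C g = Cod C f"
  shows "(h \<cdot> g) \<cdot> f = h \<cdot> g \<cdot> f"
  using assms by (intro Cmp_assoc[of _ "Dom C f" "Cod C f" _ "Cod C g" _ "Cod C h"]) (auto simp: homset_def)

lemma Cmp_Idn [simp]:
  assumes "f \<in> Arr C"
  shows "Cod C f = X \<Longrightarrow> Idn C X \<cdot> f = f" "Dom C f = X \<Longrightarrow> f \<cdot> Idn C X = f"
  using assms by (auto intro!: Idn_left Idn_right simp: homset_def)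

text \<open>The vector space axioms of \<open>homsp C X Y\<close>, read off the library locale in
  terms of the operations of the category.\<close>

lemma hom_laws:
  assumes f: "f \<in> homset C X Y"
  shows "Scl C c f \<in> homset C X Y"
    and "Scl C c (Scl C d f) = Scl C (c * d) f"
    and "Scl C 1 f = f"
    and "Scl C 0 f = Nul C X Y"
    and "Nul C X Y \<in> homset C X Y"
    and "Pls C f (Nul C X Y) = f"
    and "Scl C (c + d) f = Pls C (Scl C c f) (Scl C d f)"
    and "g \<in> homset C X Y \<Longrightarrow> Pls C f g \<in> homset C X Y"
    and "g \<in> homset C X Y \<Longrightarrow> Pls C f g = Pls C g f"
    and "g \<in> homset C X Y \<Longrightarrow> h \<in> homset C X Y \<Longrightarrow> Pls C (Pls C f g) h = Pls C f (Pls C g h)"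
    and "g \<in> homset C X Y \<Longrightarrow> Scl C c (Pls C f g) = Pls C (Scl C c f) (Scl C c g)"
proof -
  have "X \<in> Obj C" "Y \<in> Obj C" using f by (auto simp: homset_def)
  then interpret V: vectorspace complex_field "homsp C X Y" by (rule hom_vectorspace)
  note [simp] = homsp_def
  show "Scl C c f \<in> homset C X Y" "Nul C X Y \<in> homset C X Y"
    "Scl C c (Scl C d f) = Scl C (c * d) f" "Scl C 1 f = f" "Scl C 0 f = Nul C X Y"
    "Pls C f (Nul C X Y) = f" "Scl C (c + d) f = Pls C (Scl C c f) (Scl C d f)"
    using f V.smult_closed[of c f] V.smult_assoc1[of c d f] V.smult_one[of f] V.lmult_0[of f]
      V.M.zero_closed V.M.r_zero[of f] V.smult_l_distr[of c d f] by simp_all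
  assume g: "g \<in> homset C X Y"
  show "Pls C f g \<in> homset C X Y" "Pls C f g = Pls C g f"
    "Scl C c (Pls C f g) = Pls C (Scl C c f) (Scl C c g)"
    using f g V.M.a_closed[of f g] V.M.a_comm[of f g] V.smult_r_distr[of c f g] by simp_all
  assume "h \<in> homset C X Y"
  then show "Pls C (Pls C f g) h = Pls C f (Pls C g h)" using f g V.M.a_assoc[of f g h] by simp
qed

lemma Scl_simps [simp]:
  assumes "f \<in> Arr C"
  shows "Scl C c f \<in> Arr C" "Dom C (Scl C c f) = Dom C f" "Cod C (Scl C c f) = Cod C f"
    "Scl C c (Scl C d f) = Scl C (c * d) f" "Scl C 1 f = f"
  using hom_laws(1-3)[of f "Dom C f" "Cod C f"] assms by (auto simp: homset_def)

lemma Nul_simps [simp]: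
  assumes "X \<in> Obj C" "Y \<in> Obj C"
  shows "Nul C X Y \<in> Arr C" "Dom C (Nul C X Y) = X" "Cod C (Nul C X Y) = Y" "Scl C c (Nul C X Y) = Nul C X Y"
proof -
  interpret V: vectorspace complex_field "homsp C X Y" using assms by (rule hom_vectorspace)
  have "Nul C X Y \<in> homset C X Y" "Scl C c (Nul C X Y) = Nul C X Y"
    using V.M.zero_closed V.rmult_0[of c] by (simp_all add: homsp_def)
  then show "Nul C X Y \<in> Arr C" "Dom C (Nul C X Y) = X" "Cod C (Nul C X Y) = Y"
    "Scl C c (Nul C X Y) = Nul C X Y"
    by (auto simp: homset_def)
qed

lemma Scl_0: "f \<in> Arr C \<Longrightarrow> Scl C 0 f = Nul C (Dom C f) (Cod C f)"
  using hom_laws(4)[of f "Dom C f" "Cod C f"] by (auto simp: homset_def)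

lemma Pls_simps [simp]:
  assumes "f \<in> Arr C" "g \<in> Arr C" "Dom C f = Dom C g" "Cod C f = Cod C g"
  shows "Pls C f g \<in> Arr C" "Dom C (Pls C f g) = Dom C g" "Cod C (Pls C f g) = Cod C g"
    "Scl C c (Pls C f g) = Pls C (Scl C c f) (Scl C c g)"
  using hom_laws(8,11)[of f "Dom C f" "Cod C f" g] assms by (auto simp: homset_def)

lemma Pls_commute:
  assumes "f \<in> Arr C" "g \<in> Arr C" "Dom C f = Dom C g" "Cod C f = Cod C g"
  shows "Pls C f g = Pls C g f"
  using hom_laws(9)[of f "Dom C f" "Cod C f" g] assms by (auto simp: homset_def)

lemma Pls_assoc:
  assumes "f \<in> Arr C" "g \<in> Arr C" "h \<in> Arr C"
    "Dom C f = Dom C h" "Cod C f = Cod C h" "Dom C g = Dom C h" "Cod C g = Cod C h"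
  shows "Pls C (Pls C f g) h = Pls C f (Pls C g h)"
  using hom_laws(10)[of f "Dom C f" "Cod C f" g h] assms by (auto simp: homset_def)

lemma Pls_left_commute:
  assumes "f \<in> Arr C" "g \<in> Arr C" "h \<in> Arr C"
    "Dom C f = Dom C h" "Cod C f = Cod C h" "Dom C g = Dom C h" "Cod C g = Cod C h"
  shows "Pls C f (Pls C g h) = Pls C g (Pls C f h)"
  using assms by (metis Pls_assoc Pls_commute)

lemma Pls_Nul [simp]:
  assumes "f \<in> Arr C" "Dom C f = X" "Cod C f = Y"
  shows "Pls C f (Nul C X Y) = f" "Pls C (Nul C X Y) f = f"
  using hom_laws(6)[of f X Y] assms Pls_commute[of "Nul C X Y" f] by (auto simp: homset_def)

lemma Scl_add:
  assumes "f \<in> Arr C"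
  shows "Pls C (Scl C c f) (Scl C d f) = Scl C (c + d) f"
  using hom_laws(7)[of f "Dom C f" "Cod C f"] assms by (auto simp: homset_def)

lemma Cmp_bilinear [simp]:
  assumes "h \<in> Arr C"
  shows "\<lbrakk>f \<in> Arr C; g \<in> Arr C; Dom C f = Dom C g; Cod C f = Cod C g; Dom C h = Cod C g\<rbrakk>
      \<Longrightarrow> h \<cdot> Pls C f g = Pls C (h \<cdot> f) (h \<cdot> g)"
    and "\<lbrakk>f \<in> Arr C; g \<in> Arr C; Dom C f = Dom C g; Cod C f = Cod C g; Cod C h = Dom C g\<rbrakk>
      \<Longrightarrow> Pls C f g \<cdot> h = Pls C (f \<cdot> h) (g \<cdot> h)"
    and "\<lbrakk>f \<in> Arr C; Dom C h = Cod C f\<rbrakk> \<Longrightarrow> h \<cdot> Scl C c f = Scl C c (h \<cdot> f)"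
    and "\<lbrakk>f \<in> Arr C; Cod C h = Dom C f\<rbrakk> \<Longrightarrow> Scl C c f \<cdot> h = Scl C c (f \<cdot> h)"
    and "\<lbrakk>X \<in> Obj C; Y = Dom C h\<rbrakk> \<Longrightarrow> h \<cdot> Nul C X Y = Nul C X (Cod C h)"
    and "\<lbrakk>X = Cod C h; Y \<in> Obj C\<rbrakk> \<Longrightarrow> Nul C X Y \<cdot> h = Nul C (Dom C h) Y"
proof -
  have h: "h \<in> homset C (Dom C h) (Cod C h)" using assms by (simp add: homset_def)
  note r = Cmp_linear_left[OF h] and l = Cmp_linear_right[OF _ h]
  have l1: "h \<cdot> Pls C f g = Pls C (h \<cdot> f) (h \<cdot> g)" "h \<cdot> Scl C c f = Scl C c (h \<cdot> f)"
    if f: "f \<in> homset C X (Dom C h)" and g: "g \<in> homset C X (Dom C h)" and X: "X \<in> Obj C" for X c f g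
  proof -
    interpret linear_map complex_field "homsp C X (Dom C h)" "homsp C X (Cod C h)" "\<lambda>f. h \<cdot> f"
      by (rule l[OF X])
    show "h \<cdot> Pls C f g = Pls C (h \<cdot> f) (h \<cdot> g)" "h \<cdot> Scl C c f = Scl C c (h \<cdot> f)"
      using T_add[of f g] T_smult[of c f] f g by (simp_all add: homsp_def)
  qed
  have r1: "Pls C f g \<cdot> h = Pls C (f \<cdot> h) (g \<cdot> h)" "Scl C c f \<cdot> h = Scl C c (f \<cdot> h)"
    if f: "f \<in> homset C (Cod C h) X" and g: "g \<in> homset C (Cod C h) X" and X: "X \<in> Obj C" for X c f g
  proof -
    interpret linear_map complex_field "homsp C (Cod C h) X" "homsp C (Dom C h) X" "\<lambda>f. f \<cdot> h"
      by (rule r[OF X])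
    show "Pls C f g \<cdot> h = Pls C (f \<cdot> h) (g \<cdot> h)" "Scl C c f \<cdot> h = Scl C c (f \<cdot> h)"
      using T_add[of f g] T_smult[of c f] f g by (simp_all add: homsp_def)
  qed
  show "\<lbrakk>f \<in> Arr C; g \<in> Arr C; Dom C f = Dom C g; Cod C f = Cod C g; Dom C h = Cod C g\<rbrakk>
      \<Longrightarrow> h \<cdot> Pls C f g = Pls C (h \<cdot> f) (h \<cdot> g)"
    using l1(1)[of f "Dom C f" g] by (auto simp: homset_def)
  show "\<lbrakk>f \<in> Arr C; g \<in> Arr C; Dom C f = Dom C g; Cod C f = Cod C g; Cod C h = Dom C g\<rbrakk>
      \<Longrightarrow> Pls C f g \<cdot> h = Pls C (f \<cdot> h) (g \<cdot> h)"
    using r1(1)[of f "Cod C f" g] by (auto simp: homset_def)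
  show "\<lbrakk>f \<in> Arr C; Dom C h = Cod C f\<rbrakk> \<Longrightarrow> h \<cdot> Scl C c f = Scl C c (h \<cdot> f)"
    using l1(2)[of f "Dom C f" f] by (auto simp: homset_def)
  show "\<lbrakk>f \<in> Arr C; Cod C h = Dom C f\<rbrakk> \<Longrightarrow> Scl C c f \<cdot> h = Scl C c (f \<cdot> h)"
    using r1(2)[of f "Cod C f" f] by (auto simp: homset_def)
  \<comment> \<open>Zero arrows are covered by homogeneity at the scalar 0.\<close>
  show "\<lbrakk>X \<in> Obj C; Y = Dom C h\<rbrakk> \<Longrightarrow> h \<cdot> Nul C X Y = Nul C X (Cod C h)"
    using l1(2)[of "Nul C X Y" X "Nul C X Y" 0] assms by (auto simp: homset_def Scl_0)
  show "\<lbrakk>X = Cod C h; Y \<in> Obj C\<rbrakk> \<Longrightarrow> Nul C X Y \<cdot> h = Nul C (Dom C h) Y"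
    using r1(2)[of "Nul C X Y" Y "Nul C X Y" 0] assms by (auto simp: homset_def Scl_0)
qed

subsection \<open>Local objects and residues\<close>

lemma is_isoI:
  assumes "f \<in> Arr C" "g \<in> Arr C" "Dom C f = X" "Cod C f = Y" "Dom C g = Y" "Cod C g = X"
    "g \<cdot> f = Idn C X" "f \<cdot> g = Idn C Y"
  shows "is_iso C X Y f"
  using assms by (auto simp: is_iso_def homset_def)

lemma is_isoE:
  assumes "is_iso C X Y f"
  obtains g where "f \<in> Arr C" "g \<in> Arr C" "Dom C f = X" "Cod C f = Y" "Dom C g = Y" "Cod C g = X"
    "g \<cdot> f = Idn C X" "f \<cdot> g = Idn C Y"
  using assms by (auto simp: is_iso_def homset_def)

definition local_object :: "'o \<Rightarrow> bool"
  where "local_object X \<longleftrightarrow> X \<in> Obj C \<and> local_endomorphism_ring C X"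

lemma local_object_in [simp]: "local_object X \<Longrightarrow> X \<in> Obj C"
  by (simp add: local_object_def)

lemma Units_homsp: "Units (homsp C X X) = {f. is_iso C X X f}"
  by (auto simp: Units_def homsp_def is_iso_def)

lemma local_object_Idn: "local_object X \<Longrightarrow> Idn C X \<noteq> Nul C X X"
  by (simp add: local_object_def local_endomorphism_ring_def homsp_def Let_def)

lemma local_object_add:
  assumes "local_object X" and f: "f \<in> Arr C" "Dom C f = X" "Cod C f = X"
    and g: "g \<in> Arr C" "Dom C g = X" "Cod C g = X" and s: "is_iso C X X (Pls C f g)"
  shows "is_iso C X X f \<or> is_iso C X X g"
proof (rule ccontr)
  assume n: "\<not> ?thesis"
  let ?E = "homsp C X X"
  have "\<forall>f \<in> carrier ?E - Units ?E. \<forall>g \<in> carrier ?E - Units ?E. Pls C f g \<notin> Units ?E"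
    using assms(1) by (simp add: local_object_def local_endomorphism_ring_def Let_def homsp_def)
  moreover have "f \<in> carrier ?E" "g \<in> carrier ?E"
    using f g by (simp_all add: homsp_def homset_def)
  ultimately show False
    using n s unfolding Units_homsp by blast
qed

text \<open>\<open>f \<cdot> g\<close> is idempotent, and by locality it or its complement is
  invertible. The complement kills \<open>f\<close>, so its invertibility would force
  \<open>Idn C X\<close> to vanish; an invertible idempotent is the identity.\<close>

lemma split_local_object:
  assumes Y: "local_object Y" and f: "f \<in> Arr C" "Dom C f = X" "Cod C f = Y"
    and g: "g \<in> Arr C" "Dom C g = Y" "Cod C g = X"
    and gf: "g \<cdot> f = Idn C X" and X: "Idn C X \<noteq> Nul C X X"
  shows "f \<cdot> g = Idn C Y"
proof -
  let ?e = "f \<cdot> g" and ?e' = "Pls C (Idn C Y) (Scl C (-1) (f \<cdot> g))"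
  note [simp] = f g Y gf
  have Xo[simp]: "X \<in> Obj C" using f(1,2) Dom_simp by blast
  have Z: "Pls C (Scl C (-1) h) h = Nul C (Dom C h) (Cod C h)"
     "Pls C h (Scl C (-1) h) = Nul C (Dom C h) (Cod C h)" if "h \<in> Arr C" for h
    using Scl_add[OF that, of "-1" 1] Scl_add[OF that, of "1" "-1"] that by (simp_all add: Scl_0)
  have "Pls C ?e' ?e = Idn C Y"
    by (simp add: Pls_assoc Z)
  moreover have "is_iso C Y Y (Idn C Y)"
    by (rule is_isoI[where g = "Idn C Y"]) auto
  ultimately have "is_iso C Y Y ?e' \<or> is_iso C Y Y ?e"
    by (intro local_object_add) auto
  then show ?thesis
  proof
    assume "is_iso C Y Y ?e'"
    then obtain v where v: "v \<in> Arr C" "Dom C v = Y" "Cod C v = Y" "v \<cdot> ?e' = Idn C Y"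
      by (rule is_isoE)
    have "?e' \<cdot> f = Nul C X Y"
      by (simp add: Z)
    then have "v \<cdot> (?e' \<cdot> f) = Nul C X Y" using v by simp
    moreover have "v \<cdot> (?e' \<cdot> f) = (v \<cdot> ?e') \<cdot> f"
      by (rule Cmp_assoc'[symmetric]) (use v in auto)
    ultimately have "f = Nul C X Y" using v(4) by simp
    with gf have "Idn C X = Nul C X X" using Cmp_bilinear(5)[OF g(1), of X Y] by simp
    with X show ?thesis by simp
  next
    assume "is_iso C Y Y ?e"
    then obtain v where v: "v \<in> Arr C" "Dom C v = Y" "Cod C v = Y" "v \<cdot> ?e = Idn C Y"
      by (rule is_isoE)
    have "?e \<cdot> ?e = f \<cdot> (g \<cdot> f) \<cdot> g" by (simp del: gf)
    also have "\<dots> = ?e" by (simp del: Cmp_assoc')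
    finally have "?e \<cdot> ?e = ?e" .
    then have "v \<cdot> ?e \<cdot> ?e = v \<cdot> ?e" by simp
    moreover have "v \<cdot> ?e \<cdot> ?e = (v \<cdot> ?e) \<cdot> ?e"
      by (rule Cmp_assoc'[symmetric]) (use v in auto)
    ultimately show ?thesis using v(4) by simp
  qed
qed

text \<open>One-sided inverses in a local ring are two-sided: this is
  \<open>split_local_object\<close> with both objects equal to \<open>X\<close>.\<close>

lemma local_object_mult:
  assumes X: "local_object X" and f: "f \<in> Arr C" "Dom C f = X" "Cod C f = X"
    and g: "g \<in> Arr C" "Dom C g = X" "Cod C g = X" and iso: "is_iso C X X (g \<cdot> f)"
  shows "is_iso C X X f" "is_iso C X X g"
proof -
  from iso obtain u where u: "u \<in> Arr C" "Dom C u = X" "Cod C u = X" "u \<cdot> g \<cdot> f = Idn C X"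
      "(g \<cdot> f) \<cdot> u = Idn C X"
    by (rule is_isoE)
  note [simp] = f g u(1-4) X
  have "f \<cdot> (u \<cdot> g) = Idn C X"
    by (rule split_local_object[OF X, of _ X]) (auto simp: local_object_Idn)
  then show "is_iso C X X f"
    by (intro is_isoI[where g = "u \<cdot> g"]) auto
  have "(f \<cdot> u) \<cdot> g = Idn C X"
    by (rule split_local_object[OF X, of _ X]) (use u(5) in \<open>auto simp: local_object_Idn\<close>)
  then show "is_iso C X X g"
    by (intro is_isoI[where g = "f \<cdot> u"]) (use u(5) in auto)
qed

section \<open>Polynomials in an endomorphism, and eigenvalues\<close>

text \<open>The evaluation p(f), by Horner's scheme.\<close>

definition poly_end :: "'o \<Rightarrow> 'a \<Rightarrow> complex poly \<Rightarrow> 'a"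
  where "poly_end X f p = fold_coeffs (\<lambda>a g. Pls C (Scl C a (Idn C X)) (f \<cdot> g)) p (Nul C X X)"

context
  fixes X f
  assumes f: "f \<in> Arr C" "Dom C f = X" "Cod C f = X"
begin

lemma endo_Obj: "X \<in> Obj C" using f Dom_simp by blast

lemma poly_end_0 [simp]: "poly_end X f 0 = Nul C X X"
  by (simp add: poly_end_def)

lemma poly_end_pCons [simp]: "poly_end X f (pCons a p) = Pls C (Scl C a (Idn C X)) (f \<cdot> poly_end X f p)"
  using f endo_Obj by (cases "p = 0"; cases "a = 0") (auto simp: poly_end_def Scl_0)

lemma poly_end_in [simp]: "poly_end X f p \<in> Arr C" "Dom C (poly_end X f p) = X" "Cod C (poly_end X f p) = X"
  by (induction p) (use f endo_Obj in auto)

lemma poly_end_add: "poly_end X f (p + q) = Pls C (poly_end X f p) (poly_end X f q)"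
  by (induction p q rule: poly_induct2)
    (use f endo_Obj in \<open>auto simp: Scl_add[symmetric] Pls_assoc Pls_left_commute Pls_commute\<close>)

lemma poly_end_smult: "poly_end X f (Polynomial.smult c p) = Scl C c (poly_end X f p)"
  by (induction p) (use f endo_Obj in auto)

lemma poly_end_root:
  "poly_end X f ([:-c, 1:] * q) = Pls C f (Scl C (-c) (Idn C X)) \<cdot> poly_end X f q"
proof -
  have "[:-c, 1:] * q = Polynomial.smult (-c) q + pCons 0 q" by simp
  then show ?thesis
    using f endo_Obj by (simp only: poly_end_add poly_end_smult) (simp add: Pls_commute Scl_0)
qed

text \<open>Induction on the degree: \<open>p\<close> has a root \<open>c\<close>, and either f - c
  is not invertible, or it can be cancelled and the quotient still annihilates \<open>f\<close>. A
  nonzero constant cannot annihilate, as the identity is nonzero.\<close>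

lemma poly_end_zero_nonunit:
  assumes X: "Idn C X \<noteq> Nul C X X" and "p \<noteq> 0" "poly_end X f p = Nul C X X"
  shows "\<exists>c. \<not> is_iso C X X (Pls C f (Scl C (-c) (Idn C X)))"
  using assms(2-)
proof (induction "degree p" arbitrary: p rule: less_induct)
  case less
  note [simp] = f endo_Obj
  show ?case
  proof (cases "degree p = 0")
    case True
    then obtain a where p: "p = [:a:]" "a \<noteq> 0" using less.prems by (metis degree_eq_zeroE pCons_eq_0_iff)
    then have "Scl C a (Idn C X) = Nul C X X" using less.prems by simp
    then have "Scl C (inverse a) (Scl C a (Idn C X)) = Nul C X X" by simp
    with p have "Idn C X = Nul C X X" by (simp del: Nul_simps)
    with X show ?thesis by simp
  next
    case False
    then have "\<not> constant (poly p)" by (simp add: constant_degree)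
    then obtain c where "poly p c = 0" using fundamental_theorem_of_algebra by blast
    then obtain q where q: "p = [:-c, 1:] * q" by (auto simp: poly_eq_0_iff_dvd elim: dvdE)
    with less.prems have "q \<noteq> 0" by auto
    have deg: "degree q < degree p"
      using \<open>q \<noteq> 0\<close> unfolding q by (subst degree_mult_eq) auto
    let ?g = "Pls C f (Scl C (-c) (Idn C X))"
    have g: "?g \<in> Arr C" "Dom C ?g = X" "Cod C ?g = X" by auto
    have z: "?g \<cdot> poly_end X f q = Nul C X X" using less.prems q poly_end_root by simp
    show ?thesis
    proof (cases "is_iso C X X ?g")
      case True
      then obtain u where u: "u \<in> Arr C" "Dom C u = X" "Cod C u = X" "u \<cdot> ?g = Idn C X"
        by (rule is_isoE)
      have "u \<cdot> ?g \<cdot> poly_end X f q = (u \<cdot> ?g) \<cdot> poly_end X f q"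
        by (rule Cmp_assoc'[symmetric]) (use u g in auto)
      then have "poly_end X f q = Nul C X X" using u z by (simp del: Cmp_bilinear(1,2))
      with less.hyps[OF deg \<open>q \<noteq> 0\<close>] show ?thesis by blast
    qed blast
  qed
qed

text \<open>The powers of \<open>f\<close> with exponents from 0 to the dimension are one too many
  to be independent.\<close>

lemma poly_end_exists_zero:
  assumes fd: "vectorspace.fin_dim complex_field (homsp C X X)"
  shows "\<exists>p. p \<noteq> 0 \<and> poly_end X f p = Nul C X X"
proof -
  note [simp] = f endo_Obj
  let ?V = "homsp C X X"
  interpret V: vectorspace complex_field ?V by (rule hom_vectorspace) auto
  define P where "P k = poly_end X f (monom 1 k)" for k
  have carr: "carrier ?V = homset C X X" by (simp add: homsp_def)
  have P_in: "P k \<in> homset C X X" for k by (simp add: P_def homset_def)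
  show ?thesis
  \<comment> \<open>Linear dependence is a property of a set of vectors, so coinciding powers, which
    would shrink the set, are treated apart: there a difference of two monomials annihilates
    \<open>f\<close>.\<close>
  proof (cases "inj_on P {..V.dim}")
    case False
    then obtain i j where ij: "i \<noteq> j" "P i = P j" by (auto simp: inj_on_def)
    have "poly_end X f (monom 1 i + monom (-1) j) = Pls C (P i) (Scl C (-1) (P j))"
      by (simp add: poly_end_add P_def poly_end_smult[symmetric] smult_monom)
    also have "\<dots> = Pls C (Scl C 1 (P j)) (Scl C (-1) (P j))" using ij P_in by (simp add: P_def)
    also have "\<dots> = Nul C X X" by (subst Scl_add) (auto simp: P_def Scl_0)
    finally have "poly_end X f (monom 1 i + monom (-1) j) = Nul C X X" .
    moreover have "coeff (monom 1 i + monom (-1) j :: complex poly) i = 1" using ij by simp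
    then have "monom 1 i + monom (-1) j \<noteq> (0 :: complex poly)" by (metis coeff_0 zero_neq_one)
    ultimately show ?thesis by blast
  next
    case True
    let ?S = "P ` {..V.dim}"
    have S: "?S \<subseteq> carrier ?V" using P_in by (auto simp: carr)
    have "card ?S = Suc V.dim" using True by (simp add: card_image)
    then have "V.lin_dep ?S" using V.li_le_dim(2)[OF fd S] by force
    then obtain A a v where A: "finite A" "A \<subseteq> ?S" "V.lincomb a A = \<zero>\<^bsub>?V\<^esub>" "v \<in> A" "a v \<noteq> 0"
      by (auto simp: V.lin_dep_def)
    \<comment> \<open>The coefficients of the linear relation are indexed by vectors;
      \<open>k\<close> recovers the exponent from the power.\<close>
    define k where "k = the_inv_into {..V.dim} P"
    have k: "P (k w) = w" if "w \<in> ?S" for w using that True by (auto simp: k_def f_the_inv_into_f)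
    have "V.lincomb a B = poly_end X f (\<Sum>w\<in>B. monom (a w) (k w))" if "B \<subseteq> ?S" for B
      using finite_subset[OF that] that
    proof (induction B rule: infinite_finite_induct)
      case empty
      show ?case by (simp add: V.lincomb_def) (simp add: homsp_def)
    next
      case (insert w B)
      have "V.lincomb a (B \<union> {w}) = Pls C (Scl C (a w) w) (V.lincomb a B)"
        using insert S by (subst V.lincomb_insert) (auto simp: homsp_def)
      also have "Scl C (a w) w = poly_end X f (monom (a w) (k w))"
      proof -
        have "Scl C (a w) (P (k w)) = poly_end X f (monom (a w) (k w))"
          by (simp add: P_def poly_end_smult[symmetric] smult_monom)
        then show ?thesis using k insert by simp
      qed
      finally show ?case using insert by (simp add: poly_end_add)
    qed auto
    from this[OF A(2)] have z: "poly_end X f (\<Sum>w\<in>A. monom (a w) (k w)) = Nul C X X"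
      using A(3) by (simp add: homsp_def)
    \<comment> \<open>Distinct vectors have distinct exponents, so \<open>a v\<close> survives as a
      coefficient and the polynomial is nonzero.\<close>
    have "coeff (\<Sum>w\<in>A. monom (a w) (k w)) (k v) = (\<Sum>w\<in>A. if w = v then a w else 0)"
      unfolding coeff_sum coeff_monom
    proof (intro sum.cong refl)
      fix w assume w: "w \<in> A"
      have kw: "P (k w) = w" and kv: "P (k v) = v" using k w A(2,4) by blast+
      have "w = v" if "k w = k v"
        by (rule trans[OF kw[symmetric] trans[OF arg_cong[OF that, of P] kv]])
      then show "(if k w = k v then a w else 0) = (if w = v then a w else 0)"
        by (cases "w = v") (simp_all only: if_True if_False refl, metis)
    qed
    also have "\<dots> = a v" using A by simp
    finally have "(\<Sum>w\<in>A. monom (a w) (k w)) \<noteq> 0" using A(5) by auto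
    with z show ?thesis by blast
  qed
qed

end

section \<open>Residues of endomorphisms of local objects\<close>

definition finite_local_object :: "'o \<Rightarrow> bool"
  where "finite_local_object X \<longleftrightarrow> local_object X \<and> vectorspace.fin_dim complex_field (homsp C X X)"

lemma finite_local_object_simps [simp]:
  assumes "finite_local_object X"
  shows "local_object X" "X \<in> Obj C"
  using assms by (simp_all add: finite_local_object_def)

text \<open>The image of \<open>f\<close> under \<open>End X \<rightarrow> End X / rad (End X) = \<complex>\<close>. The description is proper only
  when \<open>X\<close> is a finite local object: the eigenvalue exists by finite dimensionality, and it is
  unique because the endomorphism ring is local.\<close>

definition residue :: "'o \<Rightarrow> 'a \<Rightarrow> complex"
  where "residue X f = (THE c. \<not> is_iso C X X (Pls C f (Scl C (-c) (Idn C X))))"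

lemma is_iso_Scl:
  assumes "is_iso C X X (Scl C c f)" "f \<in> Arr C" "Dom C f = X" "Cod C f = X"
  shows "is_iso C X X f"
proof -
  from assms(1) obtain g where g: "g \<in> Arr C" "Dom C g = X" "Cod C g = X" "g \<cdot> Scl C c f = Idn C X"
    "Scl C c f \<cdot> g = Idn C X" by (rule is_isoE)
  then show ?thesis using assms by (intro is_isoI[where g = "Scl C c g"]) auto
qed

text \<open>Otherwise the nonunits f - c and -(f - d) would add up to the invertible scalar d - c,
  against locality.\<close>

lemma residue_unique:
  assumes X: "local_object X" and f: "f \<in> Arr C" "Dom C f = X" "Cod C f = X"
    and c: "\<not> is_iso C X X (Pls C f (Scl C (-c) (Idn C X)))"
    and d: "\<not> is_iso C X X (Pls C f (Scl C (-d) (Idn C X)))"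
  shows "c = d"
proof (rule ccontr)
  assume "c \<noteq> d"
  note [simp] = X f
  let ?f = "Pls C f (Scl C (-c) (Idn C X))" and ?g = "Scl C (-1) (Pls C f (Scl C (-d) (Idn C X)))"
  have z: "Pls C f (Scl C (-1) f) = Nul C X X" using Scl_add[of f 1 "-1"] by (simp add: Scl_0)
  have "Pls C ?f ?g = Pls C (Pls C f (Scl C (-1) f)) (Pls C (Scl C (-c) (Idn C X)) (Scl C d (Idn C X)))"
    by (simp add: Pls_assoc Pls_left_commute Pls_commute)
  also have "\<dots> = Scl C (d - c) (Idn C X)" unfolding z by (simp add: Scl_add)
  finally have "Pls C ?f ?g = Scl C (d - c) (Idn C X)" .
  moreover have "is_iso C X X (Scl C (d - c) (Idn C X))"
    using \<open>c \<noteq> d\<close> by (intro is_isoI[where g = "Scl C (inverse (d - c)) (Idn C X)"]) auto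
  ultimately have "is_iso C X X ?f \<or> is_iso C X X ?g"
    by (intro local_object_add) (auto simp del: Pls_simps(4))
  then show False using c d is_iso_Scl[of X "-1" "Pls C f (Scl C (-d) (Idn C X))"] by auto
qed

lemma residue_eqI:
  assumes X: "local_object X" and f: "f \<in> Arr C" "Dom C f = X" "Cod C f = X"
    and c: "\<not> is_iso C X X (Pls C f (Scl C (-c) (Idn C X)))"
  shows "residue X f = c"
  unfolding residue_def
proof (rule the_equality)
  show "\<not> is_iso C X X (Pls C f (Scl C (-c) (Idn C X)))" by (fact c)
qed (rule residue_unique[OF X f _ c])

text \<open>Existence of the eigenvalue: finite dimension yields an annihilating polynomial, which
  splits over the complex numbers.\<close>

lemma residue_nonunit:
  assumes X: "finite_local_object X" and f: "f \<in> Arr C" "Dom C f = X" "Cod C f = X"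
  shows "\<not> is_iso C X X (Pls C f (Scl C (-residue X f) (Idn C X)))"
proof -
  have "Idn C X \<noteq> Nul C X X" using X by (simp add: local_object_Idn)
  then obtain c where c: "\<not> is_iso C X X (Pls C f (Scl C (-c) (Idn C X)))"
    using poly_end_exists_zero[OF f] poly_end_zero_nonunit[OF f] X by (auto simp: finite_local_object_def)
  moreover from this have "residue X f = c"
    using X f by (intro residue_eqI) auto
  ultimately show ?thesis by simp
qed

text \<open>Every endomorphism is a scalar plus a nonunit. The arithmetic of residues is reduced to
  this splitting, and \<open>residue_eqI'\<close> reads a residue back from it.\<close>

lemma residue_decomp:
  assumes "finite_local_object X" and f: "f \<in> Arr C" "Dom C f = X" "Cod C f = X"
  obtains r where "r \<in> Arr C" "Dom C r = X" "Cod C r = X" "\<not> is_iso C X X r"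
    "f = Pls C (Scl C (residue X f) (Idn C X)) r"
proof
  let ?r = "Pls C f (Scl C (-residue X f) (Idn C X))"
  note [simp] = assms
  show "?r \<in> Arr C" "Dom C ?r = X" "Cod C ?r = X" "\<not> is_iso C X X ?r"
    using residue_nonunit by auto
  have "Pls C (Scl C (residue X f) (Idn C X)) ?r =
      Pls C f (Pls C (Scl C (residue X f) (Idn C X)) (Scl C (-residue X f) (Idn C X)))"
    by (simp add: Pls_left_commute)
  also have "\<dots> = f" unfolding Scl_add[OF Idn_simps(1)[OF finite_local_object_simps(2)[OF assms(1)]]] by (simp add: Scl_0)
  finally show "f = Pls C (Scl C (residue X f) (Idn C X)) ?r" by simp
qed

lemma residue_eqI':
  assumes X: "local_object X" and r: "r \<in> Arr C" "Dom C r = X" "Cod C r = X"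
    "\<not> is_iso C X X r" "f = Pls C (Scl C c (Idn C X)) r"
  shows "residue X f = c"
proof (rule residue_eqI[OF X])
  note [simp] = X r(1-3)
  show "f \<in> Arr C" "Dom C f = X" "Cod C f = X" using r(5) by auto
  have "Pls C f (Scl C (- c) (Idn C X)) = Pls C r (Pls C (Scl C c (Idn C X)) (Scl C (- c) (Idn C X)))"
    using r(5) by (simp add: Pls_assoc Pls_left_commute Pls_commute)
  also have "\<dots> = r" by (subst Scl_add) (auto simp: Scl_0)
  finally show "\<not> is_iso C X X (Pls C f (Scl C (- c) (Idn C X)))" using r(4) by simp
qed

lemma residue_Idn [simp]: "local_object X \<Longrightarrow> residue X (Idn C X) = 1"
proof (rule residue_eqI'[where r = "Nul C X X"])
  assume X: "local_object X"
  show "\<not> is_iso C X X (Nul C X X)"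
  proof
    assume "is_iso C X X (Nul C X X)"
    then obtain g where "g \<in> Arr C" "Dom C g = X" "g \<cdot> Nul C X X = Idn C X" "Cod C g = X" by (rule is_isoE)
    then show False using X local_object_Idn[OF X, symmetric] by simp
  qed
qed auto

lemma residue_0_iff:
  assumes X: "finite_local_object X" and f: "f \<in> Arr C" "Dom C f = X" "Cod C f = X"
  shows "residue X f = 0 \<longleftrightarrow> \<not> is_iso C X X f"
proof -
  note [simp] = X f
  have z: "Pls C f (Scl C 0 (Idn C X)) = f" by (simp add: Scl_0)
  show ?thesis
  proof
    assume "residue X f = 0"
    then show "\<not> is_iso C X X f" using residue_nonunit[OF X f] z by simp
  next
    assume "\<not> is_iso C X X f"
    then show "residue X f = 0" using z by (intro residue_eqI) auto
  qed
qed

lemma residue_add: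
  assumes X: "finite_local_object X" and f: "f \<in> Arr C" "Dom C f = X" "Cod C f = X"
    and g: "g \<in> Arr C" "Dom C g = X" "Cod C g = X"
  shows "residue X (Pls C f g) = residue X f + residue X g"
proof -
  obtain r where r: "r \<in> Arr C" "Dom C r = X" "Cod C r = X" "\<not> is_iso C X X r"
    and fr: "f = Pls C (Scl C (residue X f) (Idn C X)) r" by (rule residue_decomp[OF X f])
  obtain s where s: "s \<in> Arr C" "Dom C s = X" "Cod C s = X" "\<not> is_iso C X X s"
    and gs: "g = Pls C (Scl C (residue X g) (Idn C X)) s" by (rule residue_decomp[OF X g])
  note [simp] = X r(1-3) s(1-3)
  show ?thesis
  proof (rule residue_eqI'[where r = "Pls C r s"])
    show "\<not> is_iso C X X (Pls C r s)" using local_object_add[of X r s] r s by auto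
    have "Pls C f g = Pls C (Pls C (Scl C (residue X f) (Idn C X)) r) (Pls C (Scl C (residue X g) (Idn C X)) s)"
      using fr gs by simp
    also have "\<dots> = Pls C (Scl C (residue X f + residue X g) (Idn C X)) (Pls C r s)"
      by (simp add: Scl_add[symmetric] Pls_assoc Pls_left_commute)
    finally show "Pls C f g = Pls C (Scl C (residue X f + residue X g) (Idn C X)) (Pls C r s)" .
  qed auto
qed

lemma residue_Scl:
  assumes X: "finite_local_object X" and f: "f \<in> Arr C" "Dom C f = X" "Cod C f = X"
  shows "residue X (Scl C c f) = c * residue X f"
proof -
  obtain r where r: "r \<in> Arr C" "Dom C r = X" "Cod C r = X" "\<not> is_iso C X X r"
    and fr: "f = Pls C (Scl C (residue X f) (Idn C X)) r" by (rule residue_decomp[OF X f])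
  note [simp] = X r(1-3)
  show ?thesis
  proof (rule residue_eqI'[where r = "Scl C c r"])
    show "\<not> is_iso C X X (Scl C c r)" using is_iso_Scl[of X c r] r by auto
    have "Scl C c f = Scl C c (Pls C (Scl C (residue X f) (Idn C X)) r)" using fr by simp
    then show "Scl C c f = Pls C (Scl C (c * residue X f) (Idn C X)) (Scl C c r)" by simp
  qed auto
qed

lemma residue_Nul: "finite_local_object X \<Longrightarrow> residue X (Nul C X X) = 0"
  using residue_Scl[of X "Idn C X" 0] by (simp add: Scl_0)

text \<open>After splitting \<open>f\<close> into a scalar and a nonunit \<open>r\<close>, the term
  \<open>r \<cdot> g\<close> is again a nonunit by \<open>local_object_mult\<close> and has residue
  0.\<close>

lemma residue_mult:
  assumes X: "finite_local_object X" and f: "f \<in> Arr C" "Dom C f = X" "Cod C f = X"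
    and g: "g \<in> Arr C" "Dom C g = X" "Cod C g = X"
  shows "residue X (f \<cdot> g) = residue X f * residue X g"
proof -
  obtain r where r: "r \<in> Arr C" "Dom C r = X" "Cod C r = X" "\<not> is_iso C X X r"
    and fr: "f = Pls C (Scl C (residue X f) (Idn C X)) r" by (rule residue_decomp[OF X f])
  note [simp] = X f g r(1-3)
  have "f \<cdot> g = Pls C (Scl C (residue X f) (Idn C X)) r \<cdot> g" using fr by simp
  also have "\<dots> = Pls C (Scl C (residue X f) g) (r \<cdot> g)" by simp
  finally have "residue X (f \<cdot> g) = residue X (Pls C (Scl C (residue X f) g) (r \<cdot> g))" by simp
  moreover have "\<not> is_iso C X X (r \<cdot> g)" using local_object_mult(2)[of X g r] r by auto
  then have "residue X (r \<cdot> g) = 0" by (subst residue_0_iff) auto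
  ultimately show ?thesis by (simp add: residue_add residue_Scl)
qed

text \<open>A character kills f - \<theta>(f) but not the identity, so f - \<theta>(f) is not
  invertible. Residues of maps built with a functor are identified in this way.\<close>

lemma residue_character_unique:
  assumes X: "finite_local_object X"
    and mult: "\<And>f g. \<lbrakk>f \<in> Arr C; Dom C f = X; Cod C f = X; g \<in> Arr C; Dom C g = X; Cod C g = X\<rbrakk>
      \<Longrightarrow> \<theta> (f \<cdot> g) = \<theta> f * \<theta> g"
    and add: "\<And>f g. \<lbrakk>f \<in> Arr C; Dom C f = X; Cod C f = X; g \<in> Arr C; Dom C g = X; Cod C g = X\<rbrakk>
      \<Longrightarrow> \<theta> (Pls C f g) = \<theta> f + \<theta> g"
    and scl: "\<And>c. \<theta> (Scl C c (Idn C X)) = c"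
    and f: "f \<in> Arr C" "Dom C f = X" "Cod C f = X"
  shows "\<theta> f = residue X f"
proof (rule residue_eqI[symmetric])
  note [simp] = X f
  let ?g = "Pls C f (Scl C (- \<theta> f) (Idn C X))"
  show "\<not> is_iso C X X ?g"
  proof
    assume "is_iso C X X ?g"
    then obtain u where u: "u \<in> Arr C" "Dom C u = X" "Cod C u = X" "u \<cdot> ?g = Idn C X" by (rule is_isoE)
    have "\<theta> ?g = 0" by (subst add) (auto simp: scl)
    moreover have "\<theta> (u \<cdot> ?g) = \<theta> u * \<theta> ?g" using u by (intro mult) auto
    ultimately have "\<theta> (Idn C X) = 0" using u(4) by simp
    moreover have "\<theta> (Idn C X) = 1" using scl[of 1] by simp
    ultimately show False by simp
  qed
qed (use X f in auto)

text \<open>A composite X -> Y -> X with nonzero residue is invertible and splits \<open>X\<close>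
  off \<open>Y\<close>; \<open>split_local_object\<close> then makes the two isomorphic.\<close>

lemma residue_through:
  assumes X: "finite_local_object X" and Y: "finite_local_object Y" and ni: "\<not> isomorphic C X Y"
    and f: "f \<in> Arr C" "Dom C f = X" "Cod C f = Y"
    and g: "g \<in> Arr C" "Dom C g = Y" "Cod C g = X"
  shows "residue X (g \<cdot> f) = 0"
proof (rule ccontr)
  note [simp] = X Y f g
  assume "residue X (g \<cdot> f) \<noteq> 0"
  then have "is_iso C X X (g \<cdot> f)" by (subst (asm) residue_0_iff) auto
  then obtain u where u: "u \<in> Arr C" "Dom C u = X" "Cod C u = X" "u \<cdot> g \<cdot> f = Idn C X" by (rule is_isoE)
  have "f \<cdot> (u \<cdot> g) = Idn C Y"
    by (rule split_local_object[where X = X]) (use u in \<open>auto simp: local_object_Idn\<close>)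
  then have "is_iso C X Y f" using u by (intro is_isoI[where g = "u \<cdot> g"]) auto
  with ni show False by (auto simp: isomorphic_def)
qed

text \<open>The identity of \<open>Z\<close> is inserted between \<open>f\<close> and
  \<open>g\<close>; the path through \<open>Y\<close> has residue 0. This replaces the statement
  that \<open>X\<close> has multiplicity one in \<open>Z\<close>.\<close>

lemma residue_direct_sum:
  assumes X: "finite_local_object X" and Y: "finite_local_object Y" and ni: "\<not> isomorphic C X Y"
    and i: "i \<in> Arr C" "Dom C i = X" "Cod C i = Z" and p: "p \<in> Arr C" "Dom C p = Z" "Cod C p = X"
    and j: "j \<in> Arr C" "Dom C j = Y" "Cod C j = Z" and q: "q \<in> Arr C" "Dom C q = Z" "Cod C q = Y"
    and id: "Pls C (i \<cdot> p) (j \<cdot> q) = Idn C Z"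
    and f: "f \<in> Arr C" "Dom C f = X" "Cod C f = Z" and g: "g \<in> Arr C" "Dom C g = Z" "Cod C g = X"
  shows "residue X (g \<cdot> f) = residue X (g \<cdot> i) * residue X (p \<cdot> f)"
proof -
  note [simp] = X Y i j p q f g
  have "g \<cdot> f = g \<cdot> Idn C Z \<cdot> f" by simp
  also have "\<dots> = Pls C ((g \<cdot> i) \<cdot> (p \<cdot> f)) ((g \<cdot> j) \<cdot> (q \<cdot> f))"
    unfolding id[symmetric] by simp
  also have "residue X \<dots> = residue X ((g \<cdot> i) \<cdot> (p \<cdot> f)) + residue X ((g \<cdot> j) \<cdot> (q \<cdot> f))"
    by (rule residue_add) auto
  also have "residue X ((g \<cdot> j) \<cdot> (q \<cdot> f)) = 0"
    by (rule residue_through[OF X Y ni]) auto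
  also have "residue X ((g \<cdot> i) \<cdot> (p \<cdot> f)) = residue X (g \<cdot> i) * residue X (p \<cdot> f)"
    by (rule residue_mult) auto
  finally show ?thesis by simp
qed

text \<open>Multiplicity two: up to residues, maps into and out of \<open>Z\<close> are vectors and
  covectors of a plane, and composition pairs them.\<close>

lemma residue_direct_sum_twice:
  assumes X: "finite_local_object X"
    and i: "i \<in> Arr C" "Dom C i = X" "Cod C i = Z" and p: "p \<in> Arr C" "Dom C p = Z" "Cod C p = X"
    and j: "j \<in> Arr C" "Dom C j = X" "Cod C j = Z" and q: "q \<in> Arr C" "Dom C q = Z" "Cod C q = X"
    and id: "Pls C (i \<cdot> p) (j \<cdot> q) = Idn C Z"
    and f: "f \<in> Arr C" "Dom C f = X" "Cod C f = Z" and g: "g \<in> Arr C" "Dom C g = Z" "Cod C g = X"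
  shows "residue X (g \<cdot> f) = residue X (g \<cdot> i) * residue X (p \<cdot> f) + residue X (g \<cdot> j) * residue X (q \<cdot> f)"
proof -
  note [simp] = X i j p q f g
  have "g \<cdot> f = g \<cdot> Idn C Z \<cdot> f" by simp
  also have "\<dots> = Pls C ((g \<cdot> i) \<cdot> (p \<cdot> f)) ((g \<cdot> j) \<cdot> (q \<cdot> f))"
    unfolding id[symmetric] by simp
  also have "residue X \<dots> = residue X ((g \<cdot> i) \<cdot> (p \<cdot> f)) + residue X ((g \<cdot> j) \<cdot> (q \<cdot> f))"
    by (rule residue_add) auto
  finally show ?thesis by (simp add: residue_mult del: Cmp_assoc')
qed

text \<open>Inverts two parallel sides of a commutative square. It yields the naturality of inverses
  of structure isomorphisms.\<close>

lemma Cmp_swap: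
  assumes eq: "a \<cdot> b = g \<cdot> e" and ai: "ai \<cdot> a = Idn C (Dom C a)" and ei: "e \<cdot> ei = Idn C (Cod C e)"
    and [simp]: "a \<in> Arr C" "b \<in> Arr C" "g \<in> Arr C" "e \<in> Arr C" "ai \<in> Arr C" "ei \<in> Arr C"
      "Dom C a = Cod C b" "Dom C g = Cod C e" "Dom C b = Dom C e" "Cod C a = Cod C g"
      "Dom C ai = Cod C a" "Cod C ei = Dom C e"
  shows "ai \<cdot> g = b \<cdot> ei"
proof -
  have "Dom C (e \<cdot> ei) = Cod C e" using ei by simp
  then have [simp]: "Dom C ei = Cod C e" by simp
  have "Cod C (ai \<cdot> a) = Dom C a" using ai by simp
  then have [simp]: "Cod C ai = Cod C b" by simp
  have "ai \<cdot> g = ai \<cdot> g \<cdot> e \<cdot> ei" using ei by simp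
  also have "\<dots> = ai \<cdot> (g \<cdot> e) \<cdot> ei" by simp
  also have "\<dots> = ai \<cdot> (a \<cdot> b) \<cdot> ei" using eq by simp
  also have "\<dots> = (ai \<cdot> a) \<cdot> b \<cdot> ei" by simp
  also have "\<dots> = b \<cdot> ei" unfolding ai by simp
  finally show ?thesis .
qed

definition inverse_arr :: "'a \<Rightarrow> 'a"
  where "inverse_arr f = (SOME g. g \<in> homset C (Cod C f) (Dom C f) \<and>
    g \<cdot> f = Idn C (Dom C f) \<and> f \<cdot> g = Idn C (Cod C f))"

lemma inverse_arr:
  assumes "is_iso C X Y f"
  shows "inverse_arr f \<in> Arr C" "Dom C (inverse_arr f) = Y" "Cod C (inverse_arr f) = X"
    "inverse_arr f \<cdot> f = Idn C X" "f \<cdot> inverse_arr f = Idn C Y"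
proof -
  have f: "Dom C f = X" "Cod C f = Y"
    and ex: "\<exists>g. g \<in> homset C Y X \<and> g \<cdot> f = Idn C X \<and> f \<cdot> g = Idn C Y"
    using assms by (auto simp: is_iso_def homset_def)
  from someI_ex[OF ex] show "inverse_arr f \<in> Arr C" "Dom C (inverse_arr f) = Y" "Cod C (inverse_arr f) = X"
    "inverse_arr f \<cdot> f = Idn C X" "f \<cdot> inverse_arr f = Idn C Y"
    unfolding inverse_arr_def f by (auto simp: homset_def)
qed


subsection \<open>Krull-Schmidt categories\<close>

text \<open>Conjugation by the isomorphism respects sums and, by \<open>conj\<close>,
  invertibility.\<close>

lemma local_object_iso:
  assumes Y: "local_object Y" and XY: "is_iso C Y X i"
  shows "local_object X"
proof -
  from XY obtain p where i: "i \<in> Arr C" "Dom C i = Y" "Cod C i = X" and p: "p \<in> Arr C" "Dom C p = X" "Cod C p = Y"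
    and pi: "p \<cdot> i = Idn C Y" and ip: "i \<cdot> p = Idn C X"
    by (rule is_isoE)
  have X [simp]: "X \<in> Obj C" using i(1,3) Cod_simp by blast
  note [simp] = Y i p
  have conj: "is_iso C X X f \<longleftrightarrow> is_iso C Y Y (p \<cdot> f \<cdot> i)"
    if f [simp]: "f \<in> Arr C" "Dom C f = X" "Cod C f = X" for f
  proof
    have ipx: "i \<cdot> p \<cdot> h = h" if "h \<in> Arr C" "Cod C h = X" for h
      using Cmp_assoc'[of h p i] that ip by simp
    have pix: "p \<cdot> i \<cdot> h = h" if "h \<in> Arr C" "Cod C h = Y" for h
      using Cmp_assoc'[of h i p] that pi by simp
    {
      assume "is_iso C X X f"
      then obtain u where u: "u \<in> Arr C" "Dom C u = X" "Cod C u = X" "u \<cdot> f = Idn C X" "f \<cdot> u = Idn C X"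
        by (rule is_isoE)
      have uf: "u \<cdot> f \<cdot> i = i" "f \<cdot> u \<cdot> i = i" using Cmp_assoc'[of i f u] Cmp_assoc'[of i u f] u by simp_all
      show "is_iso C Y Y (p \<cdot> f \<cdot> i)"
        by (rule is_isoI[where g = "p \<cdot> u \<cdot> i"]) (use u uf in \<open>simp_all add: ipx pi\<close>)
    }
    assume "is_iso C Y Y (p \<cdot> f \<cdot> i)"
    then obtain u where u: "u \<in> Arr C" "Dom C u = Y" "Cod C u = Y" "u \<cdot> p \<cdot> f \<cdot> i = Idn C Y"
      "(p \<cdot> f \<cdot> i) \<cdot> u = Idn C Y"
      by (rule is_isoE)
    show "is_iso C X X f"
    proof (rule is_isoI[where g = "i \<cdot> u \<cdot> p"])
      have "(i \<cdot> u \<cdot> p) \<cdot> f = i \<cdot> (u \<cdot> p \<cdot> f \<cdot> i) \<cdot> p" using u(1-3) ip by simp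
      then show "(i \<cdot> u \<cdot> p) \<cdot> f = Idn C X" using u(4) ip by simp
      have "f \<cdot> (i \<cdot> u \<cdot> p) = i \<cdot> ((p \<cdot> f \<cdot> i) \<cdot> u) \<cdot> p" using u(1-3) by (simp add: ipx)
      then show "f \<cdot> (i \<cdot> u \<cdot> p) = Idn C X" unfolding u(5) using ip by simp
    qed (use u in auto)
  qed
  have "Idn C X \<noteq> Nul C X X"
  proof
    assume "Idn C X = Nul C X X"
    then have "p \<cdot> Idn C X \<cdot> i = p \<cdot> Nul C X X \<cdot> i" by simp
    then show False using pi local_object_Idn[OF Y] by simp
  qed
  moreover have "\<not> is_iso C X X (Pls C f g)"
    if [simp]: "f \<in> Arr C" "Dom C f = X" "Cod C f = X" "g \<in> Arr C" "Dom C g = X" "Cod C g = X"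
      and n: "\<not> is_iso C X X f" "\<not> is_iso C X X g" for f g
    using n local_object_add[OF Y, of "p \<cdot> f \<cdot> i" "p \<cdot> g \<cdot> i"] by (auto simp: conj)
  ultimately show ?thesis
    unfolding local_object_def local_endomorphism_ring_def Let_def Units_homsp
    by (auto simp: homsp_def homset_def)
qed

lemma local_object_not_zero: "local_object X \<Longrightarrow> \<not> zero_object C X"
  using local_object_Idn[of X] local_object_in[of X] hom_laws(5)[OF Idn_in[of X]] Idn_in[of X]
  unfolding zero_object_def by blast

text \<open>The first summand of a Krull-Schmidt decomposition is local, hence nonzero;
  indecomposability makes the complement zero, so \<open>X\<close> is isomorphic to that
  summand.\<close>

lemma indecomposable_local_object:
  assumes KS: "krull_schmidt C" and X: "indecomposable C X"
  shows "local_object X"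
proof -
  have XO: "X \<in> Obj C" "\<not> zero_object C X"
    and dec: "\<And>Y Z. \<lbrakk>Y \<in> Obj C; Z \<in> Obj C; direct_sum_of C X Y Z\<rbrakk> \<Longrightarrow> zero_object C Y \<or> zero_object C Z"
    using X by (auto simp: indecomposable_def)
  obtain Xs where Xs: "set Xs \<subseteq> Obj C" "\<And>Y. Y \<in> set Xs \<Longrightarrow> local_endomorphism_ring C Y"
    "direct_sum_of_list C X Xs"
    using KS XO(1) unfolding krull_schmidt_def by blast
  show ?thesis
  proof (cases Xs)
    case Nil
    then show ?thesis using Xs XO by simp
  next
    case (Cons Y Ys)
    then obtain W where W: "W \<in> Obj C" "direct_sum_of C X Y W" using Xs by auto
    have Y: "local_object Y" using Cons Xs by (auto simp: local_object_def)
    then have "zero_object C W" using dec[of Y W] W local_object_not_zero by auto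
    from W(2) obtain i j p q where ij: "i \<in> homset C Y X" "j \<in> homset C W X" "p \<in> homset C X Y" "q \<in> homset C X W"
      "p \<cdot> i = Idn C Y" "Pls C (i \<cdot> p) (j \<cdot> q) = Idn C X"
      by (auto simp: direct_sum_of_def)
    have "j = Nul C W X" using \<open>zero_object C W\<close> XO(1) ij(2) hom_laws(5)[OF ij(2)] by (auto simp: zero_object_def)
    then have "i \<cdot> p = Idn C X" using ij XO W by (auto simp: homset_def)
    then have "is_iso C Y X i" using ij by (intro is_isoI[where g = p]) (auto simp: homset_def)
    then show ?thesis by (rule local_object_iso[OF Y])
  qed
qed

lemma indecomposable_finite_local_object:
  assumes fin: "locally_finitary C" and X: "indecomposable C X"
  shows "finite_local_object X"
proof -
  have "krull_schmidt C" using fin by (simp add: locally_finitary_def)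
  from indecomposable_local_object[OF this X] have "local_object X" .
  moreover from this have "X \<in> Obj C" by (rule local_object_in)
  then have "vectorspace.fin_dim complex_field (homsp C X X)"
    using fin by (simp add: locally_finitary_def)
  ultimately show ?thesis by (simp add: finite_local_object_def)
qed

end


section \<open>Self-adjoint functors\<close>

text \<open>The triangle identities hold up to the nonzero scalar \<open>d\<close>, so no
  normalisation of the duality is needed. The nonzero \<open>c\<close> makes the identity functor a
  direct summand of the square of \<open>F\<close>.\<close>

locale self_adjoint_functor = linear_category C
  for C :: "('o, 'a, 'z) lin_cat_scheme" (structure) +
  fixes FO :: "'o \<Rightarrow> 'o" and F :: "'a \<Rightarrow> 'a" and \<eta> \<epsilon> :: "'o \<Rightarrow> 'a" and c d :: complex
  assumes FO [simp]: "X \<in> Obj C \<Longrightarrow> FO X \<in> Obj C"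
    and F [simp]: "f \<in> Arr C \<Longrightarrow> F f \<in> Arr C" "f \<in> Arr C \<Longrightarrow> Dom C (F f) = FO (Dom C f)"
      "f \<in> Arr C \<Longrightarrow> Cod C (F f) = FO (Cod C f)"
    and F_Idn [simp]: "X \<in> Obj C \<Longrightarrow> F (Idn C X) = Idn C (FO X)"
    and F_Cmp [simp]: "\<lbrakk>f \<in> Arr C; g \<in> Arr C; Dom C g = Cod C f\<rbrakk> \<Longrightarrow> F (g \<cdot> f) = F g \<cdot> F f"
    and F_Pls [simp]: "\<lbrakk>f \<in> Arr C; g \<in> Arr C; Dom C f = Dom C g; Cod C f = Cod C g\<rbrakk>
      \<Longrightarrow> F (Pls C f g) = Pls C (F f) (F g)"
    and F_Scl [simp]: "f \<in> Arr C \<Longrightarrow> F (Scl C a f) = Scl C a (F f)"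
    and unit [simp]: "X \<in> Obj C \<Longrightarrow> \<eta> X \<in> Arr C" "X \<in> Obj C \<Longrightarrow> Dom C (\<eta> X) = X"
      "X \<in> Obj C \<Longrightarrow> Cod C (\<eta> X) = FO (FO X)"
    and counit [simp]: "X \<in> Obj C \<Longrightarrow> \<epsilon> X \<in> Arr C" "X \<in> Obj C \<Longrightarrow> Dom C (\<epsilon> X) = FO (FO X)"
      "X \<in> Obj C \<Longrightarrow> Cod C (\<epsilon> X) = X"
    and unit_natural: "f \<in> Arr C \<Longrightarrow> \<eta> (Cod C f) \<cdot> f = F (F f) \<cdot> \<eta> (Dom C f)"
    and counit_natural: "f \<in> Arr C \<Longrightarrow> \<epsilon> (Cod C f) \<cdot> F (F f) = f \<cdot> \<epsilon> (Dom C f)"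
    and counit_unit: "X \<in> Obj C \<Longrightarrow> \<epsilon> X \<cdot> \<eta> X = Scl C c (Idn C X)"
    and zigzag_unit: "X \<in> Obj C \<Longrightarrow> F (\<epsilon> X) \<cdot> \<eta> (FO X) = Scl C d (Idn C (FO X))"
    and zigzag_counit: "X \<in> Obj C \<Longrightarrow> \<epsilon> (FO X) \<cdot> F (\<eta> X) = Scl C d (Idn C (FO X))"
    and c_nonzero: "c \<noteq> 0" and d_nonzero: "d \<noteq> 0"


context self_adjoint_functor
begin

text \<open>Here and in the next two lemmas an identity gets a tail \<open>h\<close>, to be
  applicable inside right-nested composites.\<close>

lemma counit_natural_assoc:
  assumes "f \<in> Arr C" "h \<in> Arr C" "Cod C h = FO (FO (Dom C f))"
  shows "\<epsilon> (Cod C f) \<cdot> F (F f) \<cdot> h = f \<cdot> \<epsilon> (Dom C f) \<cdot> h"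
  using counit_natural[OF assms(1)] assms
  by (metis Cmp_assoc' Cod_simp Dom_simp F counit)

lemma zigzag_unit_assoc:
  assumes "X \<in> Obj C" "h \<in> Arr C" "Cod C h = FO X"
  shows "F (\<epsilon> X) \<cdot> \<eta> (FO X) \<cdot> h = Scl C d h"
proof -
  have "F (\<epsilon> X) \<cdot> \<eta> (FO X) \<cdot> h = (F (\<epsilon> X) \<cdot> \<eta> (FO X)) \<cdot> h"
    using assms by simp
  also have "\<dots> = Scl C d h" unfolding zigzag_unit[OF assms(1)] using assms by simp
  finally show ?thesis .
qed

lemma zigzag_counit_assoc:
  assumes "X \<in> Obj C" "h \<in> Arr C" "Cod C h = FO X"
  shows "\<epsilon> (FO X) \<cdot> F (\<eta> X) \<cdot> h = Scl C d h"
proof -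
  have "\<epsilon> (FO X) \<cdot> F (\<eta> X) \<cdot> h = (\<epsilon> (FO X) \<cdot> F (\<eta> X)) \<cdot> h"
    using assms by simp
  also have "\<dots> = Scl C d h" unfolding zigzag_counit[OF assms(1)] using assms by simp
  finally show ?thesis .
qed

end

text \<open>The objects \<open>A\<close>, \<open>B\<close>, \<open>D\<close>, \<open>E\<close> play the roles of \<open>X\<^sub>1\<close>, \<open>X\<^sub>2\<close>, \<open>X\<^sub>3\<close>, \<open>X\<^sub>4\<close>; the maps witness
  \<open>F A \<cong> B \<oplus> B\<close>, \<open>F B \<cong> A \<oplus> D\<close> and \<open>F D \<cong> B \<oplus> E\<close>.\<close>

locale type_B_start = self_adjoint_functor C FO F \<eta> \<epsilon> c d
  for C :: "('o, 'a, 'z) lin_cat_scheme" (structure)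
    and FO :: "'o \<Rightarrow> 'o" and F :: "'a \<Rightarrow> 'a" and \<eta> \<epsilon> :: "'o \<Rightarrow> 'a" and c d :: complex +
  fixes A B D E :: 'o and i\<^sub>1 i\<^sub>2 p\<^sub>1 p\<^sub>2 j\<^sub>A q\<^sub>A j\<^sub>D q\<^sub>D k\<^sub>B r\<^sub>B k\<^sub>E r\<^sub>E :: 'a
  assumes local [simp]: "finite_local_object A" "finite_local_object B" "finite_local_object D"
      "finite_local_object E"
    and not_iso: "\<not> isomorphic C A D" "\<not> isomorphic C B E"
    and ip [simp]: "i\<^sub>1 \<in> Arr C" "Dom C i\<^sub>1 = B" "Cod C i\<^sub>1 = FO A"
      "i\<^sub>2 \<in> Arr C" "Dom C i\<^sub>2 = B" "Cod C i\<^sub>2 = FO A"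
      "p\<^sub>1 \<in> Arr C" "Dom C p\<^sub>1 = FO A" "Cod C p\<^sub>1 = B"
      "p\<^sub>2 \<in> Arr C" "Dom C p\<^sub>2 = FO A" "Cod C p\<^sub>2 = B"
    and ip_eq: "p\<^sub>1 \<cdot> i\<^sub>1 = Idn C B" "p\<^sub>2 \<cdot> i\<^sub>2 = Idn C B" "p\<^sub>1 \<cdot> i\<^sub>2 = Nul C B B" "p\<^sub>2 \<cdot> i\<^sub>1 = Nul C B B"
    and ip_sum: "Pls C (i\<^sub>1 \<cdot> p\<^sub>1) (i\<^sub>2 \<cdot> p\<^sub>2) = Idn C (FO A)"
    and jq [simp]: "j\<^sub>A \<in> Arr C" "Dom C j\<^sub>A = A" "Cod C j\<^sub>A = FO B"
      "j\<^sub>D \<in> Arr C" "Dom C j\<^sub>D = D" "Cod C j\<^sub>D = FO B"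
      "q\<^sub>A \<in> Arr C" "Dom C q\<^sub>A = FO B" "Cod C q\<^sub>A = A"
      "q\<^sub>D \<in> Arr C" "Dom C q\<^sub>D = FO B" "Cod C q\<^sub>D = D"
    and jq_eq: "q\<^sub>A \<cdot> j\<^sub>A = Idn C A"
    and jq_sum: "Pls C (j\<^sub>A \<cdot> q\<^sub>A) (j\<^sub>D \<cdot> q\<^sub>D) = Idn C (FO B)"
    and kr [simp]: "k\<^sub>B \<in> Arr C" "Dom C k\<^sub>B = B" "Cod C k\<^sub>B = FO D"
      "k\<^sub>E \<in> Arr C" "Dom C k\<^sub>E = E" "Cod C k\<^sub>E = FO D"
      "r\<^sub>B \<in> Arr C" "Dom C r\<^sub>B = FO D" "Cod C r\<^sub>B = B"
      "r\<^sub>E \<in> Arr C" "Dom C r\<^sub>E = FO D" "Cod C r\<^sub>E = E"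
    and kr_sum: "Pls C (k\<^sub>B \<cdot> r\<^sub>B) (k\<^sub>E \<cdot> r\<^sub>E) = Idn C (FO D)"
begin

section \<open>Coordinates in the plane of maps between \<open>B\<close> and \<open>FO A\<close>
  modulo the radical\<close>

text \<open>Transposition along the adjunction, followed by the residue at the summand
  \<open>A\<close> of \<open>FO B\<close>, is a functional on maps \<open>B\<close> to
  \<open>FO A\<close>; \<open>a\<^sub>1\<close>, \<open>a\<^sub>2\<close> are its values on the
  inclusions, and \<open>b\<^sub>1\<close>, \<open>b\<^sub>2\<close> are the dual values on the
  projections.\<close>

definition "a\<^sub>1 = residue A (\<epsilon> A \<cdot> F i\<^sub>1 \<cdot> j\<^sub>A)"
definition "a\<^sub>2 = residue A (\<epsilon> A \<cdot> F i\<^sub>2 \<cdot> j\<^sub>A)"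
definition "b\<^sub>1 = residue A (q\<^sub>A \<cdot> F p\<^sub>1 \<cdot> \<eta> A)"
definition "b\<^sub>2 = residue A (q\<^sub>A \<cdot> F p\<^sub>2 \<cdot> \<eta> A)"

text \<open>The three multiplicity statements: \<open>A\<close> occurs once in \<open>FO B\<close>,
  \<open>B\<close> twice in \<open>FO A\<close> and once in \<open>FO D\<close>.\<close>

lemma residue_FB:
  assumes "f \<in> Arr C" "Dom C f = A" "Cod C f = FO B" "g \<in> Arr C" "Dom C g = FO B" "Cod C g = A"
  shows "residue A (g \<cdot> f) = residue A (g \<cdot> j\<^sub>A) * residue A (q\<^sub>A \<cdot> f)"
  by (rule residue_direct_sum[OF local(1,3) not_iso(1), where j = j\<^sub>D and q = q\<^sub>D and Z = "FO B"])
    (use assms jq_sum in auto)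

lemma residue_FA:
  assumes "f \<in> Arr C" "Dom C f = B" "Cod C f = FO A" "g \<in> Arr C" "Dom C g = FO A" "Cod C g = B"
  shows "residue B (g \<cdot> f) = residue B (g \<cdot> i\<^sub>1) * residue B (p\<^sub>1 \<cdot> f) + residue B (g \<cdot> i\<^sub>2) * residue B (p\<^sub>2 \<cdot> f)"
  by (rule residue_direct_sum_twice[OF local(2), where Z = "FO A"]) (use assms ip_sum in auto)

lemma residue_FD:
  assumes "f \<in> Arr C" "Dom C f = B" "Cod C f = FO D" "g \<in> Arr C" "Dom C g = FO D" "Cod C g = B"
  shows "residue B (g \<cdot> f) = residue B (g \<cdot> k\<^sub>B) * residue B (r\<^sub>B \<cdot> f)"
  by (rule residue_direct_sum[OF local(2,4) not_iso(2), where j = k\<^sub>E and q = r\<^sub>E and Z = "FO D"])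
    (use assms kr_sum in auto)

text \<open>The left side is a character of the endomorphisms of \<open>B\<close>; it is
  multiplicative because \<open>A\<close> occurs only once in \<open>FO B\<close>.\<close>

lemma residue_F_B:
  assumes "u \<in> Arr C" "Dom C u = B" "Cod C u = B"
  shows "residue A (q\<^sub>A \<cdot> F u \<cdot> j\<^sub>A) = residue B u"
proof (rule residue_character_unique[OF local(2), where \<theta> = "\<lambda>u. residue A (q\<^sub>A \<cdot> F u \<cdot> j\<^sub>A)"])
  fix f g assume fg [simp]: "f \<in> Arr C" "Dom C f = B" "Cod C f = B" "g \<in> Arr C" "Dom C g = B" "Cod C g = B"
  show "residue A (q\<^sub>A \<cdot> F (f \<cdot> g) \<cdot> j\<^sub>A) = residue A (q\<^sub>A \<cdot> F f \<cdot> j\<^sub>A) * residue A (q\<^sub>A \<cdot> F g \<cdot> j\<^sub>A)"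
    using residue_FB[of "F g \<cdot> j\<^sub>A" "q\<^sub>A \<cdot> F f"] by simp
  show "residue A (q\<^sub>A \<cdot> F (Pls C f g) \<cdot> j\<^sub>A) = residue A (q\<^sub>A \<cdot> F f \<cdot> j\<^sub>A) + residue A (q\<^sub>A \<cdot> F g \<cdot> j\<^sub>A)"
    by (simp add: residue_add)
qed (use assms in \<open>simp_all add: residue_Scl jq_eq\<close>)

text \<open>Expanding \<open>j\<close> along the two inclusions leaves the endomorphisms
  \<open>p\<^sub>1 \<cdot> j\<close> and \<open>p\<^sub>2 \<cdot> j\<close> of \<open>B\<close>,
  whose images under \<open>F\<close> act on the summand \<open>A\<close> by their residues.\<close>

lemma residue_adjoint:
  assumes j [simp]: "j \<in> Arr C" "Dom C j = B" "Cod C j = FO A"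
  shows "residue A (\<epsilon> A \<cdot> F j \<cdot> j\<^sub>A) = a\<^sub>1 * residue B (p\<^sub>1 \<cdot> j) + a\<^sub>2 * residue B (p\<^sub>2 \<cdot> j)"
proof -
  have "Pls C (i\<^sub>1 \<cdot> p\<^sub>1) (i\<^sub>2 \<cdot> p\<^sub>2) \<cdot> j = j" by (simp only: ip_sum Cmp_Idn j)
  then have "\<epsilon> A \<cdot> F j \<cdot> j\<^sub>A = \<epsilon> A \<cdot> F (Pls C (i\<^sub>1 \<cdot> p\<^sub>1) (i\<^sub>2 \<cdot> p\<^sub>2) \<cdot> j) \<cdot> j\<^sub>A" by (simp only:)
  then have "residue A (\<epsilon> A \<cdot> F j \<cdot> j\<^sub>A) = residue A ((\<epsilon> A \<cdot> F i\<^sub>1) \<cdot> (F (p\<^sub>1 \<cdot> j) \<cdot> j\<^sub>A))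
      + residue A ((\<epsilon> A \<cdot> F i\<^sub>2) \<cdot> (F (p\<^sub>2 \<cdot> j) \<cdot> j\<^sub>A))"
    by (simp add: residue_add)
  then show ?thesis
    using residue_F_B[of "p\<^sub>1 \<cdot> j"] residue_F_B[of "p\<^sub>2 \<cdot> j"]
    by (simp add: residue_FB[of "F p\<^sub>1 \<cdot> F j \<cdot> j\<^sub>A" "\<epsilon> A \<cdot> F i\<^sub>1", simplified]
      residue_FB[of "F p\<^sub>2 \<cdot> F j \<cdot> j\<^sub>A" "\<epsilon> A \<cdot> F i\<^sub>2", simplified] a\<^sub>1_def a\<^sub>2_def)
qed

text \<open>Dual to \<open>residue_adjoint\<close>, with \<open>q\<close> expanded along the two
  projections.\<close>

lemma residue_coadjoint:
  assumes q [simp]: "q \<in> Arr C" "Dom C q = FO A" "Cod C q = B"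
  shows "residue A (q\<^sub>A \<cdot> F q \<cdot> \<eta> A) = residue B (q \<cdot> i\<^sub>1) * b\<^sub>1 + residue B (q \<cdot> i\<^sub>2) * b\<^sub>2"
proof -
  have "q \<cdot> Pls C (i\<^sub>1 \<cdot> p\<^sub>1) (i\<^sub>2 \<cdot> p\<^sub>2) = q" by (simp only: ip_sum Cmp_Idn q)
  then have "q\<^sub>A \<cdot> F q \<cdot> \<eta> A = q\<^sub>A \<cdot> F (q \<cdot> Pls C (i\<^sub>1 \<cdot> p\<^sub>1) (i\<^sub>2 \<cdot> p\<^sub>2)) \<cdot> \<eta> A" by (simp only:)
  then have "residue A (q\<^sub>A \<cdot> F q \<cdot> \<eta> A) = residue A ((q\<^sub>A \<cdot> F (q \<cdot> i\<^sub>1)) \<cdot> (F p\<^sub>1 \<cdot> \<eta> A))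
      + residue A ((q\<^sub>A \<cdot> F (q \<cdot> i\<^sub>2)) \<cdot> (F p\<^sub>2 \<cdot> \<eta> A))"
    by (simp add: residue_add)
  then show ?thesis
    using residue_F_B[of "q \<cdot> i\<^sub>1"] residue_F_B[of "q \<cdot> i\<^sub>2"]
    by (simp add: residue_FB[of "F p\<^sub>1 \<cdot> \<eta> A" "q\<^sub>A \<cdot> F q \<cdot> F i\<^sub>1", simplified]
      residue_FB[of "F p\<^sub>2 \<cdot> \<eta> A" "q\<^sub>A \<cdot> F q \<cdot> F i\<^sub>2", simplified] b\<^sub>1_def b\<^sub>2_def)
qed

text \<open>The loop value \<open>c\<close> is computed by inserting the identity of
  \<open>FO A\<close> between unit and counit.\<close>

lemma ab_eq: "a\<^sub>1 * b\<^sub>1 + a\<^sub>2 * b\<^sub>2 = c"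
proof -
  have "\<epsilon> A \<cdot> \<eta> A = \<epsilon> A \<cdot> F (Pls C (i\<^sub>1 \<cdot> p\<^sub>1) (i\<^sub>2 \<cdot> p\<^sub>2)) \<cdot> \<eta> A" unfolding ip_sum by simp
  also have "\<dots> = Pls C ((\<epsilon> A \<cdot> F i\<^sub>1) \<cdot> (F p\<^sub>1 \<cdot> \<eta> A)) ((\<epsilon> A \<cdot> F i\<^sub>2) \<cdot> (F p\<^sub>2 \<cdot> \<eta> A))" by simp
  also have "residue A \<dots> = a\<^sub>1 * b\<^sub>1 + a\<^sub>2 * b\<^sub>2"
    by (subst residue_add) (auto simp: residue_FB[of "F p\<^sub>1 \<cdot> \<eta> A" "\<epsilon> A \<cdot> F i\<^sub>1", simplified]
      residue_FB[of "F p\<^sub>2 \<cdot> \<eta> A" "\<epsilon> A \<cdot> F i\<^sub>2", simplified] b\<^sub>1_def b\<^sub>2_def a\<^sub>1_def a\<^sub>2_def)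
  finally have "residue A (\<epsilon> A \<cdot> \<eta> A) = a\<^sub>1 * b\<^sub>1 + a\<^sub>2 * b\<^sub>2" .
  then show ?thesis by (simp add: counit_unit residue_Scl)
qed

text \<open>By naturality of the counit, composing \<open>j\<close> with \<open>F r\<close> composes
  its transpose with \<open>r\<close>. So the row (\<open>a\<^sub>1\<close>,
  \<open>a\<^sub>2\<close>) is a left eigenvector of the matrix of \<open>F r\<close>, with
  eigenvalue \<open>residue A r\<close>.\<close>

lemma residue_adjoint_F:
  assumes j [simp]: "j \<in> Arr C" "Dom C j = B" "Cod C j = FO A"
    and r [simp]: "r \<in> Arr C" "Dom C r = A" "Cod C r = A"
  shows "a\<^sub>1 * residue B (p\<^sub>1 \<cdot> F r \<cdot> j) + a\<^sub>2 * residue B (p\<^sub>2 \<cdot> F r \<cdot> j) =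
    residue A r * (a\<^sub>1 * residue B (p\<^sub>1 \<cdot> j) + a\<^sub>2 * residue B (p\<^sub>2 \<cdot> j))"
proof -
  have "a\<^sub>1 * residue B (p\<^sub>1 \<cdot> F r \<cdot> j) + a\<^sub>2 * residue B (p\<^sub>2 \<cdot> F r \<cdot> j) =
      residue A (\<epsilon> A \<cdot> F (F r) \<cdot> F j \<cdot> j\<^sub>A)"
    using residue_adjoint[of "F r \<cdot> j"] by simp
  also have "\<epsilon> A \<cdot> F (F r) \<cdot> F j \<cdot> j\<^sub>A = r \<cdot> \<epsilon> A \<cdot> F j \<cdot> j\<^sub>A"
    using counit_natural_assoc[of r "F j \<cdot> j\<^sub>A"] by simp
  finally show ?thesis by (simp add: residue_mult residue_adjoint)
qed

text \<open>By naturality of the unit, the column (\<open>b\<^sub>1\<close>,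
  \<open>b\<^sub>2\<close>) is a right eigenvector of the matrix of \<open>F r\<close>, with the
  same eigenvalue.\<close>

lemma residue_coadjoint_F:
  assumes q [simp]: "q \<in> Arr C" "Dom C q = FO A" "Cod C q = B"
    and r [simp]: "r \<in> Arr C" "Dom C r = A" "Cod C r = A"
  shows "residue B (q \<cdot> F r \<cdot> i\<^sub>1) * b\<^sub>1 + residue B (q \<cdot> F r \<cdot> i\<^sub>2) * b\<^sub>2 =
    (residue B (q \<cdot> i\<^sub>1) * b\<^sub>1 + residue B (q \<cdot> i\<^sub>2) * b\<^sub>2) * residue A r"
proof -
  have "residue B (q \<cdot> F r \<cdot> i\<^sub>1) * b\<^sub>1 + residue B (q \<cdot> F r \<cdot> i\<^sub>2) * b\<^sub>2 =
      residue A (q\<^sub>A \<cdot> F q \<cdot> F (F r) \<cdot> \<eta> A)"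
    using residue_coadjoint[of "q \<cdot> F r"] by simp
  also have "q\<^sub>A \<cdot> F q \<cdot> F (F r) \<cdot> \<eta> A = (q\<^sub>A \<cdot> F q \<cdot> \<eta> A) \<cdot> r"
    using unit_natural[of r] by simp
  finally show ?thesis by (simp only: residue_mult r q local ip jq F Cmp_simps unit residue_coadjoint
    finite_local_object_simps)
qed

text \<open>\<open>i\<^sub>w\<close> and \<open>p\<^sub>w\<close> span the vectors whose adjoints \<open>F B \<rightarrow> A\<close> and \<open>A \<rightarrow> F B\<close> are radical
  (lemmas \<open>residue_adjoint_iw\<close> and \<open>residue_coadjoint_pw\<close>).\<close>

definition "i\<^sub>w = Pls C (Scl C a\<^sub>1 i\<^sub>2) (Scl C (- a\<^sub>2) i\<^sub>1)"
definition "p\<^sub>w = Pls C (Scl C b\<^sub>1 p\<^sub>2) (Scl C (- b\<^sub>2) p\<^sub>1)"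

lemma ipw [simp]: "i\<^sub>w \<in> Arr C" "Dom C i\<^sub>w = B" "Cod C i\<^sub>w = FO A"
  "p\<^sub>w \<in> Arr C" "Dom C p\<^sub>w = FO A" "Cod C p\<^sub>w = B"
  by (simp_all add: i\<^sub>w_def p\<^sub>w_def)

lemma residue_ipw [simp]: "residue B (p\<^sub>1 \<cdot> i\<^sub>w) = - a\<^sub>2" "residue B (p\<^sub>2 \<cdot> i\<^sub>w) = a\<^sub>1"
  "residue B (p\<^sub>w \<cdot> i\<^sub>1) = - b\<^sub>2" "residue B (p\<^sub>w \<cdot> i\<^sub>2) = b\<^sub>1"
  by (simp_all add: i\<^sub>w_def p\<^sub>w_def residue_add residue_Scl residue_Nul ip_eq)

text \<open>In coordinates \<open>i\<^sub>w\<close> is (\<open>- a\<^sub>2\<close>,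
  \<open>a\<^sub>1\<close>) and \<open>p\<^sub>w\<close> is (\<open>- b\<^sub>2\<close>,
  \<open>b\<^sub>1\<close>). As \<open>c\<close> is nonzero, \<open>i\<^sub>w\<close> spans a
  complement of the line of b.\<close>

lemma residue_pw_iw: "residue B (p\<^sub>w \<cdot> i\<^sub>w) = c"
  using residue_FA[of "i\<^sub>w" "p\<^sub>w"] ab_eq by (simp add: algebra_simps)

lemma residue_adjoint_iw: "residue A (\<epsilon> A \<cdot> F i\<^sub>w \<cdot> j\<^sub>A) = 0"
  by (simp add: residue_adjoint)

lemma residue_coadjoint_pw: "residue A (q\<^sub>A \<cdot> F p\<^sub>w \<cdot> \<eta> A) = 0"
  by (simp add: residue_coadjoint)

text \<open>The left side is a multiple of a character of \<open>End A\<close>, and the only character of a local ring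
  with residue field \<open>\<complex>\<close> is the residue map.\<close>

lemma residue_pw_F_iw:
  assumes "r \<in> Arr C" "Dom C r = A" "Cod C r = A"
  shows "residue B (p\<^sub>w \<cdot> F r \<cdot> i\<^sub>w) = c * residue A r"
proof -
  have "residue B (p\<^sub>w \<cdot> F r \<cdot> i\<^sub>w) / c = residue A r"
  proof (rule residue_character_unique[OF local(1), where \<theta> = "\<lambda>r. residue B (p\<^sub>w \<cdot> F r \<cdot> i\<^sub>w) / c"])
    fix r s assume [simp]: "r \<in> Arr C" "Dom C r = A" "Cod C r = A" "s \<in> Arr C" "Dom C s = A" "Cod C s = A"
    show "residue B (p\<^sub>w \<cdot> F (Pls C r s) \<cdot> i\<^sub>w) / c = residue B (p\<^sub>w \<cdot> F r \<cdot> i\<^sub>w) / c + residue B (p\<^sub>w \<cdot> F s \<cdot> i\<^sub>w) / c"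
      by (simp add: residue_add add_divide_distrib)
    define x\<^sub>1 x\<^sub>2 y\<^sub>1 y\<^sub>2 where "x\<^sub>1 = residue B (p\<^sub>w \<cdot> F r \<cdot> i\<^sub>1)" "x\<^sub>2 = residue B (p\<^sub>w \<cdot> F r \<cdot> i\<^sub>2)"
      "y\<^sub>1 = residue B (p\<^sub>1 \<cdot> F s \<cdot> i\<^sub>w)" "y\<^sub>2 = residue B (p\<^sub>2 \<cdot> F s \<cdot> i\<^sub>w)"
    note xy = this
    have rs: "residue B (p\<^sub>w \<cdot> F (r \<cdot> s) \<cdot> i\<^sub>w) = x\<^sub>1 * y\<^sub>1 + x\<^sub>2 * y\<^sub>2"
      using residue_FA[of "F s \<cdot> i\<^sub>w" "p\<^sub>w \<cdot> F r"] by (simp add: xy)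
    have r: "residue B (p\<^sub>w \<cdot> F r \<cdot> i\<^sub>w) = - a\<^sub>2 * x\<^sub>1 + a\<^sub>1 * x\<^sub>2"
      using residue_FA[of "i\<^sub>w" "p\<^sub>w \<cdot> F r"] by (simp add: xy)
    have s: "residue B (p\<^sub>w \<cdot> F s \<cdot> i\<^sub>w) = - b\<^sub>2 * y\<^sub>1 + b\<^sub>1 * y\<^sub>2"
      using residue_FA[of "F s \<cdot> i\<^sub>w" "p\<^sub>w"] by (simp add: xy)
    have xb: "x\<^sub>1 * b\<^sub>1 + x\<^sub>2 * b\<^sub>2 = 0"
      using residue_coadjoint_F[of "p\<^sub>w" r] by (simp add: xy)
    have ay: "a\<^sub>1 * y\<^sub>1 + a\<^sub>2 * y\<^sub>2 = 0"
      using residue_adjoint_F[of "i\<^sub>w" s] by (simp add: xy)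
    \<comment> \<open>In the plane, \<open>c\<close> times the identity is b a +
      \<open>i\<^sub>w\<close> \<open>p\<^sub>w\<close>, columns times rows. Inserted between x and
      y, its first term vanishes.\<close>
    have "c * (x\<^sub>1 * y\<^sub>1 + x\<^sub>2 * y\<^sub>2) = (x\<^sub>1 * b\<^sub>1 + x\<^sub>2 * b\<^sub>2) * (a\<^sub>1 * y\<^sub>1 + a\<^sub>2 * y\<^sub>2)
       + (- a\<^sub>2 * x\<^sub>1 + a\<^sub>1 * x\<^sub>2) * (- b\<^sub>2 * y\<^sub>1 + b\<^sub>1 * y\<^sub>2)"
      unfolding ab_eq[symmetric] by (simp add: algebra_simps)
    then show "residue B (p\<^sub>w \<cdot> F (r \<cdot> s) \<cdot> i\<^sub>w) / c = residue B (p\<^sub>w \<cdot> F r \<cdot> i\<^sub>w) / c * (residue B (p\<^sub>w \<cdot> F s \<cdot> i\<^sub>w) / c)"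
      unfolding rs r s ay xb using c_nonzero
      by (simp add: divide_simps) (simp add: mult.commute)
  qed (use assms c_nonzero in \<open>simp_all add: residue_Scl residue_pw_iw\<close>)
  then show ?thesis using c_nonzero by (simp add: field_simps)
qed

text \<open>The row of \<open>p\<^sub>w \<cdot> F r\<close> vanishes on b and on
  \<open>i\<^sub>w\<close>, which span the plane; the linear system has determinant \<open>c\<close>
  up to sign.\<close>

lemma residue_pw_F:
  assumes j [simp]: "j \<in> Arr C" "Dom C j = B" "Cod C j = FO A"
    and r [simp]: "r \<in> Arr C" "Dom C r = A" "Cod C r = A" and r0: "residue A r = 0"
  shows "residue B (p\<^sub>w \<cdot> F r \<cdot> j) = 0"
proof -
  let ?x\<^sub>1 = "residue B (p\<^sub>w \<cdot> F r \<cdot> i\<^sub>1)" and ?x\<^sub>2 = "residue B (p\<^sub>w \<cdot> F r \<cdot> i\<^sub>2)"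
  have 1: "?x\<^sub>1 * b\<^sub>1 + ?x\<^sub>2 * b\<^sub>2 = 0"
    using residue_coadjoint_F[of "p\<^sub>w" r] by simp
  have 2: "- a\<^sub>2 * ?x\<^sub>1 + a\<^sub>1 * ?x\<^sub>2 = 0"
    using residue_FA[of "i\<^sub>w" "p\<^sub>w \<cdot> F r"] residue_pw_F_iw[of r] r0 by (simp add: mult.commute)
  have "c * ?x\<^sub>1 = a\<^sub>1 * (?x\<^sub>1 * b\<^sub>1 + ?x\<^sub>2 * b\<^sub>2) - b\<^sub>2 * (- a\<^sub>2 * ?x\<^sub>1 + a\<^sub>1 * ?x\<^sub>2)"
    "c * ?x\<^sub>2 = a\<^sub>2 * (?x\<^sub>1 * b\<^sub>1 + ?x\<^sub>2 * b\<^sub>2) + b\<^sub>1 * (- a\<^sub>2 * ?x\<^sub>1 + a\<^sub>1 * ?x\<^sub>2)"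
    unfolding ab_eq[symmetric] by (simp_all add: algebra_simps)
  then have "?x\<^sub>1 = 0" "?x\<^sub>2 = 0" unfolding 1 2 using c_nonzero by simp_all
  then show ?thesis using residue_FA[of j "p\<^sub>w \<cdot> F r"] by simp
qed

text \<open>Dual: the column of \<open>F r \<cdot> i\<^sub>w\<close> is killed by the rows a and
  \<open>p\<^sub>w\<close>.\<close>

lemma residue_F_iw:
  assumes q [simp]: "q \<in> Arr C" "Dom C q = FO A" "Cod C q = B"
    and r [simp]: "r \<in> Arr C" "Dom C r = A" "Cod C r = A" and r0: "residue A r = 0"
  shows "residue B (q \<cdot> F r \<cdot> i\<^sub>w) = 0"
proof -
  let ?y\<^sub>1 = "residue B (p\<^sub>1 \<cdot> F r \<cdot> i\<^sub>w)" and ?y\<^sub>2 = "residue B (p\<^sub>2 \<cdot> F r \<cdot> i\<^sub>w)"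
  have 1: "a\<^sub>1 * ?y\<^sub>1 + a\<^sub>2 * ?y\<^sub>2 = 0"
    using residue_adjoint_F[of "i\<^sub>w" r] by simp
  have 2: "- b\<^sub>2 * ?y\<^sub>1 + b\<^sub>1 * ?y\<^sub>2 = 0"
    using residue_FA[of "F r \<cdot> i\<^sub>w" "p\<^sub>w"] residue_pw_F_iw[of r] r0 by simp
  have "c * ?y\<^sub>1 = b\<^sub>1 * (a\<^sub>1 * ?y\<^sub>1 + a\<^sub>2 * ?y\<^sub>2) - a\<^sub>2 * (- b\<^sub>2 * ?y\<^sub>1 + b\<^sub>1 * ?y\<^sub>2)"
    "c * ?y\<^sub>2 = b\<^sub>2 * (a\<^sub>1 * ?y\<^sub>1 + a\<^sub>2 * ?y\<^sub>2) + a\<^sub>1 * (- b\<^sub>2 * ?y\<^sub>1 + b\<^sub>1 * ?y\<^sub>2)"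
    unfolding ab_eq[symmetric] by (simp_all add: algebra_simps)
  then have "?y\<^sub>1 = 0" "?y\<^sub>2 = 0" unfolding 1 2 using c_nonzero by simp_all
  then show ?thesis using residue_FA[of "F r \<cdot> i\<^sub>w" q] by simp
qed

section \<open>Nonzero maps through \<open>D\<close>, and the contradiction\<close>

text \<open>A triangle identity routes \<open>d\<close> times
  \<open>p\<^sub>w \<cdot> i\<^sub>w\<close>, of residue \<open>d * c\<close>, through
  \<open>F\<close> of the decomposition of \<open>FO B\<close>. The path through \<open>A\<close>
  dies because the transpose of \<open>i\<^sub>w\<close> has residue 0 there; the path through
  \<open>D\<close> is a multiple of the residue in question.\<close>

lemma residue_pw_through_D: "residue B (p\<^sub>w \<cdot> F (\<epsilon> A \<cdot> F i\<^sub>w \<cdot> j\<^sub>D) \<cdot> k\<^sub>B) \<noteq> 0"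
proof
  assume 0: "residue B (p\<^sub>w \<cdot> F (\<epsilon> A \<cdot> F i\<^sub>w \<cdot> j\<^sub>D) \<cdot> k\<^sub>B) = 0"
  let ?h = "\<lambda>j q. p\<^sub>w \<cdot> F (\<epsilon> A \<cdot> F i\<^sub>w \<cdot> j) \<cdot> F q \<cdot> \<eta> B"
  have "Scl C d (p\<^sub>w \<cdot> i\<^sub>w) = p\<^sub>w \<cdot> F (\<epsilon> A) \<cdot> F (F i\<^sub>w) \<cdot> \<eta> B"
    using zigzag_unit_assoc[of A "i\<^sub>w"] unit_natural[of "i\<^sub>w"] by simp
  also have "\<dots> = p\<^sub>w \<cdot> F (\<epsilon> A) \<cdot> F (F i\<^sub>w) \<cdot> F (Pls C (j\<^sub>A \<cdot> q\<^sub>A) (j\<^sub>D \<cdot> q\<^sub>D)) \<cdot> \<eta> B"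
    unfolding jq_sum by simp
  also have "\<dots> = Pls C (?h j\<^sub>A q\<^sub>A) (?h j\<^sub>D q\<^sub>D)" by simp
  finally have "residue B (Scl C d (p\<^sub>w \<cdot> i\<^sub>w)) = residue B (Pls C (?h j\<^sub>A q\<^sub>A) (?h j\<^sub>D q\<^sub>D))"
    by (rule arg_cong)
  then have sum: "d * c = residue B (?h j\<^sub>A q\<^sub>A) + residue B (?h j\<^sub>D q\<^sub>D)"
    by (simp add: residue_Scl residue_pw_iw residue_add)
  have "residue B (?h j\<^sub>A q\<^sub>A) = 0"
    by (rule residue_pw_F) (auto simp: residue_adjoint_iw)
  moreover have "residue B (?h j\<^sub>D q\<^sub>D) = 0"
    using residue_FD[of "F q\<^sub>D \<cdot> \<eta> B" "p\<^sub>w \<cdot> F (\<epsilon> A \<cdot> F i\<^sub>w \<cdot> j\<^sub>D)"] 0 by simp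
  ultimately show False using sum c_nonzero d_nonzero by simp
qed

text \<open>The dual argument, with the other triangle identity and the transpose of
  \<open>p\<^sub>w\<close>.\<close>

lemma residue_iw_through_D: "residue B (r\<^sub>B \<cdot> F (q\<^sub>D \<cdot> F p\<^sub>w \<cdot> \<eta> A) \<cdot> i\<^sub>w) \<noteq> 0"
proof
  assume 0: "residue B (r\<^sub>B \<cdot> F (q\<^sub>D \<cdot> F p\<^sub>w \<cdot> \<eta> A) \<cdot> i\<^sub>w) = 0"
  let ?h = "\<lambda>j q. \<epsilon> B \<cdot> F j \<cdot> F (q \<cdot> F p\<^sub>w \<cdot> \<eta> A) \<cdot> i\<^sub>w"
  have "Scl C d (p\<^sub>w \<cdot> i\<^sub>w) = p\<^sub>w \<cdot> \<epsilon> (FO A) \<cdot> F (\<eta> A) \<cdot> i\<^sub>w"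
    using zigzag_counit_assoc[of A "i\<^sub>w"] by simp
  also have "\<dots> = \<epsilon> B \<cdot> F (F p\<^sub>w) \<cdot> F (\<eta> A) \<cdot> i\<^sub>w"
    using counit_natural_assoc[of "p\<^sub>w" "F (\<eta> A) \<cdot> i\<^sub>w"] by simp
  also have "\<dots> = \<epsilon> B \<cdot> F (Pls C (j\<^sub>A \<cdot> q\<^sub>A) (j\<^sub>D \<cdot> q\<^sub>D)) \<cdot> F (F p\<^sub>w) \<cdot> F (\<eta> A) \<cdot> i\<^sub>w"
    unfolding jq_sum by simp
  also have "\<dots> = Pls C (?h j\<^sub>A q\<^sub>A) (?h j\<^sub>D q\<^sub>D)" by simp
  finally have "residue B (Scl C d (p\<^sub>w \<cdot> i\<^sub>w)) = residue B (Pls C (?h j\<^sub>A q\<^sub>A) (?h j\<^sub>D q\<^sub>D))"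
    by (rule arg_cong)
  then have sum: "d * c = residue B (?h j\<^sub>A q\<^sub>A) + residue B (?h j\<^sub>D q\<^sub>D)"
    by (simp add: residue_Scl residue_pw_iw residue_add)
  have "residue B (?h j\<^sub>A q\<^sub>A) = 0"
    using residue_F_iw[of "\<epsilon> B \<cdot> F j\<^sub>A" "q\<^sub>A \<cdot> F p\<^sub>w \<cdot> \<eta> A"] residue_coadjoint_pw by simp
  moreover have "residue B (?h j\<^sub>D q\<^sub>D) = 0"
    using residue_FD[of "F (q\<^sub>D \<cdot> F p\<^sub>w \<cdot> \<eta> A) \<cdot> i\<^sub>w" "\<epsilon> B \<cdot> F j\<^sub>D"] 0 by simp
  ultimately show False using sum c_nonzero d_nonzero by simp
qed

text \<open>As \<open>B\<close> occurs once in \<open>FO D\<close>, the two nonzero residues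
  multiply to that of \<open>p\<^sub>w \<cdot> F (?e \<cdot> ?n) \<cdot> i\<^sub>w\<close>, which is
  \<open>c\<close> times the residue of an endomorphism of \<open>A\<close> factoring through
  \<open>D\<close>, hence 0.\<close>

lemma contradiction: False
proof -
  let ?e = "\<epsilon> A \<cdot> F i\<^sub>w \<cdot> j\<^sub>D" and ?n = "q\<^sub>D \<cdot> F p\<^sub>w \<cdot> \<eta> A"
  have "residue B (p\<^sub>w \<cdot> F ?e \<cdot> k\<^sub>B) * residue B (r\<^sub>B \<cdot> F ?n \<cdot> i\<^sub>w) = residue B (p\<^sub>w \<cdot> F (?e \<cdot> ?n) \<cdot> i\<^sub>w)"
    using residue_FD[of "F ?n \<cdot> i\<^sub>w" "p\<^sub>w \<cdot> F ?e"] by simp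
  also have "\<dots> = c * residue A (?e \<cdot> ?n)"
    by (rule residue_pw_F_iw) auto
  also have "residue A (?e \<cdot> ?n) = 0"
    by (rule residue_through[OF local(1,3) not_iso(1)]) auto
  finally show False using residue_pw_through_D residue_iw_through_D by simp
qed

end

lemma (in self_adjoint_functor) no_type_B_start:
  assumes loc: "finite_local_object A" "finite_local_object B" "finite_local_object D" "finite_local_object E"
    and ni: "\<not> isomorphic C A D" "\<not> isomorphic C B E"
    and FA: "direct_sum_of C (FO A) B B"
    and FB: "direct_sum_of C (FO B) A D"
    and FD: "direct_sum_of C (FO D) B E"
  shows False
proof -
  from FA obtain i\<^sub>1 i\<^sub>2 p\<^sub>1 p\<^sub>2 where 1: "i\<^sub>1 \<in> homset C B (FO A)" "i\<^sub>2 \<in> homset C B (FO A)"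
    "p\<^sub>1 \<in> homset C (FO A) B" "p\<^sub>2 \<in> homset C (FO A) B"
    "p\<^sub>1 \<cdot> i\<^sub>1 = Idn C B" "p\<^sub>2 \<cdot> i\<^sub>2 = Idn C B" "p\<^sub>1 \<cdot> i\<^sub>2 = Nul C B B" "p\<^sub>2 \<cdot> i\<^sub>1 = Nul C B B"
    "Pls C (i\<^sub>1 \<cdot> p\<^sub>1) (i\<^sub>2 \<cdot> p\<^sub>2) = Idn C (FO A)"
    by (auto simp: direct_sum_of_def)
  from FB obtain j\<^sub>A j\<^sub>D q\<^sub>A q\<^sub>D where 2: "j\<^sub>A \<in> homset C A (FO B)" "j\<^sub>D \<in> homset C D (FO B)"
    "q\<^sub>A \<in> homset C (FO B) A" "q\<^sub>D \<in> homset C (FO B) D" "q\<^sub>A \<cdot> j\<^sub>A = Idn C A"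
    "Pls C (j\<^sub>A \<cdot> q\<^sub>A) (j\<^sub>D \<cdot> q\<^sub>D) = Idn C (FO B)"
    by (auto simp: direct_sum_of_def)
  from FD obtain k\<^sub>B k\<^sub>E r\<^sub>B r\<^sub>E where 3: "k\<^sub>B \<in> homset C B (FO D)" "k\<^sub>E \<in> homset C E (FO D)"
    "r\<^sub>B \<in> homset C (FO D) B" "r\<^sub>E \<in> homset C (FO D) E"
    "Pls C (k\<^sub>B \<cdot> r\<^sub>B) (k\<^sub>E \<cdot> r\<^sub>E) = Idn C (FO D)"
    by (auto simp: direct_sum_of_def)
  interpret type_B_start C FO F \<eta> \<epsilon> c d A B D E i\<^sub>1 i\<^sub>2 p\<^sub>1 p\<^sub>2 j\<^sub>A q\<^sub>A j\<^sub>D q\<^sub>D k\<^sub>B r\<^sub>B k\<^sub>E r\<^sub>E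
    by unfold_locales (use loc ni 1 2 3 in \<open>simp_all add: homset_def\<close>)
  show False by (rule contradiction)
qed


section \<open>The action of a self-dual object\<close>

text \<open>Strictness is asked of \<open>C\<close> alone, where the Kronecker product provides it;
  the structure isomorphisms of the action stay arbitrary.\<close>

locale self_dual_action = module_category C M
  for C :: "('v, 'f, 'y) mon_cat_scheme" and M :: "('o, 'a, 'v, 'f, 'z) mod_cat_scheme" +
  fixes V :: 'v and ev coev :: 'f and c d :: complex
  assumes strict_assoc: "\<lbrakk>S \<in> Obj C; T \<in> Obj C; U \<in> Obj C\<rbrakk> \<Longrightarrow> TenO C (TenO C S T) U = TenO C S (TenO C T U)"
    and strict_Asc: "\<lbrakk>S \<in> Obj C; T \<in> Obj C; U \<in> Obj C\<rbrakk> \<Longrightarrow> Asc C S T U = Idn C (TenO C S (TenO C T U))"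
    and strict_Unt [simp]: "T \<in> Obj C \<Longrightarrow> TenO C (Unt C) T = T" "T \<in> Obj C \<Longrightarrow> TenO C T (Unt C) = T"
    and strict_Run: "T \<in> Obj C \<Longrightarrow> Run C T = Idn C T"
    and V [simp]: "V \<in> Obj C"
    and coev: "coev \<in> homset C (Unt C) (TenO C V V)"
    and ev: "ev \<in> homset C (TenO C V V) (Unt C)"
    and ev_coev: "Cmp C ev coev = Scl C c (Idn C (Unt C))"
    and zigzag: "Cmp C (TenA C (Idn C V) ev) (TenA C coev (Idn C V)) = Scl C d (Idn C V)"
      "Cmp C (TenA C ev (Idn C V)) (TenA C (Idn C V) coev) = Scl C d (Idn C V)"
    and c_nonzero: "c \<noteq> 0" and d_nonzero: "d \<noteq> 0"
begin

lemma coev_simps [simp]: "coev \<in> Arr C" "Dom C coev = Unt C" "Cod C coev = TenO C V V"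
    "ev \<in> Arr C" "Dom C ev = TenO C V V" "Cod C ev = Unt C"
  using ev coev by (auto simp: homset_def)

lemma Obj_simps [simp]: "Unt C \<in> Obj C" "\<lbrakk>S \<in> Obj C; T \<in> Obj C\<rbrakk> \<Longrightarrow> TenO C S T \<in> Obj C"
    "\<lbrakk>T \<in> Obj C; X \<in> Obj M\<rbrakk> \<Longrightarrow> ActO M T X \<in> Obj M"
  using C.Unt_in C.TenO_in ActO_in by auto

lemma TenA_simps [simp]:
  assumes "f \<in> Arr C" "g \<in> Arr C"
  shows "TenA C f g \<in> Arr C" "Dom C (TenA C f g) = TenO C (Dom C f) (Dom C g)"
    "Cod C (TenA C f g) = TenO C (Cod C f) (Cod C g)"
  using C.TenA_in[of f "Dom C f" "Cod C f" g "Dom C g" "Cod C g"] assms by (auto simp: homset_def)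

lemma TenA_Idn' [simp]: "\<lbrakk>S \<in> Obj C; T \<in> Obj C\<rbrakk> \<Longrightarrow> TenA C (Idn C S) (Idn C T) = Idn C (TenO C S T)"
  by (rule C.TenA_Idn)

lemma ActA_simps [simp]:
  assumes "f \<in> Arr C" "u \<in> Arr M"
  shows "ActA M f u \<in> Arr M" "Dom M (ActA M f u) = ActO M (Dom C f) (Dom M u)"
    "Cod M (ActA M f u) = ActO M (Cod C f) (Cod M u)"
  using ActA_in[of f "Dom C f" "Cod C f" u "Dom M u" "Cod M u"] assms by (auto simp: homset_def)

lemma ActA_Idn' [simp]: "\<lbrakk>T \<in> Obj C; X \<in> Obj M\<rbrakk> \<Longrightarrow> ActA M (Idn C T) (Idn M X) = Idn M (ActO M T X)"
  by (rule ActA_Idn)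

lemma ActA_Cmp':
  assumes "f \<in> Arr C" "g \<in> Arr C" "Dom C g = Cod C f" "u \<in> Arr M" "v \<in> Arr M" "Dom M v = Cod M u"
  shows "Cmp M (ActA M g v) (ActA M f u) = ActA M (Cmp C g f) (Cmp M v u)"
  using ActA_Cmp[of f "Dom C f" "Cod C f" g "Cod C g" u "Dom M u" "Cod M u" v "Cod M v"] assms
  by (auto simp: homset_def)

lemma ActA_linear:
  assumes f: "f \<in> Arr C" and u: "u \<in> Arr M"
  shows "ActA M (Scl C a f) u = Scl M a (ActA M f u)" "ActA M f (Scl M a u) = Scl M a (ActA M f u)"
    "\<lbrakk>v \<in> Arr M; Dom M v = Dom M u; Cod M v = Cod M u\<rbrakk>
      \<Longrightarrow> ActA M f (Pls M u v) = Pls M (ActA M f u) (ActA M f v)"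
proof -
  interpret l: linear_map complex_field "homsp C (Dom C f) (Cod C f)"
    "homsp M (ActO M (Dom C f) (Dom M u)) (ActO M (Cod C f) (Cod M u))" "\<lambda>f. ActA M f u"
    by (rule ActA_linear_left) (use f u in \<open>auto simp: homset_def\<close>)
  interpret r: linear_map complex_field "homsp M (Dom M u) (Cod M u)"
    "homsp M (ActO M (Dom C f) (Dom M u)) (ActO M (Cod C f) (Cod M u))" "\<lambda>u. ActA M f u"
    by (rule ActA_linear_right) (use f u in \<open>auto simp: homset_def\<close>)
  show "ActA M (Scl C a f) u = Scl M a (ActA M f u)" "ActA M f (Scl M a u) = Scl M a (ActA M f u)"
    using l.T_smult[of a f] r.T_smult[of a u] f u by (auto simp: homsp_def homset_def)
  show "\<lbrakk>v \<in> Arr M; Dom M v = Dom M u; Cod M v = Cod M u\<rbrakk>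
      \<Longrightarrow> ActA M f (Pls M u v) = Pls M (ActA M f u) (ActA M f v)"
    using r.T_add[of u v] u by (auto simp: homsp_def homset_def)
qed

abbreviation "\<phi> \<equiv> ActAsc M"
abbreviation "\<upsilon> \<equiv> ActUn M"
abbreviation "\<phi>' S T X \<equiv> M.inverse_arr (\<phi> S T X)"
abbreviation "\<upsilon>' X \<equiv> M.inverse_arr (\<upsilon> X)"
abbreviation "idC \<equiv> Idn C"
abbreviation "idM \<equiv> Idn M"

lemma \<phi>_simps [simp]:
  assumes "S \<in> Obj C" "T \<in> Obj C" "X \<in> Obj M"
  shows "\<phi> S T X \<in> Arr M" "Dom M (\<phi> S T X) = ActO M (TenO C S T) X"
    "Cod M (\<phi> S T X) = ActO M S (ActO M T X)"
    "\<phi>' S T X \<in> Arr M" "Cod M (\<phi>' S T X) = ActO M (TenO C S T) X"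
    "Dom M (\<phi>' S T X) = ActO M S (ActO M T X)"
    "Cmp M (\<phi>' S T X) (\<phi> S T X) = idM (ActO M (TenO C S T) X)"
    "Cmp M (\<phi> S T X) (\<phi>' S T X) = idM (ActO M S (ActO M T X))"
  using M.inverse_arr[OF ActAsc_iso[OF assms]] ActAsc_iso[OF assms]
  by (auto simp: is_iso_def homset_def)

lemma \<upsilon>_simps [simp]:
  assumes "X \<in> Obj M"
  shows "\<upsilon> X \<in> Arr M" "Dom M (\<upsilon> X) = ActO M (Unt C) X" "Cod M (\<upsilon> X) = X"
    "\<upsilon>' X \<in> Arr M" "Cod M (\<upsilon>' X) = ActO M (Unt C) X" "Dom M (\<upsilon>' X) = X"
    "Cmp M (\<upsilon>' X) (\<upsilon> X) = idM (ActO M (Unt C) X)" "Cmp M (\<upsilon> X) (\<upsilon>' X) = idM X"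
  using M.inverse_arr[OF ActUn_iso[OF assms]] ActUn_iso[OF assms]
  by (auto simp: is_iso_def homset_def)

lemma \<phi>_natural:
  assumes "f \<in> Arr C" "g \<in> Arr C" "u \<in> Arr M"
  shows "Cmp M (\<phi> (Cod C f) (Cod C g) (Cod M u)) (ActA M (TenA C f g) u) =
     Cmp M (ActA M f (ActA M g u)) (\<phi> (Dom C f) (Dom C g) (Dom M u))"
  by (rule ActAsc_natural) (use assms in \<open>auto simp: homset_def\<close>)

lemma \<upsilon>_natural: "u \<in> Arr M \<Longrightarrow> Cmp M (\<upsilon> (Cod M u)) (ActA M (idC (Unt C)) u) = Cmp M u (\<upsilon> (Dom M u))"
  by (rule ActUn_natural) (auto simp: homset_def)

text \<open>The associator of \<open>C\<close> is an identity and acts as one, so the pentagon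
  becomes a square.\<close>

lemma strict_pentagon:
  assumes [simp]: "S \<in> Obj C" "T \<in> Obj C" "U \<in> Obj C" "X \<in> Obj M"
  shows "Cmp M (ActA M (idC S) (\<phi> T U X)) (\<phi> S (TenO C T U) X) = Cmp M (\<phi> S T (ActO M U X)) (\<phi> (TenO C S T) U X)"
  using Act_pentagon[OF assms] by (simp add: strict_Asc)

lemma strict_triangle:
  assumes [simp]: "T \<in> Obj C" "X \<in> Obj M"
  shows "Cmp M (ActA M (idC T) (\<upsilon> X)) (\<phi> T (Unt C) X) = idM (ActO M T X)"
  using Act_triangle[OF assms] by (simp add: strict_Run)

text \<open>Kelly's argument: the unit axiom for the other position of the unit follows from the
  pentagon and the triangle, since acting with the unit object is faithful.\<close>

lemma unit_left:
  assumes [simp]: "T \<in> Obj C" "X \<in> Obj M"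
  shows "Cmp M (\<upsilon> (ActO M T X)) (\<phi> (Unt C) T X) = idM (ActO M T X)"
proof -
  let ?I = "Unt C"
  let ?g = "Cmp M (\<upsilon> (ActO M T X)) (\<phi> ?I T X)"
  \<comment> \<open>The pentagon at two unit objects; the common right factor cancels.\<close>
  have "Cmp M (ActA M (idC ?I) (\<phi> ?I T X)) (\<phi> ?I T X) = Cmp M (\<phi> ?I ?I (ActO M T X)) (\<phi> ?I T X)"
    using strict_pentagon[of ?I ?I T X] by simp
  then have "Cmp M (Cmp M (ActA M (idC ?I) (\<phi> ?I T X)) (\<phi> ?I T X)) (\<phi>' ?I T X) =
     Cmp M (Cmp M (\<phi> ?I ?I (ActO M T X)) (\<phi> ?I T X)) (\<phi>' ?I T X)" by (simp only:)
  then have eq: "ActA M (idC ?I) (\<phi> ?I T X) = \<phi> ?I ?I (ActO M T X)" by simp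
  have "ActA M (idC ?I) ?g = Cmp M (ActA M (idC ?I) (\<upsilon> (ActO M T X))) (ActA M (idC ?I) (\<phi> ?I T X))"
    by (simp add: ActA_Cmp')
  also have "\<dots> = idM (ActO M ?I (ActO M T X))"
    unfolding eq using strict_triangle[of ?I "ActO M T X"] by simp
  \<comment> \<open>Faithfulness in action: the unit object acts on \<open>?g\<close> as an
    identity, and naturality of \<open>\<upsilon>\<close> carries this over to
    \<open>?g\<close>.\<close>
  finally have "Cmp M ?g (\<upsilon> (ActO M T X)) = \<upsilon> (ActO M T X)"
    using \<upsilon>_natural[of ?g] by simp
  then have "Cmp M (Cmp M ?g (\<upsilon> (ActO M T X))) (\<upsilon>' (ActO M T X)) = Cmp M (\<upsilon> (ActO M T X)) (\<upsilon>' (ActO M T X))"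
    by (simp only:)
  then show ?thesis by simp
qed

section \<open>The adjunction induced by the duality\<close>

definition "unit X = Cmp M (\<phi> V V X) (Cmp M (ActA M coev (idM X)) (\<upsilon>' X))"
definition "counit X = Cmp M (\<upsilon> X) (Cmp M (ActA M ev (idM X)) (\<phi>' V V X))"

lemma unit_simps [simp]:
  assumes "X \<in> Obj M"
  shows "unit X \<in> Arr M" "Dom M (unit X) = X" "Cod M (unit X) = ActO M V (ActO M V X)"
    "counit X \<in> Arr M" "Cod M (counit X) = X" "Dom M (counit X) = ActO M V (ActO M V X)"
  using assms by (auto simp: unit_def counit_def)

text \<open>Three naturality squares are pasted: for the inverse of \<open>\<upsilon>\<close>, for
  \<open>coev\<close> by interchange, and for \<open>\<phi>\<close>.\<close>

lemma unit_natural: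
  assumes [simp]: "f \<in> Arr M"
  shows "Cmp M (unit (Cod M f)) f = Cmp M (ActA M (idC V) (ActA M (idC V) f)) (unit (Dom M f))"
proof -
  let ?X = "Dom M f" and ?Y = "Cod M f" and ?I = "Unt C"
  have u: "Cmp M (\<upsilon>' ?Y) f = Cmp M (ActA M (idC ?I) f) (\<upsilon>' ?X)"
    by (rule M.Cmp_swap[OF \<upsilon>_natural]) auto
  have a: "Cmp M (ActA M coev (idM ?Y)) (ActA M (idC ?I) f) = Cmp M (ActA M (idC (TenO C V V)) f) (ActA M coev (idM ?X))"
    by (simp add: ActA_Cmp')
  have p: "Cmp M (\<phi> V V ?Y) (ActA M (idC (TenO C V V)) f) = Cmp M (ActA M (idC V) (ActA M (idC V) f)) (\<phi> V V ?X)"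
    using \<phi>_natural[of "idC V" "idC V" f] by simp
  have "Cmp M (unit ?Y) f = Cmp M (\<phi> V V ?Y) (Cmp M (ActA M coev (idM ?Y)) (Cmp M (\<upsilon>' ?Y) f))"
    by (simp add: unit_def)
  also have "\<dots> = Cmp M (\<phi> V V ?Y) (Cmp M (Cmp M (ActA M coev (idM ?Y)) (ActA M (idC ?I) f)) (\<upsilon>' ?X))"
    unfolding u by simp
  also have "\<dots> = Cmp M (Cmp M (\<phi> V V ?Y) (ActA M (idC (TenO C V V)) f)) (Cmp M (ActA M coev (idM ?X)) (\<upsilon>' ?X))"
    unfolding a by simp
  also have "\<dots> = Cmp M (ActA M (idC V) (ActA M (idC V) f)) (unit ?X)"
    unfolding p by (simp add: unit_def)
  finally show ?thesis .
qed

lemma counit_natural: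
  assumes [simp]: "f \<in> Arr M"
  shows "Cmp M (counit (Cod M f)) (ActA M (idC V) (ActA M (idC V) f)) = Cmp M f (counit (Dom M f))"
proof -
  let ?X = "Dom M f" and ?Y = "Cod M f" and ?I = "Unt C" and ?FF = "ActA M (idC V) (ActA M (idC V) f)"
  have a: "Cmp M (ActA M ev (idM ?Y)) (ActA M (idC (TenO C V V)) f) = Cmp M (ActA M (idC ?I) f) (ActA M ev (idM ?X))"
    by (simp add: ActA_Cmp')
  have p: "Cmp M (\<phi>' V V ?Y) ?FF = Cmp M (ActA M (idC (TenO C V V)) f) (\<phi>' V V ?X)"
    by (rule M.Cmp_swap[OF \<phi>_natural[of "idC V" "idC V" f, simplified]]) auto
  have "Cmp M (counit ?Y) ?FF = Cmp M (\<upsilon> ?Y) (Cmp M (ActA M ev (idM ?Y)) (Cmp M (\<phi>' V V ?Y) ?FF))"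
    by (simp add: counit_def)
  also have "\<dots> = Cmp M (\<upsilon> ?Y) (Cmp M (Cmp M (ActA M ev (idM ?Y)) (ActA M (idC (TenO C V V)) f)) (\<phi>' V V ?X))"
    unfolding p by simp
  also have "\<dots> = Cmp M (Cmp M (\<upsilon> ?Y) (ActA M (idC ?I) f)) (Cmp M (ActA M ev (idM ?X)) (\<phi>' V V ?X))"
    unfolding a by simp
  also have "\<dots> = Cmp M f (counit ?X)"
    unfolding \<upsilon>_natural[OF assms] by (simp add: counit_def)
  finally show ?thesis .
qed

lemma counit_unit:
  assumes [simp]: "X \<in> Obj M"
  shows "Cmp M (counit X) (unit X) = Scl M c (idM X)"
proof -
  have "Cmp M (counit X) (unit X) = Cmp M (\<upsilon> X) (Cmp M (ActA M ev (idM X))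
      (Cmp M (Cmp M (\<phi>' V V X) (\<phi> V V X)) (Cmp M (ActA M coev (idM X)) (\<upsilon>' X))))"
    by (simp add: unit_def counit_def del: \<phi>_simps(7,8))
  also have "\<dots> = Cmp M (\<upsilon> X) (Cmp M (Cmp M (ActA M ev (idM X)) (ActA M coev (idM X))) (\<upsilon>' X))"
    by simp
  also have "Cmp M (ActA M ev (idM X)) (ActA M coev (idM X)) = Scl M c (idM (ActO M (Unt C) X))"
    by (simp add: ActA_Cmp' ev_coev ActA_linear)
  finally show ?thesis by simp
qed

text \<open>The pentagon (1), naturality of associativity (2, 3) and the unit laws collect the
  composite into the action of the zigzag of \<open>V\<close> on \<open>X\<close>.\<close>

lemma zigzag_unit:
  assumes [simp]: "X \<in> Obj M"
  shows "Cmp M (ActA M (idC V) (counit X)) (unit (ActO M V X)) = Scl M d (idM (ActO M V X))"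
proof -
  let ?V = "idC V" and ?VV = "TenO C V V" and ?I = "Unt C" and ?VX = "ActO M V X"
  note [simp] = strict_assoc
  have 1: "Cmp M (ActA M ?V (\<phi>' V V X)) (\<phi> V V ?VX) = Cmp M (\<phi> V ?VV X) (\<phi>' ?VV V X)"
    by (rule M.Cmp_swap[OF strict_pentagon]) (auto simp: ActA_Cmp')
  have 2: "Cmp M (ActA M ?V (ActA M ev (idM X))) (\<phi> V ?VV X) = Cmp M (\<phi> V ?I X) (ActA M (TenA C ?V ev) (idM X))"
    using \<phi>_natural[of ?V ev "idM X"] by simp
  have 3: "Cmp M (\<phi>' ?VV V X) (ActA M coev (idM ?VX)) = Cmp M (ActA M (TenA C coev ?V) (idM X)) (\<phi>' ?I V X)"
    by (rule M.Cmp_swap[OF \<phi>_natural[of coev ?V "idM X", simplified]]) auto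
  \<comment> \<open>\<open>unit_left\<close> exhibits \<open>\<upsilon>\<close> as a left inverse of
    the isomorphism \<open>\<phi>\<close>, hence as its inverse.\<close>
  have "\<phi>' ?I V X = \<upsilon> ?VX"
  proof -
    have "Cmp M (\<upsilon> ?VX) (Cmp M (\<phi> ?I V X) (\<phi>' ?I V X)) = Cmp M (Cmp M (\<upsilon> ?VX) (\<phi> ?I V X)) (\<phi>' ?I V X)"
      by (simp del: \<phi>_simps(7,8))
    also have "\<dots> = \<phi>' ?I V X" unfolding unit_left[OF V assms] by simp
    finally show ?thesis by simp
  qed
  then have 4: "Cmp M (\<phi>' ?I V X) (\<upsilon>' ?VX) = idM ?VX" by simp
  have "Cmp M (ActA M ?V (counit X)) (unit ?VX) =
      Cmp M (ActA M ?V (\<upsilon> X)) (Cmp M (ActA M ?V (ActA M ev (idM X)))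
       (Cmp M (Cmp M (ActA M ?V (\<phi>' V V X)) (\<phi> V V ?VX)) (Cmp M (ActA M coev (idM ?VX)) (\<upsilon>' ?VX))))"
  proof -
    have "ActA M ?V (counit X) = Cmp M (ActA M ?V (\<upsilon> X)) (Cmp M (ActA M ?V (ActA M ev (idM X))) (ActA M ?V (\<phi>' V V X)))"
      by (simp add: counit_def ActA_Cmp')
    then show ?thesis by (simp add: unit_def)
  qed
  also have "\<dots> = Cmp M (ActA M ?V (\<upsilon> X)) (Cmp M (Cmp M (ActA M ?V (ActA M ev (idM X))) (\<phi> V ?VV X))
       (Cmp M (Cmp M (\<phi>' ?VV V X) (ActA M coev (idM ?VX))) (\<upsilon>' ?VX)))"
    unfolding 1 by simp
  also have "\<dots> = Cmp M (Cmp M (ActA M ?V (\<upsilon> X)) (\<phi> V ?I X)) (Cmp M (Cmp M (ActA M (TenA C ?V ev) (idM X))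
       (ActA M (TenA C coev ?V) (idM X))) (Cmp M (\<phi>' ?I V X) (\<upsilon>' ?VX)))"
    unfolding 2 3 by simp
  also have "\<dots> = Scl M d (idM ?VX)"
    unfolding 4 strict_triangle[OF V assms] by (simp add: ActA_Cmp' zigzag ActA_linear)
  finally show ?thesis .
qed

lemma zigzag_counit:
  assumes [simp]: "X \<in> Obj M"
  shows "Cmp M (counit (ActO M V X)) (ActA M (idC V) (unit X)) = Scl M d (idM (ActO M V X))"
proof -
  let ?V = "idC V" and ?VV = "TenO C V V" and ?I = "Unt C" and ?VX = "ActO M V X"
  note [simp] = strict_assoc
  have 1: "Cmp M (\<phi>' V V ?VX) (ActA M ?V (\<phi> V V X)) = Cmp M (\<phi> ?VV V X) (\<phi>' V ?VV X)"
    by (rule M.Cmp_swap[OF strict_pentagon[symmetric]]) auto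
  have 2: "Cmp M (ActA M ev (idM ?VX)) (\<phi> ?VV V X) = Cmp M (\<phi> ?I V X) (ActA M (TenA C ev ?V) (idM X))"
    using \<phi>_natural[of ev ?V "idM X"] by simp
  have 3: "Cmp M (\<phi>' V ?VV X) (ActA M ?V (ActA M coev (idM X))) = Cmp M (ActA M (TenA C ?V coev) (idM X)) (\<phi>' V ?I X)"
    by (rule M.Cmp_swap[OF \<phi>_natural[of ?V coev "idM X", simplified]]) auto
  \<comment> \<open>Here the unit stands on the right, so the triangle axiom replaces
    \<open>unit_left\<close>.\<close>
  have "\<phi>' V ?I X = ActA M ?V (\<upsilon> X)"
  proof -
    have "Cmp M (ActA M ?V (\<upsilon> X)) (Cmp M (\<phi> V ?I X) (\<phi>' V ?I X)) = Cmp M (Cmp M (ActA M ?V (\<upsilon> X)) (\<phi> V ?I X)) (\<phi>' V ?I X)"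
      by (simp del: \<phi>_simps(7,8))
    also have "\<dots> = \<phi>' V ?I X" unfolding strict_triangle[OF V assms] by simp
    finally show ?thesis by simp
  qed
  then have 4: "Cmp M (\<phi>' V ?I X) (ActA M ?V (\<upsilon>' X)) = idM ?VX" by (simp add: ActA_Cmp')
  have "Cmp M (counit ?VX) (ActA M ?V (unit X)) =
      Cmp M (\<upsilon> ?VX) (Cmp M (ActA M ev (idM ?VX)) (Cmp M (Cmp M (\<phi>' V V ?VX) (ActA M ?V (\<phi> V V X)))
       (Cmp M (ActA M ?V (ActA M coev (idM X))) (ActA M ?V (\<upsilon>' X)))))"
  proof -
    have "ActA M ?V (unit X) = Cmp M (ActA M ?V (\<phi> V V X)) (Cmp M (ActA M ?V (ActA M coev (idM X))) (ActA M ?V (\<upsilon>' X)))"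
      by (simp add: unit_def ActA_Cmp')
    then show ?thesis by (simp add: counit_def)
  qed
  also have "\<dots> = Cmp M (\<upsilon> ?VX) (Cmp M (Cmp M (ActA M ev (idM ?VX)) (\<phi> ?VV V X))
       (Cmp M (Cmp M (\<phi>' V ?VV X) (ActA M ?V (ActA M coev (idM X)))) (ActA M ?V (\<upsilon>' X))))"
    unfolding 1 by simp
  also have "\<dots> = Cmp M (Cmp M (\<upsilon> ?VX) (\<phi> ?I V X)) (Cmp M (Cmp M (ActA M (TenA C ev ?V) (idM X))
       (ActA M (TenA C ?V coev) (idM X))) (Cmp M (\<phi>' V ?I X) (ActA M ?V (\<upsilon>' X))))"
    unfolding 2 3 by simp
  also have "\<dots> = Scl M d (idM ?VX)"
    unfolding 4 unit_left[OF V assms] by (simp add: ActA_Cmp' zigzag ActA_linear)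
  finally show ?thesis .
qed

lemma self_adjoint_functor: "self_adjoint_functor M (ActO M V) (ActA M (idC V)) unit counit c d"
  by unfold_locales
    (simp_all add: ActA_Cmp' ActA_linear unit_natural counit_natural counit_unit zigzag_unit zigzag_counit
      c_nonzero d_nonzero)

end

section \<open>The natural module is self-dual\<close>

text \<open>The antisymmetric vector e_0 (x) e_1 - e_1 (x) e_0; with index 2 i + j its nonzero
  entries sit at 1 and 2. \<open>sl2_ev\<close> is the determinant form.\<close>

definition sl2_coev :: sl2_hom
  where "sl2_coev = (sl2_trivial, mat 4 1 (\<lambda>(i, j). if i = 1 then 1 else if i = 2 then -1 else 0),
    sl2_tensor sl2_natural sl2_natural)"

definition sl2_ev :: sl2_hom
  where "sl2_ev = (sl2_tensor sl2_natural sl2_natural,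
    mat 1 4 (\<lambda>(i, j). if j = 1 then 1 else if j = 2 then -1 else 0), sl2_trivial)"

lemma vdim_natural [simp]: "vdim sl2_natural = 2"
  by (simp add: sl2_natural_def)

lemma less_4_cases: "(i::nat) < 4 \<Longrightarrow> i = 0 \<or> i = 1 \<or> i = 2 \<or> i = 3"
  by arith

lemma rep_tensor_natural:
  "A \<in> sl2 \<Longrightarrow> rep (sl2_tensor sl2_natural sl2_natural) A = A \<otimes>\<^sub>m 1\<^sub>m 2 + 1\<^sub>m 2 \<otimes>\<^sub>m A"
  by (simp add: sl2_tensor_def sl2_natural_def)

lemma sl2_carrier: "A \<in> sl2 \<Longrightarrow> A \<in> carrier_mat 2 2" "A \<in> sl2 \<Longrightarrow> A $$ (1, 1) = - A $$ (0, 0)"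
  by (simp_all add: sl2_def add_eq_0_iff)

text \<open>A matrix acts on the antisymmetric vector by its trace, which is 0.\<close>

lemma is_sl2_hom_coev: "is_sl2_hom sl2_coev"
proof -
  have "mat 4 1 (\<lambda>(i, j). if i = 1 then 1 else if i = 2 then -1 else 0) * 0\<^sub>m 1 1 =
      (A \<otimes>\<^sub>m 1\<^sub>m 2 + 1\<^sub>m 2 \<otimes>\<^sub>m A) * mat 4 1 (\<lambda>(i, j). if i = 1 then 1 else if i = 2 then -1 else 0)"
    if "A \<in> sl2" for A
  proof (rule eq_matI, goal_cases)
    case (1 i j)
    then have i: "i < 4" "j = 0" using sl2_carrier[OF that] by auto
    from less_4_cases[OF i(1)] show ?case using sl2_carrier[OF that] i(2)
      by (elim disjE) (auto simp: scalar_prod_def kron_index atLeastLessThan_nat_numeral)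
  qed (use sl2_carrier[OF that] in auto)
  then show ?thesis
    by (simp add: sl2_coev_def is_sl2_hom_def is_sl2_module_trivial is_sl2_module_natural
        is_sl2_module_tensor rep_tensor_natural) (simp add: sl2_trivial_def)
qed

text \<open>Dually, a matrix acts on the determinant form through its trace.\<close>

lemma is_sl2_hom_ev: "is_sl2_hom sl2_ev"
proof -
  have "mat 1 4 (\<lambda>(i, j). if j = 1 then 1 else if j = 2 then -1 else 0) * (A \<otimes>\<^sub>m 1\<^sub>m 2 + 1\<^sub>m 2 \<otimes>\<^sub>m A) =
      0\<^sub>m 1 1 * mat 1 4 (\<lambda>(i, j). if j = 1 then 1 else if j = 2 then -1 else 0)"
    if "A \<in> sl2" for A
  proof (rule eq_matI, goal_cases)
    case (1 i j)
    then have i: "j < 4" "i = 0" using sl2_carrier[OF that] by auto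
    from less_4_cases[OF i(1)] show ?case using sl2_carrier[OF that] i(2)
      by (elim disjE) (auto simp: scalar_prod_def kron_index atLeastLessThan_nat_numeral)
  qed (use sl2_carrier[OF that] in auto)
  then show ?thesis
    by (simp add: sl2_ev_def is_sl2_hom_def is_sl2_module_trivial is_sl2_module_natural
        is_sl2_module_tensor rep_tensor_natural) (simp add: sl2_trivial_def)
qed

lemma ev_coev_matrix:
  "mat 1 4 (\<lambda>(i, j). if j = 1 then 1 else if j = 2 then -1 else 0) *
   mat 4 1 (\<lambda>(i, j). if i = 1 then 1 else if i = 2 then -1 else 0) = (2::complex) \<cdot>\<^sub>m 1\<^sub>m 1"
  by (rule eq_matI) (auto simp: scalar_prod_def atLeastLessThan_nat_numeral)

text \<open>The first zigzag sends e_0 to ev(e_1, e_0) e_0 = -e_0. Negating \<open>k\<close> would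
  change -1 into 1, and the loop value 2 into -2.\<close>

lemma zigzag_matrix:
  fixes e :: "complex mat" and k :: "complex mat"
  assumes e: "e = mat 1 4 (\<lambda>(i, j). if j = 1 then 1 else if j = 2 then -1 else 0)"
    and k: "k = mat 4 1 (\<lambda>(i, j). if i = 1 then 1 else if i = 2 then -1 else 0)"
  shows "(1\<^sub>m 2 \<otimes>\<^sub>m e) * (k \<otimes>\<^sub>m 1\<^sub>m 2) = (-1) \<cdot>\<^sub>m 1\<^sub>m 2"
    and "(e \<otimes>\<^sub>m 1\<^sub>m 2) * (1\<^sub>m 2 \<otimes>\<^sub>m k) = (-1) \<cdot>\<^sub>m 1\<^sub>m 2"
proof -
  have "((1\<^sub>m 2 \<otimes>\<^sub>m e) * (k \<otimes>\<^sub>m 1\<^sub>m 2)) $$ (i, j) = ((-1) \<cdot>\<^sub>m 1\<^sub>m 2) $$ (i, j)"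
    "((e \<otimes>\<^sub>m 1\<^sub>m 2) * (1\<^sub>m 2 \<otimes>\<^sub>m k)) $$ (i, j) = ((-1) \<cdot>\<^sub>m 1\<^sub>m 2) $$ (i, j)" if "i < 2" "j < 2" for i j
    using less_2_cases[OF that(1)] less_2_cases[OF that(2)]
    by (elim disjE; simp add: e k scalar_prod_def kron_index atLeastLessThan_nat_numeral)+
  then show "(1\<^sub>m 2 \<otimes>\<^sub>m e) * (k \<otimes>\<^sub>m 1\<^sub>m 2) = (-1) \<cdot>\<^sub>m 1\<^sub>m 2"
    "(e \<otimes>\<^sub>m 1\<^sub>m 2) * (1\<^sub>m 2 \<otimes>\<^sub>m k) = (-1) \<cdot>\<^sub>m 1\<^sub>m 2"
    by (auto intro!: eq_matI simp: e k)
qed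

lemma self_dual_action_natural:
  assumes "module_category sl2_modules M"
  shows "self_dual_action sl2_modules M sl2_natural sl2_ev sl2_coev 2 (-1)"
proof -
  interpret module_category sl2_modules M by (rule assms)
  show ?thesis
  proof
    show "sl2_coev \<in> homset sl2_modules (Unt sl2_modules) (TenO sl2_modules sl2_natural sl2_natural)"
      using is_sl2_hom_coev by (auto simp: homset_def sl2_coev_def)
    show "sl2_ev \<in> homset sl2_modules (TenO sl2_modules sl2_natural sl2_natural) (Unt sl2_modules)"
      using is_sl2_hom_ev by (auto simp: homset_def sl2_ev_def)
    show "Cmp sl2_modules sl2_ev sl2_coev = Scl sl2_modules 2 (Idn sl2_modules (Unt sl2_modules))"
      using ev_coev_matrix by (simp add: sl2_ev_def sl2_coev_def)
    show "Cmp sl2_modules (TenA sl2_modules (Idn sl2_modules sl2_natural) sl2_ev)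
         (TenA sl2_modules sl2_coev (Idn sl2_modules sl2_natural)) = Scl sl2_modules (-1) (Idn sl2_modules sl2_natural)"
      "Cmp sl2_modules (TenA sl2_modules sl2_ev (Idn sl2_modules sl2_natural))
         (TenA sl2_modules (Idn sl2_modules sl2_natural) sl2_coev) = Scl sl2_modules (-1) (Idn sl2_modules sl2_natural)"
      using zigzag_matrix by (simp_all add: sl2_ev_def sl2_coev_def sl2_tensor_trivial is_sl2_module_natural)
  qed (simp_all add: sl2_tensor_assoc sl2_tensor_trivial is_sl2_module_natural mult.assoc)
qed

theorem proposition23:
  shows "\<not> (\<exists>M :: ('o, 'a, sl2_module, sl2_hom) mod_cat.
    module_category sl2_modules M \<and> locally_finitary M \<and> admissible M \<and>
    simple_transitive sl2_modules M \<and> type_B_infinity M)"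
proof
  assume "\<exists>M :: ('o, 'a, sl2_module, sl2_hom) mod_cat.
    module_category sl2_modules M \<and> locally_finitary M \<and> admissible M \<and>
    simple_transitive sl2_modules M \<and> type_B_infinity M"
  then obtain M :: "('o, 'a, sl2_module, sl2_hom) mod_cat"
    where mod: "module_category sl2_modules M" and fin: "locally_finitary M" and B: "type_B_infinity M"
    by blast
  note F = self_dual_action.self_adjoint_functor[OF self_dual_action_natural[OF mod]]
  note lin = self_adjoint_functor.axioms(1)[OF F]
  from B obtain X :: "nat \<Rightarrow> 'o" where X: "\<forall>i\<ge>1. indecomposable M (X i)"
    and ni: "\<forall>i\<ge>1. \<forall>j\<ge>1. isomorphic M (X i) (X j) \<longrightarrow> i = j"
    and X1: "direct_sum_of M (ActO M sl2_natural (X 1)) (X 2) (X 2)"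
    and Xi: "\<forall>i\<ge>2. direct_sum_of M (ActO M sl2_natural (X i)) (X (i - 1)) (X (i + 1))"
    unfolding type_B_infinity_def by blast
  have loc: "linear_category.finite_local_object M (X i)" if "i \<ge> 1" for i
    using X that by (intro linear_category.indecomposable_finite_local_object[OF lin fin]) simp
  show False
  \<comment> \<open>\<open>X 1\<close>, \<open>X 2\<close>, \<open>X 3\<close>, \<open>X 4\<close>
    serve as \<open>A\<close>, \<open>B\<close>, \<open>D\<close>, \<open>E\<close>.\<close>
  proof (rule self_adjoint_functor.no_type_B_start[OF F])
    show "direct_sum_of M (ActO M sl2_natural (X 2)) (X 1) (X 3)"
      "direct_sum_of M (ActO M sl2_natural (X 3)) (X 2) (X 4)"
      using Xi[rule_format, of 2] Xi[rule_format, of 3] by simp_all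
    show "\<not> isomorphic M (X 1) (X 3)" "\<not> isomorphic M (X 2) (X 4)"
      using ni[rule_format, of 1 3] ni[rule_format, of 2 4] by auto
  qed (use X1 loc in auto)
qed

end
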